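(* Let $d=4$. There exists a constant $c_{\mathrm{hit}}\in\mathbb{R}$ such that $$\mathbb{P}_{r,\infty}(N_1>0)=\frac{2}{r^2\log r}+\frac{2\log\log r+c_{\mathrm{hit}}}{r^2(\log r)^2}+o\Big(\frac{1}{r^2(\log r)^2}\Big)\quad\text{as } r\to\infty.$$ More generally, there exists a sequence of polynomials $(P_n)_{n\ge1}$ such that, for each $N\ge1$, $$\mathbb{P}_{r,\infty}(N_1>0)=\frac1{r^2}\sum_{n=1}^N\frac{P_n(\log\log r)}{(\log r)^n}+o\Big(\frac{1}{r^2(\log r)^N}\Big)\quad\text{as } r\to\infty.$$ The sequence $(P_n)_{n\ge1}$ can be described recursively as the unique sequence of polynomials with $P_1=2$, $P_2=2X+c_{\mathrm{hit}}$, and $$(2n-4)P_n-2P_n'=\sum_{k=2}^{n-1}P_kP_{n+1-k}-(n-1)nP_{n-1}+(2n-1)P_{n-1}'-P_{n-1}''$$ for every $n\ge3$.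
   Context: Critical binary branching Brownian motion in $\mathbb{R}^4$: each particle performs a standard Brownian motion for an independent exponential lifetime of mean $1$, and is then replaced at its current location by $0$ or $2$ particles with probability $1/2$ each, the offspring evolving independently in the same way. $\mathbb{P}_{r,\infty}$ is the law of this process (with no killing) started from a single particle at a point of norm $r$. $N_1$ is the number of pioneers on the closed unit ball $B$ centred at the origin, i.e. the number of points $v$ of the genealogical real tree whose position lies in $B$ while the positions of all strict ancestors lie outside $B$; thus $\{N_1>0\}$ is the event that some particle hits the unit ball. *)

theory Defs
  imports
    "HOL-Probability.Probability"
    "HOL-Library.Landau_Symbols"
    "HOL-Library.Sublist"
    "HOL-Computational_Algebra.Polynomial"
begin

text \<open>
  Standard Brownian motion in \<open>\<real>\<^sup>n\<close>, started at the origin, with time set \<open>[0, \<infinity>)\<close>. Values at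
  negative times are irrelevant. The normalisation and continuity hold surely rather than almost
  surely, so that hitting events are measurable without completing the measure.
\<close>

definition standard_brownian_motion :: "'w measure \<Rightarrow> (real \<Rightarrow> 'w \<Rightarrow> real ^ 'n) \<Rightarrow> bool" where
  "standard_brownian_motion M W \<longleftrightarrow>
     prob_space M \<and>
     (\<forall>t\<ge>0. W t \<in> borel_measurable M) \<and>
     (\<forall>\<omega>\<in>space M. W 0 \<omega> = 0 \<and> continuous_on {0..} (\<lambda>t. W t \<omega>)) \<and>
     (\<forall>s t. 0 \<le> s \<and> s < t \<longrightarrow>
        distributed M lborel (\<lambda>\<omega>. W t \<omega> - W s \<omega>)
          (\<lambda>x. ennreal (\<Prod>i\<in>UNIV. normal_density 0 (sqrt (t - s)) (x $ i)))) \<and>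
     (\<forall>(\<tau> :: nat \<Rightarrow> real) k. 0 \<le> \<tau> 0 \<and> mono \<tau> \<longrightarrow>
        prob_space.indep_vars M (\<lambda>_. borel)
          (\<lambda>i \<omega>. W (\<tau> (Suc i)) \<omega> - W (\<tau> i) \<omega>) {..<k})"

definition path_space :: "(real \<Rightarrow> real ^ 'n) measure" where
  "path_space = Pi\<^sub>M {0..} (\<lambda>_. borel)"

definition displacement_path :: "(real \<Rightarrow> 'w \<Rightarrow> real ^ 'n) \<Rightarrow> 'w \<Rightarrow> real \<Rightarrow> real ^ 'n" where
  "displacement_path W \<omega> = (\<lambda>t\<in>{0..}. W t \<omega>)"

text \<open>
  Potential particles are labelled by words over \<open>bool\<close>: the root is \<open>[]\<close>, and the two potential
  children of \<open>u\<close> are \<open>False # u\<close> and \<open>True # u\<close>, so the ancestors of a particle are the suffixes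
  of its label. Particle \<open>u\<close> moves relative to its birthplace by \<open>W u\<close>, lives for the time \<open>L u\<close>,
  and then has two children if \<open>\<xi> u\<close> and none otherwise.
\<close>

definition critical_binary_bbm ::
    "'w measure \<Rightarrow> (bool list \<Rightarrow> real \<Rightarrow> 'w \<Rightarrow> real ^ 'n) \<Rightarrow> (bool list \<Rightarrow> 'w \<Rightarrow> real) \<Rightarrow>
     (bool list \<Rightarrow> 'w \<Rightarrow> bool) \<Rightarrow> bool" where
  "critical_binary_bbm M W L \<xi> \<longleftrightarrow>
     prob_space M \<and>
     (\<forall>u. standard_brownian_motion M (W u)) \<and>
     (\<forall>u. distributed M lborel (L u) (exponential_density 1) \<and> (\<forall>\<omega>\<in>space M. 0 < L u \<omega>)) \<and>
     (\<forall>u. \<xi> u \<in> measurable M (count_space UNIV) \<and> measure M {\<omega> \<in> space M. \<xi> u \<omega>} = 1 / 2) \<and>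
     (\<forall>u. prob_space.indep_set M
            (sets (vimage_algebra (space M) (displacement_path (W u)) path_space))
            (sets (vimage_algebra (space M) (\<lambda>\<omega>. (L u \<omega>, \<xi> u \<omega>)) (borel \<Otimes>\<^sub>M count_space UNIV)))) \<and>
     (\<forall>u. prob_space.indep_set M
            (sets (vimage_algebra (space M) (L u) borel))
            (sets (vimage_algebra (space M) (\<xi> u) (count_space UNIV)))) \<and>
     prob_space.indep_vars M (\<lambda>_. path_space \<Otimes>\<^sub>M (borel \<Otimes>\<^sub>M count_space UNIV))
       (\<lambda>u \<omega>. (displacement_path (W u) \<omega>, (L u \<omega>, \<xi> u \<omega>))) UNIV"

text \<open>The following notions concern a single realisation, i.e. \<open>W\<close>, \<open>L\<close> and \<open>\<xi>\<close> at a fixed \<open>\<omega>\<close>.\<close>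

primrec particle_exists :: "(bool list \<Rightarrow> bool) \<Rightarrow> bool list \<Rightarrow> bool" where
  "particle_exists \<xi> [] \<longleftrightarrow> True"
| "particle_exists \<xi> (b # u) \<longleftrightarrow> particle_exists \<xi> u \<and> \<xi> u"

primrec birthplace ::
    "real ^ 'n \<Rightarrow> (bool list \<Rightarrow> real \<Rightarrow> real ^ 'n) \<Rightarrow> (bool list \<Rightarrow> real) \<Rightarrow> bool list \<Rightarrow> real ^ 'n" where
  "birthplace x W L [] = x"
| "birthplace x W L (b # u) = birthplace x W L u + W u (L u)"

text \<open>
  The point \<open>(u, t)\<close> of the genealogical real tree is particle \<open>u\<close> at age \<open>t\<close>. The birth point of a
  child is the same point of the tree as the death point of its parent; it is represented only by
  the latter, so that every point other than the root \<open>([], 0)\<close> has age \<open>t > 0\<close>.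
\<close>

definition genealogical_tree ::
    "(bool list \<Rightarrow> real) \<Rightarrow> (bool list \<Rightarrow> bool) \<Rightarrow> (bool list \<times> real) set" where
  "genealogical_tree L \<xi> =
     insert ([], 0) {(u, t). particle_exists \<xi> u \<and> 0 < t \<and> t \<le> L u}"

definition strict_ancestor :: "bool list \<times> real \<Rightarrow> bool list \<times> real \<Rightarrow> bool" where
  "strict_ancestor p q \<longleftrightarrow> strict_suffix (fst p) (fst q) \<or> fst p = fst q \<and> snd p < snd q"

definition position ::
    "real ^ 'n \<Rightarrow> (bool list \<Rightarrow> real \<Rightarrow> real ^ 'n) \<Rightarrow> (bool list \<Rightarrow> real) \<Rightarrow>
     bool list \<times> real \<Rightarrow> real ^ 'n" where
  "position x W L p = birthplace x W L (fst p) + W (fst p) (snd p)"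

definition pioneers ::
    "real ^ 'n \<Rightarrow> (bool list \<Rightarrow> real \<Rightarrow> real ^ 'n) \<Rightarrow> (bool list \<Rightarrow> real) \<Rightarrow> (bool list \<Rightarrow> bool) \<Rightarrow>
     (real ^ 'n) set \<Rightarrow> (bool list \<times> real) set" where
  "pioneers x W L \<xi> B =
     {p \<in> genealogical_tree L \<xi>. position x W L p \<in> B \<and>
        (\<forall>q \<in> genealogical_tree L \<xi>. strict_ancestor q p \<longrightarrow> position x W L q \<notin> B)}"

text \<open>Counting measure is used because \<open>card\<close> would send infinite sets to \<open>0\<close>.\<close>

definition num_pioneers ::
    "real ^ 'n \<Rightarrow> (bool list \<Rightarrow> real \<Rightarrow> real ^ 'n) \<Rightarrow> (bool list \<Rightarrow> real) \<Rightarrow> (bool list \<Rightarrow> bool) \<Rightarrow>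
     ennreal" where
  "num_pioneers x W L \<xi> = emeasure (count_space UNIV) (pioneers x W L \<xi> (cball 0 1))"

definition hitting_prob ::
    "'w measure \<Rightarrow> (bool list \<Rightarrow> real \<Rightarrow> 'w \<Rightarrow> real ^ 'n) \<Rightarrow> (bool list \<Rightarrow> 'w \<Rightarrow> real) \<Rightarrow>
     (bool list \<Rightarrow> 'w \<Rightarrow> bool) \<Rightarrow> real ^ 'n \<Rightarrow> real" where
  "hitting_prob M W L \<xi> x =
     measure M {\<omega> \<in> space M. num_pioneers x (\<lambda>u t. W u t \<omega>) (\<lambda>u. L u \<omega>) (\<lambda>u. \<xi> u \<omega>) > 0}"

text \<open>Sequences of polynomials are indexed from \<open>1\<close>; the value of \<open>P 0\<close> plays no role.\<close>

definition hitting_recursion :: "real \<Rightarrow> (nat \<Rightarrow> real poly) \<Rightarrow> bool" where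
  "hitting_recursion c P \<longleftrightarrow>
     P 1 = [:2:] \<and> P 2 = [:c, 2:] \<and>
     (\<forall>n\<ge>3.
        smult (2 * real n - 4) (P n) - smult 2 (pderiv (P n)) =
          (\<Sum>k=2..n-1. P k * P (n + 1 - k))
          - smult ((real n - 1) * real n) (P (n - 1))
          + smult (2 * real n - 1) (pderiv (P (n - 1)))
          - pderiv (pderiv (P (n - 1))))"

end

theory Submission
  imports Defs "HOL-Real_Asymp.Real_Asymp"
begin

text \<open>
  Outside the unit ball the hitting probability \<open>v\<close> is the radial solution of \<open>\<Delta>v = v\<^sup>2\<close> with
  boundary value \<open>1\<close>. Writing \<open>v (x) = f (ln r) / r\<^sup>2\<close> with \<open>r = \<bar>x\<bar>\<close> turns this equation into
  \<open>f'' - 2 f' = f\<^sup>2\<close>, which has a solution with \<open>f 0 = 1\<close> and values in \<open>[0, 1]\<close>. For such a bounded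
  solution \<open>f''\<close> is of lower order, so \<open>f'\<close> is close to \<open>- f\<^sup>2 / 2\<close> and \<open>f t\<close> is close to \<open>2 / t\<close>. If \<open>S\<close> is
  a partial sum of the expansion and \<open>E = f - S\<close>, then \<open>E' = - 2 E / t\<close> up to smaller terms; hence
  \<open>(t\<^sup>2 E)'\<close> is integrable, which gains one more order. The constant \<open>c_hit\<close> is the limit of
  \<open>t\<^sup>2 (f t - 2 / t - 2 ln t / t\<^sup>2)\<close>, the only freedom in the expansion.

  Stochastic calculus is not needed to identify \<open>v\<close>: a second order Taylor expansion of \<open>h = 1 - v\<close> along
  Gaussian steps, followed by a passage to the limit in the step size, represents \<open>h (x)\<close> as the expectation
  of \<open>(1 + h\<^sup>2) / 2\<close> at the death of the first particle, on the event that this particle avoids the ball.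
  The probability \<open>w\<^sub>n\<close> that no particle of generation less than \<open>n\<close> hits the ball satisfies the same
  relation with \<open>w\<^sub>n\<^sub>+\<^sub>1\<close> on the left and \<open>w\<^sub>n\<close> on the right, starting from \<open>w\<^sub>0 = 1\<close>. The resulting
  iteration converges to \<open>h\<close>, because \<open>(1 + h) / 2\<close> is bounded away from \<open>1\<close> on bounded sets and \<open>v\<close>
  vanishes at infinity.
\<close>

subsection \<open>The profile equation \<open>f'' - 2 f' = f\<^sup>2\<close>\<close>

text \<open>The general solution of \<open>f'' - 2 f' = f^2\<close> has a mode growing like
  \<open>exp (2 t)\<close>. Every estimate of the profile therefore runs backwards from infinity,
  with boundedness of \<open>f\<close> and \<open>f'\<close> in place of an initial condition. No
  uniqueness of the profile is established beforehand: the identification with the hitting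
  probability holds for whichever bounded solution was constructed. The second order of the
  expansion is special because the solutions of \<open>E' = - 2 E / t\<close> are the multiples of
  \<open>1 / t^2\<close>; correspondingly the factor \<open>2 n - 4\<close> of the recursion
  vanishes at \<open>n = 2\<close>. On the probabilistic side there are two obstacles:
  \<open>h\<close> has a kink at the unit sphere, and a path observed at discrete times can overlook
  a visit to the ball. Gaussian steps are therefore compared with \<open>h\<close> only outside the
  radius \<open>1 + \<delta>\<close>. With time step \<open>\<epsilon>\<close> the error of one step
  is of order \<open>\<epsilon>^(3/2)\<close>, hence of order \<open>sqrt \<epsilon>\<close> per
  unit of time, and \<open>\<delta>\<close> tends to \<open>0\<close> only after
  \<open>\<epsilon>\<close>.\<close>

lemma deriv_nonneg_imp_le:
  fixes F :: "real \<Rightarrow> real"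
  assumes "\<And>t. a \<le> t \<Longrightarrow> (F has_real_derivative F' t) (at t)"
    and "\<And>t. a \<le> t \<Longrightarrow> 0 \<le> F' t" and "a \<le> s" "s \<le> t"
  shows "F s \<le> F t"
proof (rule DERIV_nonneg_imp_nondecreasing[OF \<open>s \<le> t\<close>])
  fix x assume "s \<le> x" "x \<le> t"
  then show "\<exists>y. (F has_real_derivative y) (at x) \<and> 0 \<le> y"
    using assms(1,2)[of x] assms(3) by auto
qed

text \<open>A Gronwall argument from infinity: \<open>exp (- c t) * H t\<close> is nonincreasing,
  and the growth bound with \<open>b < c\<close> sends it to \<open>0\<close>, so it cannot be
  negative anywhere. The growth bound takes the place of an initial condition.\<close>

lemma nonneg_of_deriv_le_backward:
  fixes H :: "real \<Rightarrow> real"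
  assumes der: "\<And>t. a \<le> t \<Longrightarrow> (H has_real_derivative H' t) (at t)"
    and le: "\<And>t. a \<le> t \<Longrightarrow> H' t \<le> c * H t"
    and bd: "\<And>t. a \<le> t \<Longrightarrow> \<bar>H t\<bar> \<le> C * exp (b * t)" and "b < c" and "a \<le> t"
  shows "0 \<le> H t"
proof -
  define F where "F t = - (exp (- c * t) * H t)" for t
  have dF: "(F has_real_derivative exp (- c * s) * (c * H s - H' s)) (at s)" if "a \<le> s" for s
    unfolding F_def using der[OF that]
    by (auto intro!: derivative_eq_intros simp: algebra_simps)
  have mono: "F t \<le> F s" if "t \<le> s" for s
    by (rule deriv_nonneg_imp_le[OF dF _ \<open>a \<le> t\<close> that]) (use le in auto)
  have "((\<lambda>t. C * exp ((b - c) * t)) \<longlongrightarrow> 0) at_top"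
    using \<open>b < c\<close> by real_asymp
  moreover have "\<forall>\<^sub>F s in at_top. norm (F s) \<le> C * exp ((b - c) * s)"
    using eventually_ge_at_top[of a]
  proof eventually_elim
    case (elim s)
    have "norm (F s) \<le> exp (- c * s) * (C * exp (b * s))"
      using bd[OF elim] by (simp add: F_def abs_mult)
    also have "\<dots> = C * exp ((b - c) * s)"
      by (simp add: exp_add[symmetric] algebra_simps flip: exp_diff)
    finally show ?case .
  qed
  ultimately have "(F \<longlongrightarrow> 0) at_top"
    by (rule Lim_null_comparison[rotated])
  moreover have "\<forall>\<^sub>F s in at_top. F t \<le> F s"
    using eventually_ge_at_top[of t] by eventually_elim (rule mono)
  ultimately have "F t \<le> 0"
    by (intro tendsto_lowerbound) auto
  then show ?thesis
    by (simp add: F_def zero_le_mult_iff)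
qed

lemma nonneg_of_deriv_ge_forward:
  fixes H :: "real \<Rightarrow> real"
  assumes der: "\<And>t. a \<le> t \<Longrightarrow> (H has_real_derivative H' t) (at t)"
    and ge: "\<And>t. a \<le> t \<Longrightarrow> c * H t \<le> H' t" and "0 \<le> H a" "a \<le> t"
  shows "exp (c * (t - a)) * H a \<le> H t"
proof -
  have "exp (- c * a) * H a \<le> exp (- c * t) * H t"
  proof (rule deriv_nonneg_imp_le[where F = "\<lambda>t. exp (- c * t) * H t" and a = a])
    show "((\<lambda>t. exp (- c * t) * H t) has_real_derivative exp (- c * s) * (H' s - c * H s)) (at s)"
      if "a \<le> s" for s
      using der[OF that] by (auto intro!: derivative_eq_intros simp: algebra_simps)
  qed (use ge assms in auto)
  then have "exp (c * t) * (exp (- c * a) * H a) \<le> exp (c * t) * (exp (- c * t) * H t)"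
    by (intro mult_left_mono) auto
  then show ?thesis
    by (simp add: mult.assoc[symmetric] right_diff_distrib flip: exp_add)
qed

text \<open>The operator \<open>y'' - 2 y' - 3 y\<close> factors as \<open>(D - 3) (D + 1)\<close>.\<close>

lemma second_order_comparison:
  fixes y :: "real \<Rightarrow> real"
  assumes d1: "\<And>t. 0 \<le> t \<Longrightarrow> (y has_real_derivative y1 t) (at t)"
    and d2: "\<And>t. 0 \<le> t \<Longrightarrow> (y1 has_real_derivative y2 t) (at t)"
    and le: "\<And>t. 0 \<le> t \<Longrightarrow> y2 t - 2 * y1 t - 3 * y t \<le> 0"
    and y0: "0 \<le> y 0"
    and bd: "\<And>t. 0 \<le> t \<Longrightarrow> \<bar>y t\<bar> \<le> C * exp t" "\<And>t. 0 \<le> t \<Longrightarrow> \<bar>y1 t\<bar> \<le> C * exp t"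
    and "0 \<le> t"
  shows "0 \<le> y t"
proof -
  \<comment> \<open>The factor \<open>D - 3\<close> is treated backwards from infinity, where growth
    like \<open>exp t\<close> is admissible; the factor \<open>D + 1\<close> is then treated
    forwards from \<open>y 0\<close>.\<close>
  have z: "0 \<le> y1 t + y t" if "0 \<le> t" for t
  proof (rule nonneg_of_deriv_le_backward[where H = "\<lambda>t. y1 t + y t" and a = 0 and c = 3 and b = 1 and C = "2 * C"])
    show "((\<lambda>t. y1 t + y t) has_real_derivative (y2 s + y1 s)) (at s)" if "0 \<le> s" for s
      using that by (intro derivative_intros d1 d2)
    show "\<bar>y1 s + y s\<bar> \<le> 2 * C * exp (1 * s)" if "0 \<le> s" for s
      using bd[OF that] by simp
    show "y2 s + y1 s \<le> 3 * (y1 s + y s)" if "0 \<le> s" for s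
      using le[OF that] by simp
  qed (use that in auto)
  have "exp ((-1) * (t - 0)) * y 0 \<le> y t"
  proof (rule nonneg_of_deriv_ge_forward[where H = y and H' = y1])
    show "- 1 * y s \<le> y1 s" if "0 \<le> s" for s using z[OF that] by simp
  qed (use d1 y0 \<open>0 \<le> t\<close> in auto)
  with mult_nonneg_nonneg[OF exp_ge_zero y0, of "(-1) * (t - 0)"] show ?thesis
    by (rule order_trans)
qed

lemma continuous_has_antiderivative:
  fixes g :: "real \<Rightarrow> real"
  assumes "continuous_on UNIV g"
  obtains G where "\<And>t. (G has_real_derivative g t) (at t)" "G 0 = 0"
proof -
  have "isCont g t" for t
    using assms by (simp add: continuous_on_eq_continuous_at)
  then obtain G where "\<And>t. (G has_vector_derivative g t) (at t)"
    using einterval_antiderivative[of "-\<infinity>" "\<infinity>" g] by auto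
  then have "((\<lambda>t. G t - G 0) has_real_derivative g t) (at t)" for t
    by (auto intro!: derivative_eq_intros simp: has_real_derivative_iff_has_vector_derivative)
  then show thesis
    by (intro that[of "\<lambda>t. G t - G 0"]) auto
qed

text \<open>The factorisation is inverted one factor at a time: \<open>z = y' + y\<close> is the
  bounded solution of \<open>z' = 3 z - g\<close>, that is \<open>exp (3 t)\<close> times the tail
  integral of \<open>exp (- 3 s) * g s\<close>, and \<open>y\<close> then solves
  \<open>y' + y = z\<close> with \<open>y 0 = 1\<close>.\<close>

lemma linear_equation_solution:
  fixes g :: "real \<Rightarrow> real"
  assumes cont: "continuous_on UNIV g" and bd: "\<And>t. \<bar>g t\<bar> \<le> K"
  obtains y y1 y2 C where
    "\<And>t. (y has_real_derivative y1 t) (at t)" "\<And>t. (y1 has_real_derivative y2 t) (at t)"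
    "\<And>t. y2 t - 2 * y1 t - 3 * y t = - g t" "y 0 = 1"
    "\<And>t. 0 \<le> t \<Longrightarrow> \<bar>y t\<bar> \<le> C" "\<And>t. 0 \<le> t \<Longrightarrow> \<bar>y1 t\<bar> \<le> C"
proof -
  have K: "0 \<le> K" using bd[of 0] by linarith
  have "continuous_on UNIV (\<lambda>t. exp (- 3 * t) * g t)"
    by (intro continuous_intros cont)
  then obtain A where A: "\<And>t. (A has_real_derivative exp (- 3 * t) * g t) (at t)"
    using continuous_has_antiderivative by blast
  \<comment> \<open>\<open>B\<close> increases and \<open>D\<close> decreases because
    \<open>K\<close> bounds the modulus of \<open>g\<close>, and they enclose the antiderivative
    \<open>A\<close> with a gap tending to \<open>0\<close>. So \<open>A\<close> has a limit
    \<open>L\<close> at infinity, and the tail integral is \<open>L - A t\<close>.\<close>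
  define B where "B t = A t - K / 3 * exp (- 3 * t)" for t
  define D where "D t = A t + K / 3 * exp (- 3 * t)" for t
  have B: "B s \<le> B t" if "s \<le> t" for s t
  proof (rule deriv_nonneg_imp_le[OF _ _ order_refl that])
    show "(B has_real_derivative exp (- 3 * t) * (g t + K)) (at t)" for t
      unfolding B_def by (auto intro!: derivative_eq_intros A simp: algebra_simps)
    show "0 \<le> exp (- 3 * t) * (g t + K)" for t
      using bd[of t] by (intro mult_nonneg_nonneg) auto
  qed
  have D: "D t \<le> D s" if "s \<le> t" for s t
  proof -
    have "- D s \<le> - D t"
    proof (rule deriv_nonneg_imp_le[OF _ _ order_refl that])
      show "((\<lambda>t. - D t) has_real_derivative exp (- 3 * t) * (K - g t)) (at t)" for t
        unfolding D_def by (auto intro!: derivative_eq_intros A simp: algebra_simps)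
      show "0 \<le> exp (- 3 * t) * (K - g t)" for t
        using bd[of t] by (intro mult_nonneg_nonneg) auto
    qed
    then show ?thesis by simp
  qed
  have BD: "B s \<le> D t" for s t
  proof -
    have "B s \<le> B (max s t)" by (rule B) simp
    also have "\<dots> \<le> D (max s t)" using K by (simp add: B_def D_def)
    also have "\<dots> \<le> D t" by (rule D) simp
    finally show ?thesis .
  qed
  define L where "L = (SUP t. B t)"
  have bdd: "bdd_above (range B)" using BD by (intro bdd_aboveI2)
  have L: "B t \<le> L" "L \<le> D t" for t
    unfolding L_def by (auto intro!: cSUP_upper cSUP_least bdd BD)
  define z where "z t = exp (3 * t) * (L - A t)" for t
  have zd: "(z has_real_derivative 3 * z t - g t) (at t)" for t
    unfolding z_def
    by (auto intro!: derivative_eq_intros A simp: algebra_simps exp_minus)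
  have LA: "\<bar>L - A t\<bar> \<le> K / 3 * exp (- 3 * t)" for t
    using L[of t] unfolding B_def D_def abs_le_iff by linarith
  have zb: "\<bar>z t\<bar> \<le> K / 3" for t
  proof -
    have "exp (3 * t) * \<bar>L - A t\<bar> \<le> exp (3 * t) * (K / 3 * exp (- 3 * t))"
      by (intro mult_left_mono) (use LA[of t] in auto)
    also have "\<dots> = K / 3" by (simp add: exp_minus)
    finally show ?thesis by (simp add: z_def abs_mult)
  qed
  have "continuous_on UNIV z"
    by (intro continuous_at_imp_continuous_on ballI DERIV_isCont[OF zd])
  then have "continuous_on UNIV (\<lambda>t. exp t * z t)"
    by (intro continuous_intros)
  then obtain Y where Y: "\<And>t. (Y has_real_derivative exp t * z t) (at t)" "Y 0 = 0"
    using continuous_has_antiderivative by blast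
  have Yb: "\<bar>Y t\<bar> \<le> K / 3 * (exp t - 1)" if "0 \<le> t" for t
  proof -
    have "K / 3 * (exp 0 - 1) - Y 0 \<le> K / 3 * (exp t - 1) - Y t"
    proof (rule deriv_nonneg_imp_le[where F = "\<lambda>t. K / 3 * (exp t - 1) - Y t", OF _ _ order_refl that])
      show "((\<lambda>t. K / 3 * (exp t - 1) - Y t) has_real_derivative exp t * (K / 3 - z t)) (at t)" for t
        by (auto intro!: derivative_eq_intros Y simp: algebra_simps)
      show "0 \<le> exp t * (K / 3 - z t)" for t
        using zb[of t] by (intro mult_nonneg_nonneg) auto
    qed
    moreover have "K / 3 * (exp 0 - 1) + Y 0 \<le> K / 3 * (exp t - 1) + Y t"
    proof (rule deriv_nonneg_imp_le[where F = "\<lambda>t. K / 3 * (exp t - 1) + Y t", OF _ _ order_refl that])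
      show "((\<lambda>t. K / 3 * (exp t - 1) + Y t) has_real_derivative exp t * (K / 3 + z t)) (at t)" for t
        by (auto intro!: derivative_eq_intros Y simp: algebra_simps)
      show "0 \<le> exp t * (K / 3 + z t)" for t
        using zb[of t] by (intro mult_nonneg_nonneg) auto
    qed
    ultimately show ?thesis using Y(2) by simp
  qed
  define y where "y t = exp (- t) * (1 + Y t)" for t
  have yb: "\<bar>y t\<bar> \<le> 1 + K / 3" if "0 \<le> t" for t
  proof -
    have "\<bar>y t\<bar> \<le> exp (- t) * (1 + K / 3 * (exp t - 1))"
      unfolding y_def abs_mult using Yb[OF that] by (intro mult_mono) auto
    also have "\<dots> = exp (- t) * (1 - K / 3) + K / 3"
      by (simp add: exp_minus field_simps)
    also have "\<dots> \<le> 1 + K / 3"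
      using mult_nonneg_nonneg[of "exp (- t)" "K / 3"] K that by (simp add: algebra_simps add_increasing2)
    finally show ?thesis .
  qed
  show thesis
  proof (rule that[of y "\<lambda>t. z t - y t" "\<lambda>t. y t + 2 * z t - g t" "1 + 2 * K / 3"])
    show yd: "(y has_real_derivative z t - y t) (at t)" for t
      unfolding y_def by (auto intro!: derivative_eq_intros Y simp: algebra_simps exp_minus)
    show "((\<lambda>t. z t - y t) has_real_derivative y t + 2 * z t - g t) (at t)" for t
      by (auto intro!: derivative_eq_intros yd zd)
    show "y 0 = 1" by (simp add: y_def Y)
    show "\<bar>y t\<bar> \<le> 1 + 2 * K / 3" if "0 \<le> t" for t
      using yb[OF that] K by linarith
    show "\<bar>z t - y t\<bar> \<le> 1 + 2 * K / 3" if "0 \<le> t" for t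
      using yb[OF that] zb[of t] K by linarith
  qed auto
qed

text \<open>For \<open>f\<close> in \<open>[0, 1]\<close> the values of \<open>3 f - f^2\<close> lie
  in \<open>[0, 3]\<close>, so comparison with the constants \<open>0\<close> and \<open>1\<close>
  keeps the solution in \<open>[0, 1]\<close>. The terms \<open>3 y\<close> and \<open>3 f\<close>
  cancel at a fixed point, which therefore solves \<open>f'' - 2 f' = f^2\<close>.\<close>

lemma profile_iteration_step:
  fixes f :: "real \<Rightarrow> real"
  assumes cont: "continuous_on {0..} f" and bd: "\<And>t. 0 \<le> t \<Longrightarrow> f t \<in> {0..1}"
  obtains y y1 y2 C where
    "\<And>t. 0 \<le> t \<Longrightarrow> (y has_real_derivative y1 t) (at t)"
    "\<And>t. 0 \<le> t \<Longrightarrow> (y1 has_real_derivative y2 t) (at t)"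
    "\<And>t. 0 \<le> t \<Longrightarrow> y2 t - 2 * y1 t - 3 * y t = - (3 * f t - (f t)\<^sup>2)" "y 0 = 1"
    "\<And>t. 0 \<le> t \<Longrightarrow> \<bar>y1 t\<bar> \<le> C" "\<And>t. 0 \<le> t \<Longrightarrow> y t \<in> {0..1}"
proof -
  \<comment> \<open>Freezing \<open>f\<close> at its value \<open>f 0\<close> for negative times
    gives a continuous and bounded right hand side on the whole line.\<close>
  define g where "g t = 3 * f (max t 0) - (f (max t 0))\<^sup>2" for t
  have "continuous_on UNIV g"
    unfolding g_def
    by (intro continuous_intros continuous_on_compose2[OF cont]) auto
  moreover have gb: "0 \<le> g t \<and> g t \<le> 3" for t
  proof -
    have "g t = f (max t 0) * (3 - f (max t 0))"
      by (simp add: g_def power2_eq_square algebra_simps)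
    then show ?thesis
      using bd[of "max t 0"] mult_mono[of "f (max t 0)" 1 "3 - f (max t 0)" 3] by auto
  qed
  then have "\<bar>g t\<bar> \<le> 3" for t by simp
  ultimately obtain y y1 y2 C where y:
    "\<And>t. (y has_real_derivative y1 t) (at t)" "\<And>t. (y1 has_real_derivative y2 t) (at t)"
    "\<And>t. y2 t - 2 * y1 t - 3 * y t = - g t" "y 0 = 1"
    "\<And>t. 0 \<le> t \<Longrightarrow> \<bar>y t\<bar> \<le> C" "\<And>t. 0 \<le> t \<Longrightarrow> \<bar>y1 t\<bar> \<le> C"
    using linear_equation_solution by blast
  have C: "0 \<le> C" using y(5)[of 0] by linarith
  have Ce: "x \<le> (C + 1) * exp t" if "x \<le> C + 1" "0 \<le> t" for x t
    using mult_left_mono[of 1 "exp t" "C + 1"] by (intro order_trans[OF that(1)]) (use that C in auto)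
  have "0 \<le> y t" if "0 \<le> t" for t
  proof (rule second_order_comparison[OF y(1,2) _ _ _ _ that, where C = "C + 1"])
    show "y2 t - 2 * y1 t - 3 * y t \<le> 0" for t using gb[of t] y(3)[of t] by simp
    show "\<bar>y t\<bar> \<le> (C + 1) * exp t" "\<bar>y1 t\<bar> \<le> (C + 1) * exp t" if "0 \<le> t" for t
      using y(5,6)[OF that] that by (auto intro: Ce)
  qed (use y in auto)
  moreover have "0 \<le> 1 - y t" if "0 \<le> t" for t
  proof (rule second_order_comparison[OF _ _ _ _ _ _ that, where C = "C + 1"])
    show "((\<lambda>t. 1 - y t) has_real_derivative - y1 t) (at t)"
      "((\<lambda>t. - y1 t) has_real_derivative - y2 t) (at t)" for t
      by (auto intro!: derivative_eq_intros y)
    show "- y2 t - 2 * (- y1 t) - 3 * (1 - y t) \<le> 0" for t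
      using gb[of t] y(3)[of t] by simp
    show "\<bar>1 - y t\<bar> \<le> (C + 1) * exp t" "\<bar>- y1 t\<bar> \<le> (C + 1) * exp t" if "0 \<le> t" for t
      using y(5,6)[OF that] that by (auto intro!: Ce)
  qed (use y in auto)
  ultimately show thesis
    using y by (intro that[of y y1 y2 C]) (auto simp: g_def)
qed

text \<open>The weight is \<open>exp t\<close>: the operator maps it to \<open>- 4 exp t\<close>,
  whereas \<open>s \<mapsto> 3 s - s^2\<close> has Lipschitz constant \<open>3\<close> on
  \<open>[0, 1]\<close>. Comparison with a multiple of \<open>exp t\<close> therefore yields the
  factor \<open>3 / 4\<close>.\<close>

lemma profile_iteration_contraction:
  fixes f g :: "real \<Rightarrow> real"
  assumes "\<And>t. 0 \<le> t \<Longrightarrow> (y has_real_derivative y1 t) (at t)"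
    "\<And>t. 0 \<le> t \<Longrightarrow> (y1 has_real_derivative y2 t) (at t)"
    "\<And>t. 0 \<le> t \<Longrightarrow> y2 t - 2 * y1 t - 3 * y t = - (3 * f t - (f t)\<^sup>2)" "y 0 = 1"
    "\<And>t. 0 \<le> t \<Longrightarrow> \<bar>y1 t\<bar> \<le> C" "\<And>t. 0 \<le> t \<Longrightarrow> y t \<in> {0..1::real}"
  assumes "\<And>t. 0 \<le> t \<Longrightarrow> (z has_real_derivative z1 t) (at t)"
    "\<And>t. 0 \<le> t \<Longrightarrow> (z1 has_real_derivative z2 t) (at t)"
    "\<And>t. 0 \<le> t \<Longrightarrow> z2 t - 2 * z1 t - 3 * z t = - (3 * g t - (g t)\<^sup>2)" "z 0 = 1"
    "\<And>t. 0 \<le> t \<Longrightarrow> \<bar>z1 t\<bar> \<le> D" "\<And>t. 0 \<le> t \<Longrightarrow> z t \<in> {0..1::real}"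
  assumes fg: "\<And>t. 0 \<le> t \<Longrightarrow> f t \<in> {0..1}" "\<And>t. 0 \<le> t \<Longrightarrow> g t \<in> {0..1}"
    and K: "\<And>t. 0 \<le> t \<Longrightarrow> \<bar>f t - g t\<bar> \<le> K * exp t" and "0 \<le> t"
  shows "y t - z t \<le> 3 / 4 * K * exp t"
proof -
  have K0: "0 \<le> K" using K[of 0] by simp
  have "0 \<le> 3 / 4 * K * exp t - (y t - z t)"
  proof (rule second_order_comparison[OF _ _ _ _ _ _ \<open>0 \<le> t\<close>, where C = "3 / 4 * K + C + D + 2"])
    show "((\<lambda>t. 3 / 4 * K * exp t - (y t - z t)) has_real_derivative
        3 / 4 * K * exp s - (y1 s - z1 s)) (at s)"
      "((\<lambda>t. 3 / 4 * K * exp t - (y1 t - z1 t)) has_real_derivative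
        3 / 4 * K * exp s - (y2 s - z2 s)) (at s)" if "0 \<le> s" for s
      using assms(1,2,7,8)[OF that] by (auto intro!: derivative_eq_intros)
    show "3 / 4 * K * exp s - (y2 s - z2 s) - 2 * (3 / 4 * K * exp s - (y1 s - z1 s))
        - 3 * (3 / 4 * K * exp s - (y s - z s)) \<le> 0" if "0 \<le> s" for s
    proof -
      have "(3 * f s - (f s)\<^sup>2) - (3 * g s - (g s)\<^sup>2) = (f s - g s) * (3 - f s - g s)"
        by (simp add: power2_eq_square algebra_simps)
      also have "\<dots> \<le> \<bar>f s - g s\<bar> * 3"
      proof -
        have "\<bar>3 - f s - g s\<bar> \<le> 3" using fg[OF that] by auto
        then have "\<bar>f s - g s\<bar> * \<bar>3 - f s - g s\<bar> \<le> \<bar>f s - g s\<bar> * 3"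
          by (intro mult_left_mono) auto
        then show ?thesis
          using abs_ge_self[of "(f s - g s) * (3 - f s - g s)"] by (simp only: abs_mult)
      qed
      also have "\<dots> \<le> 3 * K * exp s" using K[OF that] by simp
      finally show ?thesis using assms(3,9)[OF that] by simp
    qed
    show "\<bar>3 / 4 * K * exp s - (y s - z s)\<bar> \<le> (3 / 4 * K + C + D + 2) * exp s"
      "\<bar>3 / 4 * K * exp s - (y1 s - z1 s)\<bar> \<le> (3 / 4 * K + C + D + 2) * exp s" if "0 \<le> s" for s
    proof -
      have CD: "0 \<le> C" "0 \<le> D" using assms(5,11)[of 0] by auto
      have "C + D + 2 \<le> (C + D + 2) * exp s"
        using that CD mult_left_mono[of 1 "exp s" "C + D + 2"] by simp
      moreover have "\<bar>y s - z s\<bar> \<le> C + D + 2" "\<bar>y1 s - z1 s\<bar> \<le> C + D + 2"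
        using assms(5,6,11,12)[OF that] CD by auto
      moreover have "0 \<le> 3 / 4 * K * exp s" using K0 by simp
      ultimately show "\<bar>3 / 4 * K * exp s - (y s - z s)\<bar> \<le> (3 / 4 * K + C + D + 2) * exp s"
        "\<bar>3 / 4 * K * exp s - (y1 s - z1 s)\<bar> \<le> (3 / 4 * K + C + D + 2) * exp s"
        by (auto simp: distrib_right abs_le_iff)
    qed
    show "0 \<le> 3 / 4 * K * exp 0 - (y 0 - z 0)" using assms K0 by simp
  qed
  then show ?thesis by simp
qed

text \<open>Banach iteration in the norm weighted by \<open>exp (- t)\<close>, started at the
  constant \<open>1\<close>. Boundedness of \<open>f1\<close> is recorded because it is what later
  excludes the mode \<open>exp (2 t)\<close>.\<close>

theorem profile_exists:
  obtains f f1 :: "real \<Rightarrow> real" and C where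
    "\<And>t. 0 \<le> t \<Longrightarrow> (f has_real_derivative f1 t) (at t)"
    "\<And>t. 0 \<le> t \<Longrightarrow> (f1 has_real_derivative 2 * f1 t + (f t)\<^sup>2) (at t)"
    "f 0 = 1" "\<And>t. 0 \<le> t \<Longrightarrow> f t \<in> {0..1}" "\<And>t. 0 \<le> t \<Longrightarrow> \<bar>f1 t\<bar> \<le> C"
proof -
  define step where "step f y \<longleftrightarrow> (\<exists>y1 y2 C.
    (\<forall>t\<ge>0. (y has_real_derivative y1 t) (at t)) \<and>
    (\<forall>t\<ge>0. (y1 has_real_derivative y2 t) (at t)) \<and>
    (\<forall>t\<ge>0. y2 t - 2 * y1 t - 3 * y t = - (3 * f t - (f t)\<^sup>2)) \<and> y 0 = 1 \<and>
    (\<forall>t\<ge>0. \<bar>y1 t\<bar> \<le> C) \<and> (\<forall>t\<ge>0. y t \<in> {0..1}))" for f y :: "real \<Rightarrow> real"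
  define good where "good f \<longleftrightarrow> continuous_on {0..} f \<and> (\<forall>t\<ge>0. f t \<in> {0..1})"
    for f :: "real \<Rightarrow> real"
  have step_good: "good y" if "step f y" for f y
  proof -
    from that obtain y1 where y1: "\<forall>t\<ge>0. (y has_real_derivative y1 t) (at t)"
      "\<forall>t\<ge>0. y t \<in> {0..1}"
      unfolding step_def by blast
    have "continuous_on {0..} y"
      by (rule DERIV_continuous_on[where D = y1]) (use y1 in \<open>auto intro: DERIV_subset\<close>)
    with y1 show ?thesis by (simp add: good_def)
  qed
  have contr: "\<bar>y t - z t\<bar> \<le> 3 / 4 * K * exp t"
    if fy: "step f y" and gz: "step g z" and fg: "good f" "good g"
      and K: "\<And>t. 0 \<le> t \<Longrightarrow> \<bar>f t - g t\<bar> \<le> K * exp t" and "0 \<le> t" for f g y z K t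
  proof -
    obtain y1 y2 C where Y: "\<forall>t\<ge>0. (y has_real_derivative y1 t) (at t)"
      "\<forall>t\<ge>0. (y1 has_real_derivative y2 t) (at t)"
      "\<forall>t\<ge>0. y2 t - 2 * y1 t - 3 * y t = - (3 * f t - (f t)\<^sup>2)" "y 0 = 1"
      "\<forall>t\<ge>0. \<bar>y1 t\<bar> \<le> C" "\<forall>t\<ge>0. y t \<in> {0..1}"
      using fy unfolding step_def by blast
    obtain z1 z2 D where Z: "\<forall>t\<ge>0. (z has_real_derivative z1 t) (at t)"
      "\<forall>t\<ge>0. (z1 has_real_derivative z2 t) (at t)"
      "\<forall>t\<ge>0. z2 t - 2 * z1 t - 3 * z t = - (3 * g t - (g t)\<^sup>2)" "z 0 = 1"
      "\<forall>t\<ge>0. \<bar>z1 t\<bar> \<le> D" "\<forall>t\<ge>0. z t \<in> {0..1}"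
      using gz unfolding step_def by blast
    have 1: "y t - z t \<le> 3 / 4 * K * exp t"
      by (rule profile_iteration_contraction[where f = f and g = g and C = C and D = D
            and ?y1.0 = y1 and ?y2.0 = y2 and ?z1.0 = z1 and ?z2.0 = z2])
        (use Y Z fg K \<open>0 \<le> t\<close> in \<open>simp_all add: good_def\<close>)
    have "\<bar>g t - f t\<bar> \<le> K * exp t" if "0 \<le> t" for t
      using K[OF that] by (simp add: abs_minus_commute)
    then have 2: "z t - y t \<le> 3 / 4 * K * exp t"
      by (intro profile_iteration_contraction[where f = g and g = f and C = D and D = C
            and ?y1.0 = z1 and ?y2.0 = z2 and ?z1.0 = y1 and ?z2.0 = y2])
        (use Y Z fg \<open>0 \<le> t\<close> in \<open>simp_all add: good_def\<close>)
    from 1 2 show ?thesis unfolding abs_le_iff by linarith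
  qed
  have ex: "\<exists>y. step f y" if "good f" for f
  proof -
    have c: "continuous_on {0..} f" and b: "\<And>t. 0 \<le> t \<Longrightarrow> f t \<in> {0..1}"
      using that by (auto simp: good_def)
    show ?thesis
      by (rule profile_iteration_step[OF c b]) (simp, unfold step_def, blast)
  qed
  define T where "T f = (SOME y. step f y)" for f
  have T: "step f (T f)" if "good f" for f
    using someI_ex[OF ex[OF that]] by (simp add: T_def)
  define F where "F n = (T ^^ n) (\<lambda>_. 1)" for n
  have F_Suc: "F (Suc n) = T (F n)" for n by (simp add: F_def)
  have F_good: "good (F n)" for n
  proof (induction n)
    case 0 then show ?case by (simp add: F_def good_def)
  next
    case (Suc n) then show ?case by (metis F_Suc T step_good)
  qed
  have F_diff: "\<bar>F (Suc n) t - F n t\<bar> \<le> (3 / 4) ^ n * exp t" if "0 \<le> t" for n t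
    using that
  proof (induction n arbitrary: t)
    case 0
    have "F 0 t \<in> {0..1}" "F 1 t \<in> {0..1}" using F_good[of 0] F_good[of 1] 0 by (auto simp: good_def)
    moreover have "1 \<le> exp t" using 0 by simp
    ultimately have "\<bar>F (Suc 0) t - F 0 t\<bar> \<le> exp t"
      unfolding atLeastAtMost_iff One_nat_def by linarith
    then show ?case by simp
  next
    case (Suc n)
    have "\<bar>F (Suc (Suc n)) t - F (Suc n) t\<bar> \<le> 3 / 4 * (3 / 4) ^ n * exp t"
      by (rule contr[of "F (Suc n)" _ "F n"])
        (use Suc F_good T[OF F_good] in \<open>simp_all only: F_Suc[symmetric]\<close>)
    then show ?case by simp
  qed
  \<comment> \<open>The partial sums of \<open>u\<close> telescope to
    \<open>exp (- t) * (F n t - 1)\<close>, so the geometric bound gives uniform convergence and a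
    continuous limit.\<close>
  define u where "u n t = exp (- t) * (F (Suc n) t - F n t)" for n t
  have "uniform_limit {0..} (\<lambda>n t. \<Sum>i<n. u i t) (\<lambda>t. \<Sum>i. u i t) sequentially"
  proof (rule Weierstrass_m_test)
    show "norm (u n t) \<le> (3 / 4) ^ n" if "t \<in> {0..}" for n t
    proof -
      have "exp (- t) * \<bar>F (Suc n) t - F n t\<bar> \<le> exp (- t) * ((3 / 4) ^ n * exp t)"
        using F_diff[of t n] that by (intro mult_left_mono) auto
      also have "\<dots> = (3 / 4) ^ n" by (simp add: exp_minus)
      finally show ?thesis by (simp add: u_def abs_mult)
    qed
  qed (simp add: summable_geometric)
  moreover have "(\<Sum>i<n. u i t) = exp (- t) * (F n t - 1)" for n t
    by (induction n) (simp_all add: u_def F_def algebra_simps)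
  ultimately have ul: "uniform_limit {0..} (\<lambda>n t. exp (- t) * (F n t - 1)) (\<lambda>t. \<Sum>i. u i t) sequentially"
    by simp
  define f where "f t = 1 + exp t * (\<Sum>i. u i t)" for t
  have "continuous_on {0..} (\<lambda>t. \<Sum>i. u i t)"
    by (rule uniform_limit_theorem[OF _ ul])
      (use F_good in \<open>auto simp: good_def intro!: always_eventually continuous_intros\<close>)
  then have f_cont: "continuous_on {0..} f"
    unfolding f_def by (intro continuous_intros)
  have F_lim: "(\<lambda>n. F n t) \<longlonglongrightarrow> f t" if "0 \<le> t" for t
  proof -
    have "(\<lambda>n. 1 + exp t * (exp (- t) * (F n t - 1))) \<longlonglongrightarrow> f t"
      unfolding f_def by (intro tendsto_intros tendsto_uniform_limitI[OF ul]) (use that in auto)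
    moreover have "1 + exp t * (exp (- t) * (F n t - 1)) = F n t" for n
      by (simp add: exp_minus field_simps)
    ultimately show ?thesis by simp
  qed
  have "f t \<in> {0..1}" if "0 \<le> t" for t
    by (rule closed_sequentially[OF _ _ F_lim[OF that]]) (use F_good that in \<open>auto simp: good_def\<close>)
  with f_cont have f_good: "good f" by (simp add: good_def)
  have F_f: "\<bar>F n t - f t\<bar> \<le> 4 * (3 / 4) ^ n * exp t" if "0 \<le> t" for n t
  proof (rule LIMSEQ_le_const2[OF tendsto_rabs[OF tendsto_diff[OF tendsto_const F_lim[OF that]]]])
    have "\<bar>F n t - F (n + k) t\<bar> \<le> 4 * ((3 / 4) ^ n - (3 / 4) ^ (n + k)) * exp t" for k
    proof (induction k)
      case (Suc k)
      have "\<bar>F n t - F (n + Suc k) t\<bar> \<le> \<bar>F n t - F (n + k) t\<bar> + \<bar>F (Suc (n + k)) t - F (n + k) t\<bar>"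
        by simp
      also have "\<dots> \<le> 4 * ((3 / 4) ^ n - (3 / 4) ^ (n + k)) * exp t + (3 / 4) ^ (n + k) * exp t"
        by (intro add_mono Suc F_diff that)
      finally show ?case by (simp add: algebra_simps)
    qed simp
    moreover have "4 * ((3 / 4) ^ n - (3 / 4) ^ (n + k)) * exp t \<le> 4 * (3 / 4) ^ n * exp t" for k
      by simp
    ultimately have "\<bar>F n t - F (n + k) t\<bar> \<le> 4 * (3 / 4) ^ n * exp t" for k
      by (rule order_trans)
    then show "\<exists>N. \<forall>m\<ge>N. \<bar>F n t - F m t\<bar> \<le> 4 * (3 / 4) ^ n * exp t"
      by (metis le_add_diff_inverse)
  qed
  have Tf: "T f t = f t" if "0 \<le> t" for t
  proof (rule LIMSEQ_unique)
    show "(\<lambda>n. F (Suc n) t) \<longlonglongrightarrow> f t" using LIMSEQ_Suc[OF F_lim[OF that]] .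
    show "(\<lambda>n. F (Suc n) t) \<longlonglongrightarrow> T f t"
    proof (rule LIM_zero_cancel, rule Lim_null_comparison)
      show "\<forall>\<^sub>F n in sequentially. norm (F (Suc n) t - T f t) \<le> 3 / 4 * (4 * (3 / 4) ^ n) * exp t"
        using contr[OF T[OF F_good] T[OF f_good] F_good f_good F_f that]
        by (simp add: F_Suc)
      show "(\<lambda>n. 3 / 4 * (4 * (3 / 4) ^ n) * exp t) \<longlonglongrightarrow> 0"
        by real_asymp
    qed
  qed
  obtain y1 y2 C where Y: "\<forall>t\<ge>0. (T f has_real_derivative y1 t) (at t)"
      "\<forall>t\<ge>0. (y1 has_real_derivative y2 t) (at t)"
      "\<forall>t\<ge>0. y2 t - 2 * y1 t - 3 * T f t = - (3 * f t - (f t)\<^sup>2)" "T f 0 = 1"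
      "\<forall>t\<ge>0. \<bar>y1 t\<bar> \<le> C" "\<forall>t\<ge>0. T f t \<in> {0..1}"
    using T[OF f_good] unfolding step_def by blast
  show thesis
  \<comment> \<open>The profile is \<open>T f\<close> and not \<open>f\<close>: the two are known to
    agree only for \<open>t \<ge> 0\<close>, and a two-sided derivative at \<open>0\<close> is
    available only for \<open>T f\<close>.\<close>
  proof (rule that[of "T f" y1 C])
    show "(y1 has_real_derivative 2 * y1 t + (T f t)\<^sup>2) (at t)" if "0 \<le> t" for t
    proof -
      have "y2 t = 2 * y1 t + (T f t)\<^sup>2" using Y(3) Tf[OF that] that by (auto simp: algebra_simps)
      with Y(2) that show ?thesis by auto
    qed
  qed (use Y in auto)
qed

subsection \<open>Orders of growth\<close>

lemma powr_bigo_powr: "a \<le> b \<Longrightarrow> (\<lambda>t::real. t powr a) \<in> O(\<lambda>t. t powr b)"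
  by (rule landau_o.big_mono) (use eventually_ge_at_top[of "1::real"] in eventually_elim, auto intro: powr_mono)

lemma bigo_powr_mono:
  fixes F :: "real \<Rightarrow> real"
  assumes "F \<in> O(\<lambda>t. t powr a)" "a \<le> b"
  shows "F \<in> O(\<lambda>t. t powr b)"
  using landau_o.big_trans[OF assms(1) powr_bigo_powr[OF assms(2)]] .

lemma bigo_powr_mult:
  fixes F G :: "real \<Rightarrow> real"
  assumes "F \<in> O(\<lambda>t. t powr a)" "G \<in> O(\<lambda>t. t powr b)" "a + b \<le> c"
  shows "(\<lambda>t. F t * G t) \<in> O(\<lambda>t. t powr c)"
proof -
  have "(\<lambda>t. F t * G t) \<in> O(\<lambda>t. t powr (a + b))"
    using landau_o.big.mult[OF assms(1,2)] by (simp only: powr_add)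
  then show ?thesis using assms(3) by (rule bigo_powr_mono)
qed

lemma tendsto_zero_of_bigo_powr:
  fixes F :: "real \<Rightarrow> real"
  assumes "F \<in> O(\<lambda>t. t powr a)" "a < 0"
  shows "(F \<longlongrightarrow> 0) at_top"
proof -
  have "((\<lambda>t::real. t powr a) \<longlongrightarrow> 0) at_top"
    using \<open>a < 0\<close> by real_asymp
  then have "(\<lambda>t::real. t powr a) \<in> o(\<lambda>_. 1)"
    by (intro smalloI_tendsto) auto
  then have "F \<in> o(\<lambda>_. 1)"
    by (rule landau_o.big_small_trans[OF assms(1)])
  from smalloD_tendsto[OF this] show ?thesis by simp
qed

lemma bigo_powr_eventually:
  fixes F :: "real \<Rightarrow> real"
  assumes "F \<in> O(\<lambda>t. t powr a)"
  obtains K T where "0 < K" "1 \<le> T" "T0 \<le> T" "\<And>t. T \<le> t \<Longrightarrow> \<bar>F t\<bar> \<le> K * t powr a"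
proof -
  from assms obtain K where K: "0 < K" "\<forall>\<^sub>F t in at_top. \<bar>F t\<bar> \<le> K * \<bar>t powr a\<bar>"
    by (auto elim: landau_o.bigE)
  then obtain T where "\<And>t. T \<le> t \<Longrightarrow> \<bar>F t\<bar> \<le> K * t powr a"
    by (auto simp: eventually_at_top_linorder)
  with K(1) show thesis
    by (intro that[of K "max T (max T0 1)"]) auto
qed

lemma bigo_powrI:
  fixes F :: "real \<Rightarrow> real"
  assumes "\<And>t. T \<le> t \<Longrightarrow> \<bar>F t\<bar> \<le> K * t powr a"
  shows "F \<in> O(\<lambda>t. t powr a)"
  by (rule bigoI[where c = K]) (use eventually_ge_at_top[of T] in eventually_elim, auto dest: assms)

text \<open>Boundedness excludes the homogeneous solution \<open>exp (2 t)\<close>. The barrier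
  \<open>K t^(- a)\<close> is nonincreasing, so \<open>K t^(- a) + \<sigma> H\<close> with
  \<open>\<sigma> = 1\<close> or \<open>\<sigma> = - 1\<close> satisfies the backward inequality
  with rate \<open>2\<close>; the two signs bound the modulus of \<open>H\<close>.\<close>

lemma first_order_decay:
  fixes H :: "real \<Rightarrow> real"
  assumes der: "\<And>t. T0 \<le> t \<Longrightarrow> (H has_real_derivative 2 * H t + G t) (at t)"
    and bd: "H \<in> O(\<lambda>t. t powr 0)" and G: "G \<in> O(\<lambda>t. t powr - a)" and "0 \<le> a"
  shows "H \<in> O(\<lambda>t. t powr - a)"
proof -
  obtain K T1 where K: "0 < K" "1 \<le> T1" "T0 \<le> T1"
    "\<And>t. T1 \<le> t \<Longrightarrow> \<bar>G t\<bar> \<le> K * t powr - a"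
    using bigo_powr_eventually[OF G] by blast
  obtain C T where C: "0 < C" "1 \<le> T" "T1 \<le> T" "\<And>t. T \<le> t \<Longrightarrow> \<bar>H t\<bar> \<le> C * t powr 0"
    using bigo_powr_eventually[OF bd] by blast
  have le1: "t powr - a \<le> 1" if "T \<le> t" for t
  proof -
    have "1 powr a \<le> t powr a" using that C(2) \<open>0 \<le> a\<close> by (intro powr_mono2) auto
    then show ?thesis using that C by (simp add: powr_minus inverse_le_1_iff)
  qed
  have dp: "((\<lambda>t. K * t powr - a) has_real_derivative - (a * K * s powr (- a - 1))) (at s)" if "T \<le> s" for s
    using that C by (auto intro!: derivative_eq_intros)
  have bound: "0 \<le> K * t powr - a + \<sigma> * H t" if "T \<le> t" and \<sigma>: "\<bar>\<sigma>\<bar> = 1" for \<sigma> t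
  proof (rule nonneg_of_deriv_le_backward[where H = "\<lambda>t. K * t powr - a + \<sigma> * H t"
        and a = T and c = 2 and b = 0 and C = "K + C"])
    show "((\<lambda>t. K * t powr - a + \<sigma> * H t) has_real_derivative
        - (a * K * s powr (- a - 1)) + \<sigma> * (2 * H s + G s)) (at s)" if "T \<le> s" for s
      by (intro DERIV_add dp DERIV_cmult der) (use that C K in auto)
    show "- (a * K * s powr (- a - 1)) + \<sigma> * (2 * H s + G s) \<le> 2 * (K * s powr - a + \<sigma> * H s)"
      if "T \<le> s" for s
    proof -
      have "\<sigma> * G s \<le> \<bar>G s\<bar>" using \<sigma> by (metis abs_ge_self abs_mult mult_1)
      also have "\<dots> \<le> K * s powr - a" using K that C by auto
      finally have "\<sigma> * G s \<le> K * s powr - a" .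
      moreover have "0 \<le> a * K * s powr (- a - 1)" "0 \<le> K * s powr - a"
        using K \<open>0 \<le> a\<close> by auto
      ultimately show ?thesis by (simp add: algebra_simps)
    qed
    show "\<bar>K * s powr - a + \<sigma> * H s\<bar> \<le> (K + C) * exp (0 * s)" if "T \<le> s" for s
    proof -
      have "\<bar>K * s powr - a\<bar> \<le> K" using le1[OF that] K by simp
      moreover have "\<bar>\<sigma> * H s\<bar> \<le> C" using C(4)[OF that] \<sigma> that C by (simp add: abs_mult)
      ultimately show ?thesis by simp
    qed
  qed (use that in auto)
  show ?thesis
  proof (rule bigo_powrI[of T _ K])
    show "\<bar>H t\<bar> \<le> K * t powr - a" if "T \<le> t" for t
      using bound[OF that, of 1] bound[OF that, of "- 1"] by (simp add: abs_le_iff)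
  qed
qed

text \<open>With \<open>p' = - K t^(- b)\<close> the function \<open>F - p\<close> increases and
  \<open>F + p\<close> decreases; the limit \<open>c\<close> lies between them, hence within
  \<open>p t\<close> of \<open>F t\<close>. The free constant of the expansion is produced in this
  way.\<close>

lemma antiderivative_converges:
  fixes F :: "real \<Rightarrow> real"
  assumes der: "\<And>t. T0 \<le> t \<Longrightarrow> (F has_real_derivative D t) (at t)"
    and D: "D \<in> O(\<lambda>t. t powr - b)" and "1 < b"
  obtains c where "(\<lambda>t. F t - c) \<in> O(\<lambda>t. t powr (1 - b))"
proof -
  obtain K T where K: "0 < K" "1 \<le> T" "T0 \<le> T"
    "\<And>t. T \<le> t \<Longrightarrow> \<bar>D t\<bar> \<le> K * t powr - b"
    using bigo_powr_eventually[OF D] by blast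
  define p where "p t = K / (b - 1) * t powr (1 - b)" for t
  have dp: "(p has_real_derivative - (K * t powr - b)) (at t)" if "T \<le> t" for t
  proof -
    have "(p has_real_derivative K / (b - 1) * ((1 - b) * t powr (1 - b - 1))) (at t)"
      unfolding p_def by (rule DERIV_cmult has_real_derivative_powr)+ (use that K in auto)
    also have "K / (b - 1) * ((1 - b) * t powr (1 - b - 1)) = - (K * t powr - b)"
      using \<open>1 < b\<close> by (simp add: divide_simps) (simp add: algebra_simps)
    finally show ?thesis .
  qed
  have p0: "0 \<le> p t" for t using K \<open>1 < b\<close> by (simp add: p_def)
  have up: "F s - p s \<le> F t - p t" if "T \<le> s" "s \<le> t" for s t
  proof (rule deriv_nonneg_imp_le[where F = "\<lambda>t. F t - p t", OF _ _ that])
    show "((\<lambda>t. F t - p t) has_real_derivative D t - - (K * t powr - b)) (at t)" if "T \<le> t" for t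
      by (intro derivative_intros dp der) (use that K in auto)
    show "0 \<le> D t - - (K * t powr - b)" if "T \<le> t" for t using K(4)[OF that] by simp
  qed
  have down: "F t + p t \<le> F s + p s" if "T \<le> s" "s \<le> t" for s t
  proof -
    have "- (F s + p s) \<le> - (F t + p t)"
    proof (rule deriv_nonneg_imp_le[where F = "\<lambda>t. - (F t + p t)", OF _ _ that])
      show "((\<lambda>t. - (F t + p t)) has_real_derivative - (D t + - (K * t powr - b))) (at t)" if "T \<le> t" for t
        by (intro derivative_intros dp der) (use that K in auto)
      show "0 \<le> - (D t + - (K * t powr - b))" if "T \<le> t" for t using K(4)[OF that] by simp
    qed
    then show ?thesis by simp
  qed
  have cross: "F s - p s \<le> F t + p t" if "T \<le> s" "T \<le> t" for s t
    using up[of s "max s t"] down[of t "max s t"] p0[of "max s t"] that by linarith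
  define c where "c = (SUP t\<in>{T..}. F t - p t)"
  have bdd: "bdd_above ((\<lambda>t. F t - p t) ` {T..})"
    using cross[of _ T] by (intro bdd_aboveI2[where M = "F T + p T"]) auto
  have "F t - p t \<le> c" "c \<le> F t + p t" if "T \<le> t" for t
    unfolding c_def using that bdd by (auto intro!: cSUP_upper cSUP_least cross)
  then have "\<bar>F t - c\<bar> \<le> K / (b - 1) * t powr (1 - b)" if "T \<le> t" for t
    using that by (auto simp: abs_le_iff p_def algebra_simps)
  then show thesis
    by (intro that[of c] bigo_powrI)
qed

subsection \<open>Polynomials in the logarithm\<close>

definition log_term :: "real poly \<Rightarrow> nat \<Rightarrow> real \<Rightarrow> real" where
  "log_term p n t = poly p (ln t) / t ^ n"

text \<open>The derivative of \<open>p (ln t) / t^n\<close> is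
  \<open>(p' - n p) (ln t) / t^(n + 1)\<close>: on coefficients, differentiation is this operator
  together with a shift of the order by one.\<close>

definition log_term_deriv :: "real poly \<Rightarrow> nat \<Rightarrow> real poly" where
  "log_term_deriv p n = pderiv p - smult (real n) p"

lemma log_term_simps:
  "log_term (p + q) n t = log_term p n t + log_term q n t"
  "log_term (p - q) n t = log_term p n t - log_term q n t"
  "log_term (smult c p) n t = c * log_term p n t"
  "log_term 0 n t = 0"
  "log_term p m t * log_term q n t = log_term (p * q) (m + n) t"
  by (simp_all add: log_term_def add_divide_distrib diff_divide_distrib power_add)

lemma log_term_sum: "log_term (\<Sum>i\<in>I. p i) n t = (\<Sum>i\<in>I. log_term (p i) n t)"
  by (simp add: log_term_def poly_sum sum_divide_distrib)

lemma has_real_derivative_log_term: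
  assumes "0 < t"
  shows "(log_term p n has_real_derivative log_term (log_term_deriv p n) (Suc n) t) (at t)"
proof -
  have "((\<lambda>t. poly p (ln t) * t powr (- real n)) has_real_derivative
      poly (pderiv p) (ln t) * (1 / t) * t powr (- real n)
        + poly p (ln t) * (- real n * t powr (- real n - 1))) (at t)"
    using assms by (auto intro!: derivative_eq_intros DERIV_chain2[OF poly_DERIV])
  moreover have "t powr (- real n - 1) = inverse t * t powr (- real n)"
    using assms by (simp add: powr_diff field_simps)
  moreover have "t powr (- real n) = 1 / t ^ n"
    using assms by (simp add: powr_minus powr_realpow divide_simps)
  ultimately have "((\<lambda>t. poly p (ln t) * t powr (- real n)) has_real_derivative
      log_term (log_term_deriv p n) (Suc n) t) (at t)"
    using assms by (simp add: log_term_def log_term_deriv_def field_simps)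
  then show ?thesis
  proof (rule DERIV_cong_ev[THEN iffD1, rotated 3])
    show "\<forall>\<^sub>F s in nhds t. poly p (ln s) * s powr - real n = log_term p n s"
      using eventually_nhds_in_open[of "{0<..}" t] assms
      by (auto elim!: eventually_mono simp: log_term_def powr_minus powr_realpow divide_simps)
  qed auto
qed

lemma poly_ln_bigo:
  assumes "0 < \<epsilon>"
  shows "(\<lambda>t. poly p (ln t)) \<in> O(\<lambda>t::real. t powr \<epsilon>)"
  using assms
proof (induction p arbitrary: \<epsilon>)
  case 0
  then show ?case by simp
next
  case (pCons a p)
  have "(\<lambda>t::real. ln t) \<in> O(\<lambda>t. t powr (\<epsilon> / 2))"
    using pCons.prems by real_asymp
  moreover have "(\<lambda>t. poly p (ln t)) \<in> O(\<lambda>t. t powr (\<epsilon> / 2))"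
    using pCons.prems by (intro pCons.IH) auto
  ultimately have "(\<lambda>t. ln t * poly p (ln t)) \<in> O(\<lambda>t. t powr \<epsilon>)"
    by (rule bigo_powr_mult) simp
  moreover have "(\<lambda>t::real. a) \<in> O(\<lambda>t. t powr \<epsilon>)"
    using pCons.prems by real_asymp
  ultimately show ?case
    by (simp add: sum_in_bigo)
qed

lemma log_term_bigo:
  assumes "b < real n"
  shows "log_term p n \<in> O(\<lambda>t. t powr - b)"
proof -
  have "(\<lambda>t. poly p (ln t) * t powr - real n) \<in> O(\<lambda>t. t powr - b)"
    by (rule bigo_powr_mult[OF poly_ln_bigo[of "real n - b"] landau_o.big_refl]) (use assms in auto)
  also have "?this \<longleftrightarrow> ?thesis"
    by (rule landau_o.big.in_cong) (use eventually_gt_at_top[of "0::real"] in eventually_elim,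
      auto simp: log_term_def powr_minus powr_realpow divide_simps)
  finally show ?thesis .
qed

subsection \<open>The recursion for the polynomials\<close>

text \<open>Since \<open>pderiv\<close> lowers the degree, \<open>a - 2 D\<close> is inverted by a
  finite Neumann series: \<open>q / a\<close> solves the equation up to \<open>2 q' / a\<close>, to
  which the induction hypothesis applies.\<close>

lemma poly_equation_ex:
  fixes q :: "real poly"
  assumes "a \<noteq> 0"
  shows "\<exists>p. smult a p - smult 2 (pderiv p) = q"
proof (induction "degree q" arbitrary: q rule: less_induct)
  case less
  show ?case
  proof (cases "pderiv q = 0")
    case True
    then have "smult a (smult (1 / a) q) - smult 2 (pderiv (smult (1 / a) q)) = q"
      using assms by (simp add: pderiv_smult)
    then show ?thesis by blast
  next
    case False
    then have "degree (smult (2 / a) (pderiv q)) < degree q"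
      using assms by (simp add: degree_pderiv pderiv_eq_0_iff)
    from less[OF this] obtain p where
      p: "smult a p - smult 2 (pderiv p) = smult (2 / a) (pderiv q)" by blast
    have "smult a (smult (1 / a) q + p) - smult 2 (pderiv (smult (1 / a) q + p)) = q"
      using assms p by (simp add: pderiv_smult pderiv_add smult_add_right algebra_simps)
    then show ?thesis by blast
  qed
qed

lemma poly_equation_unique:
  fixes p q :: "real poly"
  assumes "a \<noteq> 0" "smult a p - smult 2 (pderiv p) = smult a q - smult 2 (pderiv q)"
  shows "p = q"
proof (rule ccontr)
  assume "p \<noteq> q"
  define r where "r = p - q"
  have r: "smult a r = smult 2 (pderiv r)" "r \<noteq> 0"
    using assms \<open>p \<noteq> q\<close> by (simp_all add: r_def pderiv_diff smult_diff_right algebra_simps)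
  then have "degree r = degree (pderiv r)"
    using assms(1) by (metis degree_smult_eq zero_neq_numeral)
  then have "degree r = 0" by (simp add: degree_pderiv)
  then have "pderiv r = 0" by (simp add: pderiv_eq_0_iff)
  with r assms(1) show False by simp
qed

text \<open>For \<open>n \<ge> 3\<close> the factor \<open>2 n - 4\<close> is nonzero, so the
  equation is uniquely solvable and \<open>THE\<close> is legitimate. At \<open>n = 2\<close> the
  factor vanishes, which is why the second polynomial is prescribed and carries the parameter
  \<open>c\<close>.\<close>

function hitting_poly :: "real \<Rightarrow> nat \<Rightarrow> real poly" where
  "hitting_poly c n =
     (if n = 1 then [:2:] else if n = 2 then [:c, 2:] else if n = 0 then 0
      else (THE p. smult (2 * real n - 4) p - smult 2 (pderiv p) =
        (\<Sum>k=2..n-1. hitting_poly c k * hitting_poly c (n + 1 - k))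
        - smult ((real n - 1) * real n) (hitting_poly c (n - 1))
        + smult (2 * real n - 1) (pderiv (hitting_poly c (n - 1)))
        - pderiv (pderiv (hitting_poly c (n - 1)))))"
  by (metis surj_pair, (erule Pair_inject, hypsubst, rule refl))
termination
  \<comment> \<open>For \<open>k\<close> in \<open>{2..n-1}\<close> both \<open>k\<close> and
    \<open>n + 1 - k\<close> are at most \<open>n - 1\<close>.\<close>
  by (relation "Wellfounded.measure snd", rule wf_measure, unfold in_measure snd_conv atLeastAtMost_iff)
    arith+

declare hitting_poly.simps [simp del]

lemma hitting_recursion_hitting_poly: "hitting_recursion c (hitting_poly c)"
  unfolding hitting_recursion_def
proof (intro conjI allI impI)
  show "hitting_poly c 1 = [:2:]" "hitting_poly c 2 = [:c, 2:]"
    by (simp_all add: hitting_poly.simps)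
  fix n :: nat assume n: "3 \<le> n"
  define q where "q = (\<Sum>k=2..n-1. hitting_poly c k * hitting_poly c (n + 1 - k))
        - smult ((real n - 1) * real n) (hitting_poly c (n - 1))
        + smult (2 * real n - 1) (pderiv (hitting_poly c (n - 1)))
        - pderiv (pderiv (hitting_poly c (n - 1)))"
  have a: "2 * real n - 4 \<noteq> 0" using n by auto
  have "\<exists>!p. smult (2 * real n - 4) p - smult 2 (pderiv p) = q"
    by (rule ex_ex1I[OF poly_equation_ex[OF a]]) (rule poly_equation_unique[OF a], simp only:)
  from theI'[OF this] have "smult (2 * real n - 4) (THE p. smult (2 * real n - 4) p - smult 2 (pderiv p) = q)
      - smult 2 (pderiv (THE p. smult (2 * real n - 4) p - smult 2 (pderiv p) = q)) = q" .
  moreover have "(n = 0) = False" "(n = 1) = False" "(n = 2) = False" using n by auto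
  then have "hitting_poly c n = (THE p. smult (2 * real n - 4) p - smult 2 (pderiv p) = q)"
    unfolding q_def by (subst hitting_poly.simps) (simp only: if_False)
  ultimately show "smult (2 * real n - 4) (hitting_poly c n) - smult 2 (pderiv (hitting_poly c n)) =
      (\<Sum>k=2..n-1. hitting_poly c k * hitting_poly c (n + 1 - k))
        - smult ((real n - 1) * real n) (hitting_poly c (n - 1))
        + smult (2 * real n - 1) (pderiv (hitting_poly c (n - 1)))
        - pderiv (pderiv (hitting_poly c (n - 1)))"
    by (simp only: q_def)
qed

lemma hitting_recursion_init:
  assumes "hitting_recursion c P"
  shows "P 1 = [:2:]" "P (Suc 0) = [:2:]" "P 2 = [:c, 2:]"
  using assms unfolding hitting_recursion_def One_nat_def by blast+

lemma hitting_recursion_step: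
  assumes "hitting_recursion c P" "3 \<le> n"
  shows "smult (2 * real n - 4) (P n) - smult 2 (pderiv (P n)) =
    (\<Sum>k=2..n-1. P k * P (n + 1 - k)) - smult ((real n - 1) * real n) (P (n - 1))
    + smult (2 * real n - 1) (pderiv (P (n - 1))) - pderiv (pderiv (P (n - 1)))"
  using assms unfolding hitting_recursion_def by blast

lemma hitting_recursion_unique:
  assumes P: "hitting_recursion c P" and Q: "hitting_recursion c Q" and "1 \<le> n"
  shows "Q n = P n"
  using \<open>1 \<le> n\<close>
proof (induction n rule: less_induct)
  case (less n)
  consider "n = 1" | "n = 2" | "3 \<le> n" using less.prems by linarith
  then show ?case
  proof cases
    case 3
    have eq: "Q k = P k" if "1 \<le> k" "k < n" for k
      by (rule less.IH[OF that(2,1)])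
    have "(\<Sum>k=2..n-1. Q k * Q (n + 1 - k)) = (\<Sum>k=2..n-1. P k * P (n + 1 - k))"
    proof (intro sum.cong refl)
      fix k assume "k \<in> {2..n-1}"
      then have "1 \<le> k" "k < n" "1 \<le> n + 1 - k" "n + 1 - k < n"
        unfolding atLeastAtMost_iff using 3 by arith+
      then show "Q k * Q (n + 1 - k) = P k * P (n + 1 - k)"
        by (simp only: eq)
    qed
    moreover have "Q (n - 1) = P (n - 1)" using 3 by (intro eq) auto
    ultimately have "smult (2 * real n - 4) (Q n) - smult 2 (pderiv (Q n)) =
        smult (2 * real n - 4) (P n) - smult 2 (pderiv (P n))"
      by (simp only: hitting_recursion_step[OF P 3] hitting_recursion_step[OF Q 3])
    moreover have "2 * real n - 4 \<noteq> 0" using 3 by auto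
    ultimately show ?thesis by (rule poly_equation_unique[rotated])
  qed (simp_all only: hitting_recursion_init[OF P] hitting_recursion_init[OF Q])
qed

section \<open>Partial sums of the expansion and their defect in the profile equation\<close>

definition partial_expansion :: "(nat \<Rightarrow> real poly) \<Rightarrow> nat \<Rightarrow> real \<Rightarrow> real" where
  "partial_expansion P N t = (\<Sum>n=1..N. log_term (P n) n t)"

definition partial_expansion1 :: "(nat \<Rightarrow> real poly) \<Rightarrow> nat \<Rightarrow> real \<Rightarrow> real" where
  "partial_expansion1 P N t = (\<Sum>n=1..N. log_term (log_term_deriv (P n) n) (Suc n) t)"

definition partial_expansion2 :: "(nat \<Rightarrow> real poly) \<Rightarrow> nat \<Rightarrow> real \<Rightarrow> real" where
  "partial_expansion2 P N t =
     (\<Sum>n=1..N. log_term (log_term_deriv (log_term_deriv (P n) n) (Suc n)) (Suc (Suc n)) t)"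

text \<open>The products in the square of a partial sum whose order exceeds \<open>N + 1\<close>;
  the recursion up to \<open>N\<close> does not match them.\<close>

definition high_pairs :: "nat \<Rightarrow> (nat \<times> nat) set" where
  "high_pairs N = {(j, k). j \<in> {1..N} \<and> k \<in> {1..N} \<and> N + 1 < j + k}"

text \<open>The defect \<open>2 S' + S^2 - S''\<close> of the partial sum \<open>S\<close>, as an
  explicit finite sum of terms of order at least \<open>N + 2\<close>. In this form it can be
  differentiated term by term, which a mere growth bound would not allow.\<close>

definition residual :: "(nat \<Rightarrow> real poly) \<Rightarrow> nat \<Rightarrow> real \<Rightarrow> real" where
  "residual P N t = (\<Sum>(j, k)\<in>high_pairs N. log_term (P j * P k) (j + k) t)
     - log_term (log_term_deriv (log_term_deriv (P N) N) (Suc N)) (Suc (Suc N)) t"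

definition residual1 :: "(nat \<Rightarrow> real poly) \<Rightarrow> nat \<Rightarrow> real \<Rightarrow> real" where
  "residual1 P N t =
     (\<Sum>(j, k)\<in>high_pairs N. log_term (log_term_deriv (P j * P k) (j + k)) (Suc (j + k)) t)
     - log_term (log_term_deriv (log_term_deriv (log_term_deriv (P N) N) (Suc N)) (Suc (Suc N)))
         (Suc (Suc (Suc N))) t"

lemma finite_high_pairs: "finite (high_pairs N)"
  by (rule finite_subset[of _ "{1..N} \<times> {1..N}"]) (auto simp: high_pairs_def)

lemma partial_expansion_derivatives:
  assumes "0 < t"
  shows "(partial_expansion P N has_real_derivative partial_expansion1 P N t) (at t)"
    "(partial_expansion1 P N has_real_derivative partial_expansion2 P N t) (at t)"
    "(residual P N has_real_derivative residual1 P N t) (at t)"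
proof -
  show "(partial_expansion P N has_real_derivative partial_expansion1 P N t) (at t)"
    unfolding partial_expansion_def[abs_def] partial_expansion1_def[abs_def]
    by (intro DERIV_sum has_real_derivative_log_term assms)
  show "(partial_expansion1 P N has_real_derivative partial_expansion2 P N t) (at t)"
    unfolding partial_expansion1_def[abs_def] partial_expansion2_def[abs_def]
    by (intro DERIV_sum has_real_derivative_log_term assms)
  show "(residual P N has_real_derivative residual1 P N t) (at t)"
    unfolding residual_def[abs_def] residual1_def[abs_def] case_prod_beta'
    by (intro DERIV_diff DERIV_sum has_real_derivative_log_term assms)
qed

lemma residual_bigo:
  assumes "0 < \<kappa>"
  shows "residual P N \<in> O(\<lambda>t. t powr - (real N + 2 - \<kappa>))"
    "residual1 P N \<in> O(\<lambda>t. t powr - (real N + 3 - \<kappa>))"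
proof -
  have *: "log_term p n \<in> O(\<lambda>t. t powr - (real N + 2 - \<kappa>))" if "N + 2 \<le> n" for p n
    using that assms by (intro log_term_bigo) (auto simp flip: of_nat_le_iff[where ?'a = real])
  have **: "log_term p n \<in> O(\<lambda>t. t powr - (real N + 3 - \<kappa>))" if "N + 3 \<le> n" for p n
    using that assms by (intro log_term_bigo) (auto simp flip: of_nat_le_iff[where ?'a = real])
  show "residual P N \<in> O(\<lambda>t. t powr - (real N + 2 - \<kappa>))"
    unfolding residual_def[abs_def] case_prod_beta'
    by (intro sum_in_bigo big_sum_in_bigo *) (auto simp: high_pairs_def)
  show "residual1 P N \<in> O(\<lambda>t. t powr - (real N + 3 - \<kappa>))"
    unfolding residual1_def[abs_def] case_prod_beta'
    by (intro sum_in_bigo big_sum_in_bigo **) (auto simp: high_pairs_def)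
qed

text \<open>The recursion says that the coefficients of \<open>1 / t ^ (n + 1)\<close> in \<open>S'' - 2 S' - S\<^sup>2\<close> vanish for \<open>n \<le> N\<close>.\<close>

lemma recursion_coefficient:
  assumes P: "hitting_recursion c P" and "1 \<le> n"
  shows "(\<Sum>k=1..n. P k * P (n + 1 - k)) + smult 2 (log_term_deriv (P n) n) =
    (if n = 1 then 0 else log_term_deriv (log_term_deriv (P (n - 1)) (n - 1)) n)"
proof -
  consider "n = 1" | "n = 2" | "3 \<le> n" using assms(2) by linarith
  then show ?thesis
  proof cases
    case 1
    then show ?thesis by (simp add: hitting_recursion_init[OF P] log_term_deriv_def pderiv_pCons)
  next
    case 2
    have "{1..2::nat} = {1, 2}" by auto
    with 2 show ?thesis
      by (simp add: hitting_recursion_init[OF P] log_term_deriv_def pderiv_pCons pderiv_diff pderiv_smult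
          flip: numeral_2_eq_2)
  next
    case 3
    \<comment> \<open>The two end terms each equal \<open>2 P n\<close> because
      \<open>P 1 = 2\<close>; together they account for the \<open>- 4\<close> in the factor
      \<open>2 n - 4\<close>.\<close>
    then have s: "{1..n} = insert 1 (insert n {2..n-1})" by auto
    have "(\<Sum>k=1..n. P k * P (n + 1 - k)) = smult 4 (P n) + (\<Sum>k=2..n-1. P k * P (n + 1 - k))"
      unfolding s using 3
      by (simp add: hitting_recursion_init(2)[OF P]) (simp add: fun_eq_iff flip: poly_eq_poly_eq_iff)
    moreover have "(\<Sum>k=2..n-1. P k * P (n + 1 - k)) =
        smult (2 * real n - 4) (P n) - smult 2 (pderiv (P n))
        + smult ((real n - 1) * real n) (P (n - 1))
        - smult (2 * real n - 1) (pderiv (P (n - 1))) + pderiv (pderiv (P (n - 1)))"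
      using hitting_recursion_step[OF P 3] by (simp only: algebra_simps)
    ultimately have e: "(\<Sum>k=1..n. P k * P (n + 1 - k)) = smult 4 (P n)
        + (smult (2 * real n - 4) (P n) - smult 2 (pderiv (P n))
        + smult ((real n - 1) * real n) (P (n - 1))
        - smult (2 * real n - 1) (pderiv (P (n - 1))) + pderiv (pderiv (P (n - 1))))"
      by (simp only:)
    have r: "real (n - 1) = real n - 1" using 3 by simp
    show ?thesis
      unfolding e using 3
      by (simp add: log_term_deriv_def r pderiv_diff pderiv_smult)
        (simp add: fun_eq_iff algebra_simps flip: poly_eq_poly_eq_iff)
  qed
qed

text \<open>Everything is sorted by powers of \<open>1 / t\<close>: the square by
  \<open>j + k = n + 1\<close>, the second derivative after moving its index by one. The terms of
  order at most \<open>N + 1\<close> cancel by \<open>recursion_coefficient\<close>; the rest is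
  \<open>residual\<close>.\<close>

lemma residual_eq:
  assumes P: "hitting_recursion c P" and "1 \<le> N" "0 < t"
  shows "partial_expansion2 P N t =
    2 * partial_expansion1 P N t + (partial_expansion P N t)\<^sup>2 - residual P N t"
proof -
  define DD where "DD n = log_term_deriv (log_term_deriv (P n) n) (Suc n)" for n
  define low where "low = {(j, k). j \<in> {1..N} \<and> k \<in> {1..N} \<and> j + k \<le> N + 1}"
  have "(\<Sum>n=1..N. log_term (DD n) (Suc (Suc n)) t) =
      (\<Sum>n=1..N. log_term (if n = 1 then 0 else DD (n - 1)) (Suc n) t) + log_term (DD N) (Suc (Suc N)) t"
    using \<open>1 \<le> N\<close>
  proof (induction N rule: dec_induct)
    case (step n)
    then show ?case by (simp add: DD_def)
  qed (simp add: log_term_simps)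
  then have S2: "partial_expansion2 P N t =
      (\<Sum>n=1..N. log_term (if n = 1 then 0 else DD (n - 1)) (Suc n) t) + log_term (DD N) (Suc (Suc N)) t"
    by (simp add: partial_expansion2_def DD_def)
  have S1: "2 * partial_expansion1 P N t =
      (\<Sum>n=1..N. log_term (smult 2 (log_term_deriv (P n) n)) (Suc n) t)"
    by (simp add: partial_expansion1_def sum_distrib_left log_term_simps)
  have "(partial_expansion P N t)\<^sup>2 =
      (\<Sum>(j, k)\<in>{1..N} \<times> {1..N}. log_term (P j * P k) (j + k) t)"
    by (simp add: partial_expansion_def power2_eq_square sum_product sum.cartesian_product log_term_simps)
  also have "{1..N} \<times> {1..N} = low \<union> high_pairs N"
    by (auto simp: low_def high_pairs_def)
  also have "(\<Sum>(j, k)\<in>\<dots>. log_term (P j * P k) (j + k) t) =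
      (\<Sum>(j, k)\<in>low. log_term (P j * P k) (j + k) t)
      + (\<Sum>(j, k)\<in>high_pairs N. log_term (P j * P k) (j + k) t)"
    by (rule sum.union_disjoint)
      (auto simp: low_def high_pairs_def intro: finite_subset[of _ "{1..N} \<times> {1..N}"] finite_high_pairs)
  also have "(\<Sum>(j, k)\<in>low. log_term (P j * P k) (j + k) t) =
      (\<Sum>(n, k)\<in>(SIGMA n:{1..N}. {1..n}). log_term (P k * P (n + 1 - k)) (Suc n) t)"
    by (rule sum.reindex_bij_witness[where i = "\<lambda>(n, k). (k, n + 1 - k)" and j = "\<lambda>(j, k). (j + k - 1, j)"])
      (auto simp: low_def)
  also have "\<dots> = (\<Sum>n=1..N. log_term (\<Sum>k=1..n. P k * P (n + 1 - k)) (Suc n) t)"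
    by (simp add: log_term_sum flip: sum.Sigma)
  finally have S: "(partial_expansion P N t)\<^sup>2 =
      (\<Sum>n=1..N. log_term (\<Sum>k=1..n. P k * P (n + 1 - k)) (Suc n) t)
      + (\<Sum>(j, k)\<in>high_pairs N. log_term (P j * P k) (j + k) t)" .
  have "(\<Sum>n=1..N. log_term (if n = 1 then 0 else DD (n - 1)) (Suc n) t) =
      (\<Sum>n=1..N. log_term ((\<Sum>k=1..n. P k * P (n + 1 - k)) + smult 2 (log_term_deriv (P n) n)) (Suc n) t)"
  proof (intro sum.cong refl)
    fix n assume "n \<in> {1..N}"
    then have "1 \<le> n" by simp
    then show "log_term (if n = 1 then 0 else DD (n - 1)) (Suc n) t = log_term ((\<Sum>k=1..n. P k * P (n + 1 - k))
        + smult 2 (log_term_deriv (P n) n)) (Suc n) t"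
      unfolding recursion_coefficient[OF P \<open>1 \<le> n\<close>] DD_def by (cases "n = 1") simp_all
  qed
  also have "\<dots> = (\<Sum>n=1..N. log_term (\<Sum>k=1..n. P k * P (n + 1 - k)) (Suc n) t)
      + (\<Sum>n=1..N. log_term (smult 2 (log_term_deriv (P n) n)) (Suc n) t)"
    by (simp only: log_term_simps(1) sum.distrib)
  finally show ?thesis
    unfolding S2 S1 S residual_def DD_def by simp
qed

text \<open>The derivative is bounded without the loss \<open>\<kappa>\<close>: as
  \<open>P 1\<close> is constant, its leading term is exactly \<open>- 2 / t^2\<close>, with no
  logarithm.\<close>

lemma partial_expansion_bigo:
  assumes P: "hitting_recursion c P" and "0 < \<kappa>" "\<kappa> < 1"
  shows "(\<lambda>t. partial_expansion P N t - (if N = 0 then 0 else 2 / t)) \<in> O(\<lambda>t. t powr (\<kappa> - 2))"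
    "partial_expansion1 P N \<in> O(\<lambda>t. t powr - 2)"
proof -
  have lt: "log_term p n \<in> O(\<lambda>t. t powr (\<kappa> - 2))" if "2 \<le> n" for p n
  proof -
    have "log_term p n \<in> O(\<lambda>t. t powr - (2 - \<kappa>))"
    proof (rule log_term_bigo)
      have "2 \<le> real n" using that by simp
      with \<open>0 < \<kappa>\<close> show "2 - \<kappa> < real n" by linarith
    qed
    then show ?thesis by simp
  qed
  show "(\<lambda>t. partial_expansion P N t - (if N = 0 then 0 else 2 / t)) \<in> O(\<lambda>t. t powr (\<kappa> - 2))"
  proof (cases "N = 0")
    case False
    then have s: "{1..N} = insert 1 {2..N}" by auto
    have "(\<lambda>t. partial_expansion P N t - (if N = 0 then 0 else 2 / t)) = (\<lambda>t. \<Sum>n=2..N. log_term (P n) n t)"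
      unfolding partial_expansion_def s using False by (simp add: log_term_def hitting_recursion_init(2)[OF P])
    moreover have "(\<lambda>t. \<Sum>n=2..N. log_term (P n) n t) \<in> O(\<lambda>t. t powr (\<kappa> - 2))"
      by (intro big_sum_in_bigo lt) simp
    ultimately show ?thesis by (simp only:)
  qed (simp add: partial_expansion_def)
  show "partial_expansion1 P N \<in> O(\<lambda>t. t powr - 2)"
    unfolding partial_expansion1_def[abs_def]
  proof (rule big_sum_in_bigo)
    fix n assume n: "n \<in> {1..N}"
    show "log_term (log_term_deriv (P n) n) (Suc n) \<in> O(\<lambda>t. t powr - 2)"
    proof (cases "n = 1")
      case True
      have "log_term_deriv (P n) n = [:- 2:]"
        using True by (simp add: log_term_deriv_def hitting_recursion_init(2)[OF P] pderiv_pCons)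
      then have "log_term (log_term_deriv (P n) n) (Suc n) = (\<lambda>t. - 2 / t ^ 2)"
        using True by (simp add: fun_eq_iff log_term_def numeral_2_eq_2)
      moreover have "(\<lambda>t::real. - 2 / t ^ 2) \<in> O(\<lambda>t. t powr - 2)" by real_asymp
      ultimately show ?thesis by (simp only:)
    next
      case False
      with n show ?thesis by (intro log_term_bigo) simp
    qed
  qed
qed

lemma partial_expansion_Suc:
  "partial_expansion P (Suc N) t = partial_expansion P N t + log_term (P (Suc N)) (Suc N) t"
  by (simp add: partial_expansion_def)

lemma bigo_of_square_mult:
  assumes "(\<lambda>t::real. t\<^sup>2 * F t) \<in> O(\<lambda>t. t powr b)"
  shows "F \<in> O(\<lambda>t. t powr (b - 2))"
proof -
  have "(\<lambda>t::real. 1 / t\<^sup>2) \<in> O(\<lambda>t. t powr - 2)" by real_asymp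
  from bigo_powr_mult[OF this assms, of "b - 2"]
  have "(\<lambda>t. 1 / t\<^sup>2 * (t\<^sup>2 * F t)) \<in> O(\<lambda>t. t powr (b - 2))" by simp
  also have "?this \<longleftrightarrow> ?thesis"
    by (rule landau_o.big.in_cong) (use eventually_gt_at_top[of "0::real"] in eventually_elim, auto)
  finally show ?thesis .
qed

subsection \<open>Asymptotic expansion of the profile\<close>

locale hitting_profile =
  fixes f f1 :: "real \<Rightarrow> real" and C :: real
  assumes f_deriv: "0 \<le> t \<Longrightarrow> (f has_real_derivative f1 t) (at t)"
    and f1_deriv: "0 \<le> t \<Longrightarrow> (f1 has_real_derivative 2 * f1 t + (f t)\<^sup>2) (at t)"
    and f_0: "f 0 = 1" and f_range: "0 \<le> t \<Longrightarrow> f t \<in> {0..1}"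
    and f1_bounded: "0 \<le> t \<Longrightarrow> \<bar>f1 t\<bar> \<le> C"
begin

lemma f_nonneg: "0 \<le> t \<Longrightarrow> 0 \<le> f t" and f_le_1: "0 \<le> t \<Longrightarrow> f t \<le> 1"
  using f_range by auto

lemma C_nonneg: "0 \<le> C"
  using f1_bounded[of 0] by simp

lemma f_power_le_1: "0 \<le> t \<Longrightarrow> f t ^ n \<le> 1"
  using f_nonneg f_le_1 by (intro power_le_one) auto

section \<open>A priori bounds: the profile follows the slow equation
  \<open>f' = - f^2 / 2\<close>\<close>

lemma f1_nonpos:
  assumes "0 \<le> t"
  shows "f1 t \<le> 0"
proof -
  have "0 \<le> - f1 t"
  proof (rule nonneg_of_deriv_le_backward[where H = "\<lambda>t. - f1 t" and a = 0 and c = 2 and b = 0 and C = C])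
    show "((\<lambda>t. - f1 t) has_real_derivative - (2 * f1 s + (f s)\<^sup>2)) (at s)" if "0 \<le> s" for s
      by (intro DERIV_minus f1_deriv that)
  qed (use f1_bounded assms in auto)
  then show ?thesis by simp
qed

text \<open>For \<open>H = f' + f^2 / 2\<close> the equation gives \<open>H' = 2 H + f f'\<close>,
  and the last term is nonpositive by \<open>f1_nonpos\<close>.\<close>

lemma f1_lower:
  assumes "0 \<le> t"
  shows "0 \<le> f1 t + (f t)\<^sup>2 / 2"
proof (rule nonneg_of_deriv_le_backward[where H = "\<lambda>t. f1 t + (f t)\<^sup>2 / 2" and a = 0 and c = 2 and b = 0 and C = "C + 1"])
  show "((\<lambda>t. f1 t + (f t)\<^sup>2 / 2) has_real_derivative (2 * f1 s + (f s)\<^sup>2) + f s * f1 s) (at s)" if "0 \<le> s" for s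
    by (auto intro!: derivative_eq_intros f1_deriv f_deriv that)
  show "2 * f1 s + (f s)\<^sup>2 + f s * f1 s \<le> 2 * (f1 s + (f s)\<^sup>2 / 2)" if "0 \<le> s" for s
    using f1_nonpos[OF that] f_nonneg[OF that] by (simp add: mult_nonneg_nonpos)
  show "\<bar>f1 s + (f s)\<^sup>2 / 2\<bar> \<le> (C + 1) * exp (0 * s)" if "0 \<le> s" for s
    using f1_bounded[OF that] f_power_le_1[OF that, of 2] zero_le_power2[of "f s"]
    unfolding abs_le_iff mult_zero_left exp_zero mult_1_right by linarith
qed (use assms in auto)

text \<open>With \<open>f1_lower\<close> this confines \<open>f' + f^2 / 2\<close> to order
  \<open>f^3\<close>. The coefficient \<open>1 / 4\<close> reduces the backward inequality with rate
  \<open>2\<close> to \<open>- f f' \<le> f^3 / 2\<close>, which is \<open>f1_lower\<close>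
  multiplied by \<open>f\<close>.\<close>

lemma f1_upper:
  assumes "0 \<le> t"
  shows "f1 t + (f t)\<^sup>2 / 2 \<le> (f t) ^ 3 / 4"
proof -
  have "0 \<le> (f t) ^ 3 / 4 - (f1 t + (f t)\<^sup>2 / 2)"
  proof (rule nonneg_of_deriv_le_backward[where H = "\<lambda>t. (f t) ^ 3 / 4 - (f1 t + (f t)\<^sup>2 / 2)"
        and a = 0 and c = 2 and b = 0 and C = "C + 2"])
    show "((\<lambda>t. (f t) ^ 3 / 4 - (f1 t + (f t)\<^sup>2 / 2)) has_real_derivative
        3 * (f s)\<^sup>2 * f1 s / 4 - ((2 * f1 s + (f s)\<^sup>2) + f s * f1 s)) (at s)" if "0 \<le> s" for s
      by (auto intro!: derivative_eq_intros f1_deriv f_deriv that)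
    show "3 * (f s)\<^sup>2 * f1 s / 4 - ((2 * f1 s + (f s)\<^sup>2) + f s * f1 s)
        \<le> 2 * ((f s) ^ 3 / 4 - (f1 s + (f s)\<^sup>2 / 2))" if "0 \<le> s" for s
    proof -
      have "(f s)\<^sup>2 * f1 s \<le> 0"
        using f1_nonpos[OF that] by (simp add: mult_nonneg_nonpos)
      moreover have "f s * (- f1 s) \<le> f s * ((f s)\<^sup>2 / 2)"
        using f1_lower[OF that] f_nonneg[OF that] by (intro mult_left_mono) auto
      ultimately show ?thesis by (simp add: power2_eq_square power3_eq_cube)
    qed
    show "\<bar>(f s) ^ 3 / 4 - (f1 s + (f s)\<^sup>2 / 2)\<bar> \<le> (C + 2) * exp (0 * s)" if "0 \<le> s" for s
      using f1_bounded[OF that] f_power_le_1[OF that, of 2] f_power_le_1[OF that, of 3]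
        zero_le_power2[of "f s"] zero_le_power[OF f_nonneg[OF that], of 3]
      unfolding abs_le_iff mult_zero_left exp_zero mult_1_right by linarith
  qed (use assms in auto)
  then show ?thesis by simp
qed

text \<open>From \<open>f' \<ge> - f^2 / 2 \<ge> - f / 2\<close>, as \<open>f \<le> 1\<close>. The
  bound is crude, but it gives positivity of \<open>f\<close> and, later, a lower bound for
  \<open>radial\<close> on bounded sets.\<close>

lemma f_lower:
  assumes "0 \<le> t"
  shows "exp (- t / 2) \<le> f t"
proof -
  have "exp (- (1 / 2) * (t - 0)) * f 0 \<le> f t"
  proof (rule nonneg_of_deriv_ge_forward[where H = f and H' = f1])
    show "- (1 / 2) * f s \<le> f1 s" if "0 \<le> s" for s
    proof -
      have "f s * f s \<le> f s * 1" using f_range[OF that] by (intro mult_left_mono) auto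
      then show ?thesis using f1_lower[OF that] by (simp add: power2_eq_square)
    qed
  qed (use f_0 f_deriv assms in auto)
  then show ?thesis by (simp add: f_0)
qed

lemma f_pos: "0 \<le> t \<Longrightarrow> 0 < f t"
  using f_lower[of t] exp_gt_zero[of "- t / 2"] by linarith

lemma f1_abs_le: "0 \<le> t \<Longrightarrow> \<bar>f1 t\<bar> \<le> (f t)\<^sup>2 / 2"
  using f1_lower[of t] f1_nonpos[of t] by simp

text \<open>Passing to \<open>1 / f\<close> linearises the slow equation: the derivative becomes
  \<open>1 / 2\<close> up to an error of at most \<open>f / 4\<close>.\<close>

lemma inverse_deriv:
  assumes "0 \<le> t"
  shows "((\<lambda>t. 1 / f t) has_real_derivative - f1 t / (f t)\<^sup>2) (at t)"
    and "1 / 2 - f t / 4 \<le> - f1 t / (f t)\<^sup>2" "- f1 t / (f t)\<^sup>2 \<le> 1 / 2"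
proof -
  show "((\<lambda>t. 1 / f t) has_real_derivative - f1 t / (f t)\<^sup>2) (at t)"
    using f_pos[OF assms] by (auto intro!: derivative_eq_intros f_deriv assms simp: power2_eq_square)
  show "1 / 2 - f t / 4 \<le> - f1 t / (f t)\<^sup>2"
  proof -
    have "(1 / 2 - f t / 4) * (f t)\<^sup>2 \<le> - f1 t"
      using f1_upper[OF assms] by (simp add: algebra_simps power2_eq_square power3_eq_cube)
    then show ?thesis using f_pos[OF assms] by (subst pos_le_divide_eq) auto
  qed
  show "- f1 t / (f t)\<^sup>2 \<le> 1 / 2"
    using f_pos[OF assms] f1_lower[OF assms] by (subst pos_divide_le_eq) auto
qed

lemma f_upper:
  assumes "0 \<le> t"
  shows "f t \<le> 4 / (4 + t)"
proof -
  have "1 / f 0 - 0 / 4 \<le> 1 / f t - t / 4"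
  proof (rule deriv_nonneg_imp_le[where F = "\<lambda>t. 1 / f t - t / 4", OF _ _ order_refl assms])
    show "((\<lambda>t. 1 / f t - t / 4) has_real_derivative - f1 s / (f s)\<^sup>2 - 1 / 4) (at s)" if "0 \<le> s" for s
      by (intro DERIV_diff inverse_deriv that) (auto intro!: derivative_eq_intros)
    show "0 \<le> - f1 s / (f s)\<^sup>2 - 1 / 4" if "0 \<le> s" for s
      using inverse_deriv(2)[OF that] f_le_1[OF that] by simp
  qed
  then show ?thesis using f_pos[OF assms] assms by (simp add: f_0 field_simps)
qed

text \<open>A bootstrap: by \<open>f_upper\<close> the error \<open>f / 4\<close> in the derivative
  of \<open>1 / f\<close> is at most \<open>1 / (4 + t)\<close>, so \<open>1 / f\<close> is
  \<open>t / 2\<close> up to a logarithm. Inverting multiplies the error by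
  \<open>(2 / t) * f t\<close>, which is of order \<open>1 / t^2\<close>.\<close>

lemma f_leading:
  assumes "0 < t"
  shows "\<bar>f t - 2 / t\<bar> \<le> 8 * (1 + ln (4 + t)) / t\<^sup>2"
proof -
  have t: "0 \<le> t" using assms by simp
  have "1 / f 0 - 0 / 2 + ln (4 + 0) \<le> 1 / f t - t / 2 + ln (4 + t)"
  proof (rule deriv_nonneg_imp_le[where F = "\<lambda>t. 1 / f t - t / 2 + ln (4 + t)", OF _ _ order_refl t])
    show "((\<lambda>t. 1 / f t - t / 2 + ln (4 + t)) has_real_derivative
        - f1 s / (f s)\<^sup>2 - 1 / 2 + 1 / (4 + s)) (at s)" if "0 \<le> s" for s
      using that by (intro DERIV_diff DERIV_add inverse_deriv that) (auto intro!: derivative_eq_intros)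
    show "0 \<le> - f1 s / (f s)\<^sup>2 - 1 / 2 + 1 / (4 + s)" if "0 \<le> s" for s
    proof -
      have "4 / (4 + s) = 4 * (1 / (4 + s))" by simp
      then show ?thesis using inverse_deriv(2)[OF that] f_upper[OF that] by linarith
    qed
  qed
  then have "1 + ln 4 \<le> 1 / f t - t / 2 + ln (4 + t)" by (simp add: f_0)
  then have 1: "1 / f t - t / 2 \<ge> - ln (4 + t)" using ln_ge_zero[of "4::real"] by linarith
  have "t / 2 - 1 / f t \<ge> 0 / 2 - 1 / f 0"
  proof (rule deriv_nonneg_imp_le[where F = "\<lambda>t. t / 2 - 1 / f t", OF _ _ order_refl t])
    show "((\<lambda>t. t / 2 - 1 / f t) has_real_derivative 1 / 2 - (- f1 s / (f s)\<^sup>2)) (at s)" if "0 \<le> s" for s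
      by (intro DERIV_diff inverse_deriv that) (auto intro!: derivative_eq_intros)
    show "0 \<le> 1 / 2 - (- f1 s / (f s)\<^sup>2)" if "0 \<le> s" for s
      using inverse_deriv(3)[OF that] by linarith
  qed
  then have 2: "1 / f t - t / 2 \<le> 1" using f_0 by simp
  have "0 \<le> ln (4 + t)" using t by simp
  with 1 2 have "\<bar>1 / f t - t / 2\<bar> \<le> 1 + ln (4 + t)" by (simp add: abs_le_iff)
  moreover have "f t \<le> 4 / t" using f_upper[OF t] frac_le[of 4 4 t "4 + t"] assms by simp
  moreover have "f t - 2 / t = - (2 / t) * f t * (1 / f t - t / 2)"
    using f_pos[OF t] assms by (simp add: field_simps)
  ultimately have "\<bar>f t - 2 / t\<bar> \<le> (2 / t) * (4 / t) * (1 + ln (4 + t))"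
    using f_pos[OF t] assms by (simp only: abs_mult) (intro mult_mono, auto)
  then show ?thesis by (simp add: power2_eq_square)
qed

lemma f_leading_bigo:
  assumes "0 < \<kappa>"
  shows "(\<lambda>t. f t - 2 / t) \<in> O(\<lambda>t. t powr (\<kappa> - 2))" "f1 \<in> O(\<lambda>t. t powr - 2)"
proof -
  have "(\<lambda>t. f t - 2 / t) \<in> O(\<lambda>t. 8 * (1 + ln (4 + t)) / t\<^sup>2)"
    by (rule landau_o.big_mono) (use eventually_gt_at_top[of 0] in eventually_elim, use f_leading in fastforce)
  also have "(\<lambda>t::real. 8 * (1 + ln (4 + t)) / t\<^sup>2) \<in> O(\<lambda>t. t powr (\<kappa> - 2))"
    using assms by real_asymp
  finally show "(\<lambda>t. f t - 2 / t) \<in> O(\<lambda>t. t powr (\<kappa> - 2))" .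
  show "f1 \<in> O(\<lambda>t. t powr - 2)"
  proof (rule bigo_powrI[of 1 _ 8])
    fix t :: real assume "1 \<le> t"
    then have "f t \<le> 4 / t" using f_upper[of t] frac_le[of 4 4 t "4 + t"] by simp
    then have "(f t)\<^sup>2 \<le> (4 / t)\<^sup>2" using f_nonneg[of t] \<open>1 \<le> t\<close> by (intro power_mono) auto
    then have "\<bar>f1 t\<bar> \<le> (4 / t)\<^sup>2 / 2" using f1_abs_le[of t] \<open>1 \<le> t\<close> by simp
    also have "\<dots> = 8 * t powr - 2"
      using \<open>1 \<le> t\<close> by (simp add: powr_minus power_divide divide_simps)
    finally show "\<bar>f1 t\<bar> \<le> 8 * t powr - 2" .
  qed
qed

text \<open>With \<open>E = f - S\<close> one has \<open>E'' - 2 E' = G\<close> and hence \<open>E' = - G / 2\<close> up to the order of \<open>G'\<close>, where the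
  leading part of \<open>G\<close> is \<open>4 E / t\<close>. So \<open>(t\<^sup>2 E)'\<close> is of lower order than \<open>t E\<close>, and integrable.\<close>

lemma remainder_improve:
  assumes P: "hitting_recursion c P" and "1 \<le> N" and \<kappa>: "0 < \<kappa>" "\<kappa> \<le> 1 / 4"
    and E: "(\<lambda>t. f t - partial_expansion P N t) \<in> O(\<lambda>t. t powr - a)" and a: "a = real N - \<kappa>" "3 / 2 < a"
  obtains c' where "(\<lambda>t. t\<^sup>2 * (f t - partial_expansion P N t) - c') \<in> O(\<lambda>t. t powr (1 - a + \<kappa>))"
proof -
  define S S1 R R1 where "S = partial_expansion P N" and "S1 = partial_expansion1 P N"
    and "R = residual P N" and "R1 = residual1 P N"
  define E0 E1 where "E0 t = f t - S t" and "E1 t = f1 t - S1 t" for t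
  define G G1 where "G t = (f t + S t) * E0 t + R t"
    and "G1 t = (f1 t + S1 t) * E0 t + (f t + S t) * E1 t + R1 t" for t
  have E0d: "(E0 has_real_derivative E1 t) (at t)" if "1 \<le> t" for t
    unfolding E0_def E1_def S_def S1_def
    by (intro DERIV_diff f_deriv partial_expansion_derivatives) (use that in auto)
  have E1d: "(E1 has_real_derivative 2 * E1 t + G t) (at t)" if "1 \<le> t" for t
  proof -
    have "(E1 has_real_derivative (2 * f1 t + (f t)\<^sup>2) - partial_expansion2 P N t) (at t)"
      unfolding E1_def S1_def
      by (intro DERIV_diff f1_deriv partial_expansion_derivatives) (use that in auto)
    also have "(2 * f1 t + (f t)\<^sup>2) - partial_expansion2 P N t = 2 * E1 t + G t"
      using residual_eq[OF P \<open>1 \<le> N\<close>, of t] that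
      by (simp add: E1_def G_def E0_def S_def S1_def R_def power2_eq_square algebra_simps)
    finally show ?thesis .
  qed
  have Gd: "(G has_real_derivative G1 t) (at t)" if "1 \<le> t" for t
  proof -
    have Sd: "(S has_real_derivative S1 t) (at t)"
      and Rd: "(R has_real_derivative R1 t) (at t)"
      unfolding S_def S1_def R_def R1_def using that by (auto intro!: partial_expansion_derivatives)
    show ?thesis
      unfolding G_def G1_def using that
      by (auto intro!: derivative_eq_intros f_deriv Sd Rd E0d simp: algebra_simps)
  qed
  have bigo_rewrite: "F \<in> O(\<lambda>t. t powr b)" if "F \<in> O(\<lambda>t. t powr b')" "b' = b" for F :: "real \<Rightarrow> real" and b b'
    using that by simp
  have E0: "E0 \<in> O(\<lambda>t. t powr - a)" using E by (simp add: E0_def[abs_def] S_def)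
  have Rb: "R \<in> O(\<lambda>t. t powr (- a - 2))" "R1 \<in> O(\<lambda>t. t powr (- a - 3))"
    unfolding R_def R1_def using residual_bigo[OF \<kappa>(1), of P N]
    by (auto elim!: bigo_rewrite simp: a)
  have fS4: "(\<lambda>t. (f t + S t) - 4 / t) \<in> O(\<lambda>t. t powr (\<kappa> - 2))"
  proof -
    have "(\<lambda>t. (f t - 2 / t) + (S t - 2 / t)) \<in> O(\<lambda>t. t powr (\<kappa> - 2))"
      unfolding S_def using partial_expansion_bigo(1)[OF P \<kappa>(1), of N] \<kappa> \<open>1 \<le> N\<close>
      by (intro sum_in_bigo(1)[OF f_leading_bigo(1)[OF \<kappa>(1)]]) simp
    then show ?thesis by (simp add: algebra_simps)
  qed
  have "(\<lambda>t. ((f t + S t) - 4 / t) + 4 / t) \<in> O(\<lambda>t. t powr - 1)"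
  proof (rule sum_in_bigo)
    show "(\<lambda>t. (f t + S t) - 4 / t) \<in> O(\<lambda>t. t powr - 1)"
      by (rule bigo_powr_mono[OF fS4]) (use \<kappa> in auto)
    show "(\<lambda>t. 4 / t) \<in> O(\<lambda>t::real. t powr - 1)" by real_asymp
  qed
  then have fS: "(\<lambda>t. f t + S t) \<in> O(\<lambda>t. t powr - 1)" by simp
  have f1S1: "f1 \<in> O(\<lambda>t. t powr - 2)" "S1 \<in> O(\<lambda>t. t powr - 2)"
    unfolding S1_def using f_leading_bigo(2)[OF \<kappa>(1)] partial_expansion_bigo(2)[OF P \<kappa>(1)] \<kappa> by auto
  have Gb: "G \<in> O(\<lambda>t. t powr - (a + 1))"
    unfolding G_def
    by (intro sum_in_bigo bigo_powr_mult[OF fS E0] bigo_powr_mono[OF Rb(1)]) auto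
  have E1b: "E1 \<in> O(\<lambda>t. t powr - (a + 1))"
  proof (rule first_order_decay[OF E1d _ Gb])
    show "E1 \<in> O(\<lambda>t. t powr 0)"
      unfolding E1_def by (intro sum_in_bigo f1S1[THEN bigo_powr_mono]) auto
  qed (use a in auto)
  have G1b: "G1 \<in> O(\<lambda>t. t powr - (a + 2))"
    unfolding G1_def
    by (intro sum_in_bigo bigo_powr_mult[OF fS E1b] bigo_powr_mult[OF _ E0, where a = "- 2"]
        bigo_powr_mono[OF Rb(2)] f1S1) auto
  \<comment> \<open>\<open>E1 + G / 2\<close> solves the same type of equation with forcing
    \<open>G1 / 2\<close> in place of \<open>G\<close>, and so inherits the faster decay of the
    derivative of \<open>G\<close>.\<close>
  have E1G: "(\<lambda>t. E1 t + G t / 2) \<in> O(\<lambda>t. t powr - (a + 2))"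
  proof (rule first_order_decay[where ?T0.0 = 1 and G = "\<lambda>t. G1 t / 2"])
    show "((\<lambda>t. E1 t + G t / 2) has_real_derivative 2 * (E1 t + G t / 2) + G1 t / 2) (at t)" if "1 \<le> t" for t
      using that by (auto intro!: derivative_eq_intros E1d Gd)
    have "(\<lambda>t. G t / 2) \<in> O(\<lambda>t. t powr 0)"
      using bigo_powr_mono[OF Gb, of 0] a by simp
    then show "(\<lambda>t. E1 t + G t / 2) \<in> O(\<lambda>t. t powr 0)"
      by (intro sum_in_bigo(1) bigo_powr_mono[OF E1b, of 0]) (use a in auto)
    show "(\<lambda>t. G1 t / 2) \<in> O(\<lambda>t. t powr - (a + 2))" using G1b by simp
  qed (use a in auto)
  define D where "D t = E1 t + 2 / t * E0 t" for t
  have Db: "D \<in> O(\<lambda>t. t powr - (a + 2 - \<kappa>))"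
  proof -
    have 1: "(\<lambda>t. E1 t + G t / 2) \<in> O(\<lambda>t. t powr - (a + 2 - \<kappa>))"
      by (rule bigo_powr_mono[OF E1G]) (use \<kappa> in auto)
    have 2: "(\<lambda>t. ((f t + S t - 4 / t) * E0 t) / 2) \<in> O(\<lambda>t. t powr - (a + 2 - \<kappa>))"
      using bigo_powr_mult[OF fS4 E0, of "- (a + 2 - \<kappa>)"] by simp
    have 3: "(\<lambda>t. R t / 2) \<in> O(\<lambda>t. t powr - (a + 2 - \<kappa>))"
      using bigo_powr_mono[OF Rb(1), of "- (a + 2 - \<kappa>)"] \<kappa> by simp
    note sum_in_bigo(2)[OF sum_in_bigo(2)[OF 1 2] 3]
    also have "(\<lambda>t. (E1 t + G t / 2) - ((f t + S t - 4 / t) * E0 t) / 2 - R t / 2) = D"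
      by (simp add: fun_eq_iff D_def G_def field_simps)
    finally show ?thesis .
  qed
  have "(\<lambda>t::real. t\<^sup>2) \<in> O(\<lambda>t. t powr 2)" by real_asymp
  from bigo_powr_mult[OF this Db, of "- (a - \<kappa>)"]
  have Db2: "(\<lambda>t. t\<^sup>2 * D t) \<in> O(\<lambda>t. t powr - (a - \<kappa>))" by simp
  have "((\<lambda>t. t\<^sup>2 * E0 t) has_real_derivative t\<^sup>2 * D t) (at t)" if "1 \<le> t" for t
    using that by (auto intro!: derivative_eq_intros E0d simp: D_def field_simps power2_eq_square)
  moreover have "1 < a - \<kappa>" using a \<kappa> by simp
  ultimately obtain c' where c': "(\<lambda>t. t\<^sup>2 * E0 t - c') \<in> O(\<lambda>t. t powr (1 - (a - \<kappa>)))"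
    using antiderivative_converges[OF _ Db2] by metis
  have "1 - (a - \<kappa>) = 1 - a + \<kappa>" by simp
  with c' show thesis
    unfolding E0_def S_def by (intro that[of c']) (simp only:)
qed

text \<open>The expansion is first tried with parameter \<open>0\<close>. Then \<open>t^2 E\<close>
  converges, and its limit is the constant sought, because replacing the parameter \<open>0\<close>
  by \<open>c\<close> subtracts \<open>c / t^2\<close> from \<open>E\<close>.\<close>

lemma second_order_expansion:
  obtains c where "\<And>P \<kappa>. hitting_recursion c P \<Longrightarrow> 0 < \<kappa> \<Longrightarrow> \<kappa> \<le> 1 / 2 \<Longrightarrow>
    (\<lambda>t. f t - partial_expansion P 2 t) \<in> O(\<lambda>t. t powr - (3 - \<kappa>))"
proof -
  define P0 where "P0 = hitting_poly 0"
  have P0: "hitting_recursion 0 P0" unfolding P0_def by (rule hitting_recursion_hitting_poly)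
  define E where "E t = f t - partial_expansion P0 2 t" for t
  have E: "\<exists>c. (\<lambda>t. t\<^sup>2 * E t - c) \<in> O(\<lambda>t. t powr - (1 - \<kappa>))" if \<kappa>: "0 < \<kappa>" "\<kappa> \<le> 1 / 2" for \<kappa>
  proof -
    have "(\<lambda>t. (f t - 2 / t) - (partial_expansion P0 2 t - 2 / t)) \<in> O(\<lambda>t. t powr (\<kappa> / 2 - 2))"
      using partial_expansion_bigo(1)[OF P0, of "\<kappa> / 2" 2] \<kappa>
      by (intro sum_in_bigo(2)[OF f_leading_bigo(1)]) simp_all
    moreover have "(\<lambda>t. (f t - 2 / t) - (partial_expansion P0 2 t - 2 / t)) = E"
      by (simp add: E_def fun_eq_iff)
    moreover have exponent: "\<kappa> / 2 - 2 = - (real 2 - \<kappa> / 2)" by simp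
    ultimately have E: "(\<lambda>t. f t - partial_expansion P0 2 t) \<in> O(\<lambda>t. t powr - (real 2 - \<kappa> / 2))"
      unfolding E_def[abs_def] by (simp only:)
    have "0 < \<kappa> / 2" "\<kappa> / 2 \<le> 1 / 4" "3 / 2 < real 2 - \<kappa> / 2" "1 \<le> (2::nat)" using \<kappa> by auto
    then obtain c where c: "(\<lambda>t. t\<^sup>2 * (f t - partial_expansion P0 2 t) - c)
        \<in> O(\<lambda>t. t powr (1 - (real 2 - \<kappa> / 2) + \<kappa> / 2))"
      using remainder_improve[OF P0 _ _ _ E refl] by metis
    have "1 - (real 2 - \<kappa> / 2) + \<kappa> / 2 = - (1 - \<kappa>)" by simp
    with c show ?thesis unfolding E_def by (metis (no_types))
  qed
  obtain c where c: "(\<lambda>t. t\<^sup>2 * E t - c) \<in> O(\<lambda>t. t powr - (1 - 1 / 2))"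
    using E[of "1 / 2"] by auto
  have lim: "((\<lambda>t. t\<^sup>2 * E t) \<longlongrightarrow> c') at_top"
    if "(\<lambda>t. t\<^sup>2 * E t - c') \<in> O(\<lambda>t. t powr - b)" "0 < b" for c' b
    using tendsto_zero_of_bigo_powr[OF that(1)] that(2) by (auto intro: LIM_zero_cancel)
  \<comment> \<open>The constant obtained for each \<open>\<kappa>\<close> could a priori vary with
    \<open>\<kappa>\<close>; being the limit of \<open>t^2 E\<close>, it is always the same.\<close>
  have c_all: "(\<lambda>t. t\<^sup>2 * E t - c) \<in> O(\<lambda>t. t powr - (1 - \<kappa>))" if \<kappa>: "0 < \<kappa>" "\<kappa> \<le> 1 / 2" for \<kappa>
  proof -
    obtain c' where c': "(\<lambda>t. t\<^sup>2 * E t - c') \<in> O(\<lambda>t. t powr - (1 - \<kappa>))" using E[OF \<kappa>] by auto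
    have "c' = c"
      using tendsto_unique[OF _ lim[OF c'] lim[OF c]] \<kappa> by simp
    with c' show ?thesis by simp
  qed
  show thesis
  proof (rule that[of c])
    fix P and \<kappa> :: real
    assume P: "hitting_recursion c P" and \<kappa>: "0 < \<kappa>" "\<kappa> \<le> 1 / 2"
    have "f t - partial_expansion P 2 t = E t - c / t\<^sup>2" for t
      using hitting_recursion_init(2,3)[OF P] hitting_recursion_init(2,3)[OF P0]
      by (simp add: E_def partial_expansion_def numeral_2_eq_2 log_term_def add_divide_distrib)
    then have "(\<lambda>t. t\<^sup>2 * E t - c) \<in> O(\<lambda>t. t powr - (1 - \<kappa>)) \<longleftrightarrow>
        (\<lambda>t. t\<^sup>2 * (f t - partial_expansion P 2 t)) \<in> O(\<lambda>t. t powr - (1 - \<kappa>))"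
      by (intro landau_o.big.in_cong)
        (use eventually_gt_at_top[of "0::real"] in eventually_elim, simp add: right_diff_distrib)
    with c_all[OF \<kappa>] have "(\<lambda>t. f t - partial_expansion P 2 t) \<in> O(\<lambda>t. t powr (- (1 - \<kappa>) - 2))"
      by (intro bigo_of_square_mult) simp
    then show "(\<lambda>t. f t - partial_expansion P 2 t) \<in> O(\<lambda>t. t powr - (3 - \<kappa>))"
      by (simp add: algebra_simps)
  qed
qed

text \<open>Beyond the second order no further constant appears. Adding the next term leaves an
  error \<open>E\<close> of order \<open>t^(- (N + 1))\<close> up to logarithms. Then
  \<open>t^2 E\<close> tends to the constant of \<open>remainder_improve\<close>, but also to
  \<open>0\<close> since \<open>N + 1 \<ge> 3\<close>; the vanishing of that constant is the gain of
  one order.\<close>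

theorem f_expansion:
  obtains c where "\<And>P N. hitting_recursion c P \<Longrightarrow> 1 \<le> N \<Longrightarrow>
    (\<lambda>t. f t - (\<Sum>n=1..N. poly (P n) (ln t) / t ^ n)) \<in> o(\<lambda>t. 1 / t ^ N)"
proof -
  obtain c where c: "\<And>P \<kappa>. hitting_recursion c P \<Longrightarrow> 0 < \<kappa> \<Longrightarrow> \<kappa> \<le> 1 / 2 \<Longrightarrow>
    (\<lambda>t. f t - partial_expansion P 2 t) \<in> O(\<lambda>t. t powr - (3 - \<kappa>))"
    using second_order_expansion by blast
  show thesis
  proof (rule that[of c])
    fix P N
    assume P: "hitting_recursion c P" and N: "1 \<le> (N :: nat)"
    have all: "(\<lambda>t. f t - partial_expansion P N t) \<in> O(\<lambda>t. t powr - (real N + 1 - \<kappa>))"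
      if "2 \<le> N" "0 < \<kappa>" "\<kappa> \<le> 1 / 2" for N \<kappa>
      using that
    proof (induction N arbitrary: \<kappa> rule: dec_induct)
      case base
      then show ?case using c[OF P] by simp
    next
      case (step N)
      define F where "F t = f t - partial_expansion P (Suc N) t" for t
      have "(\<lambda>t. (f t - partial_expansion P N t) - log_term (P (Suc N)) (Suc N) t)
          \<in> O(\<lambda>t. t powr - (real N + 1 - \<kappa> / 2))"
        using step by (intro sum_in_bigo log_term_bigo step.IH) auto
      moreover have "(\<lambda>t. (f t - partial_expansion P N t) - log_term (P (Suc N)) (Suc N) t) = F"
        by (simp add: F_def partial_expansion_Suc fun_eq_iff)
      moreover have e: "real N + 1 - \<kappa> / 2 = real (Suc N) - \<kappa> / 2" by simp
      ultimately have F: "F \<in> O(\<lambda>t. t powr - (real (Suc N) - \<kappa> / 2))"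
        by (simp only:)
      have "0 < \<kappa> / 2" "\<kappa> / 2 \<le> 1 / 4" "3 / 2 < real (Suc N) - \<kappa> / 2" "1 \<le> Suc N"
        using step by auto
      then obtain c' where c': "(\<lambda>t. t\<^sup>2 * F t - c') \<in> O(\<lambda>t. t powr (1 - (real (Suc N) - \<kappa> / 2) + \<kappa> / 2))"
        using remainder_improve[OF P _ _ _ F[unfolded F_def] refl] unfolding F_def by metis
      have "(\<lambda>t::real. t\<^sup>2) \<in> O(\<lambda>t. t powr 2)" by real_asymp
      from bigo_powr_mult[OF this F, of "- 1 / 2"]
      have "(\<lambda>t. t\<^sup>2 * F t) \<in> O(\<lambda>t. t powr (- 1 / 2))" using step by simp
      then have "((\<lambda>t. t\<^sup>2 * F t) \<longlongrightarrow> 0) at_top"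
        by (rule tendsto_zero_of_bigo_powr) simp
      moreover have "((\<lambda>t. t\<^sup>2 * F t) \<longlongrightarrow> c') at_top"
        using tendsto_zero_of_bigo_powr[OF c'] step by (auto intro: LIM_zero_cancel)
      ultimately have "c' = 0"
        using tendsto_unique trivial_limit_at_top_linorder by blast
      with c' have "(\<lambda>t. t\<^sup>2 * F t) \<in> O(\<lambda>t. t powr (1 - (real (Suc N) - \<kappa> / 2) + \<kappa> / 2))"
        by (simp only: diff_zero)
      from bigo_of_square_mult[OF this]
      have "F \<in> O(\<lambda>t. t powr (1 - (real (Suc N) - \<kappa> / 2) + \<kappa> / 2 - 2))" .
      moreover have "1 - (real (Suc N) - \<kappa> / 2) + \<kappa> / 2 - 2 = - (real (Suc N) + 1 - \<kappa>)" by simp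
      ultimately show ?case unfolding F_def by (simp only:)
    qed
    have small: "(\<lambda>t. f t - partial_expansion P N t) \<in> o(\<lambda>t. 1 / t ^ N)"
    proof -
      have "(\<lambda>t. f t - partial_expansion P N t) \<in> O(\<lambda>t. t powr - (real N + 1 / 2))"
      proof (cases "2 \<le> N")
        case True
        moreover have "real N + 1 - 1 / 2 = real N + 1 / 2" by simp
        ultimately show ?thesis using all[OF True, of "1 / 2"] by (simp only:)
      next
        case False
        \<comment> \<open>The induction starts at \<open>N = 2\<close>; for \<open>N = 1\<close> the
          second term is put back into the error.\<close>
        then have N1: "N = 1" using N by simp
        have "(\<lambda>t. (f t - partial_expansion P 2 t) + log_term (P 2) 2 t) \<in> O(\<lambda>t. t powr - (3 / 2))"
          by (intro sum_in_bigo log_term_bigo bigo_powr_mono[OF c[OF P, of "1 / 2"]]) auto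
        then show ?thesis
          using partial_expansion_Suc[of P 1] by (simp add: N1 numeral_2_eq_2 algebra_simps)
      qed
      also have "(\<lambda>t. t powr - (real N + 1 / 2)) \<in> o(\<lambda>t::real. t powr - real N)"
        by real_asymp
      also have "(\<lambda>t::real. t powr - real N) \<in> \<Theta>(\<lambda>t. 1 / t ^ N)"
        by (rule bigthetaI_cong) (use eventually_gt_at_top[of "0::real"] in eventually_elim,
          simp add: powr_minus powr_realpow divide_simps)
      finally show ?thesis .
    qed
    then show "(\<lambda>t. f t - (\<Sum>n=1..N. poly (P n) (ln t) / t ^ n)) \<in> o(\<lambda>t. 1 / t ^ N)"
      by (simp add: partial_expansion_def log_term_def)
  qed
qed

end

subsection \<open>Integration against independent data\<close>

lemma (in prob_space) integral_indep_var:
  fixes Z :: "'b \<times> 'b \<Rightarrow> real"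
  assumes indep: "indep_var S X T Y" and Z: "Z \<in> borel_measurable (S \<Otimes>\<^sub>M T)"
    and bd: "\<And>p. p \<in> space (S \<Otimes>\<^sub>M T) \<Longrightarrow> \<bar>Z p\<bar> \<le> B"
  shows "(\<integral>\<omega>. Z (X \<omega>, Y \<omega>) \<partial>M) = (\<integral>\<omega>. (\<integral>\<omega>'. Z (X \<omega>, Y \<omega>') \<partial>M) \<partial>M)"
proof -
  have X: "X \<in> measurable M S" and Y: "Y \<in> measurable M T"
    and d: "distr M S X \<Otimes>\<^sub>M distr M T Y = distr M (S \<Otimes>\<^sub>M T) (\<lambda>x. (X x, Y x))"
    using indep by (auto simp: indep_var_distribution_eq)
  interpret X: prob_space "distr M S X" by (rule prob_space_distr[OF X])
  interpret Y: prob_space "distr M T Y" by (rule prob_space_distr[OF Y])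
  interpret XY: pair_prob_space "distr M S X" "distr M T Y" ..
  have "sets (distr M S X \<Otimes>\<^sub>M distr M T Y) = sets (S \<Otimes>\<^sub>M T)"
    by (intro sets_pair_measure_cong) auto
  then have Z': "Z \<in> borel_measurable (distr M S X \<Otimes>\<^sub>M distr M T Y)"
    using Z by (simp cong: measurable_cong_sets)
  have "integrable (distr M S X \<Otimes>\<^sub>M distr M T Y) Z"
    by (rule XY.integrable_const_bound[where B = B]) (use bd Z' in \<open>auto simp: space_pair_measure\<close>)
  then have int: "integrable (distr M S X \<Otimes>\<^sub>M distr M T Y) (case_prod (\<lambda>x y. Z (x, y)))"
    by simp
  have "(\<integral>\<omega>. Z (X \<omega>, Y \<omega>) \<partial>M) = integral\<^sup>L (distr M (S \<Otimes>\<^sub>M T) (\<lambda>x. (X x, Y x))) Z"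
    by (rule integral_distr[symmetric]) (use X Y Z in auto)
  also have "\<dots> = integral\<^sup>L (distr M S X \<Otimes>\<^sub>M distr M T Y) (case_prod (\<lambda>x y. Z (x, y)))"
    by (simp add: d)
  also have "\<dots> = (\<integral>x. (\<integral>y. Z (x, y) \<partial>distr M T Y) \<partial>distr M S X)"
    by (rule XY.integral_fst[OF int, symmetric])
  also have "\<dots> = (\<integral>\<omega>. (\<integral>y. Z (X \<omega>, y) \<partial>distr M T Y) \<partial>M)"
  proof (rule integral_distr[OF X])
    have "(\<lambda>x. \<integral>y. Z (x, y) \<partial>distr M T Y) \<in> borel_measurable (distr M S X)"
      using int by (intro Y.borel_measurable_lebesgue_integral) auto
    then show "(\<lambda>x. \<integral>y. Z (x, y) \<partial>distr M T Y) \<in> borel_measurable S" by simp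
  qed
  also have "\<dots> = (\<integral>\<omega>. (\<integral>\<omega>'. Z (X \<omega>, Y \<omega>') \<partial>M) \<partial>M)"
  proof (rule Bochner_Integration.integral_cong[OF refl])
    fix \<omega> assume "\<omega> \<in> space M"
    then have "X \<omega> \<in> space S" using measurable_space[OF X] by auto
    then have "(\<lambda>y. Z (X \<omega>, y)) \<in> borel_measurable T" using Z by measurable
    then show "(\<integral>y. Z (X \<omega>, y) \<partial>distr M T Y) = (\<integral>\<omega>'. Z (X \<omega>, Y \<omega>') \<partial>M)"
      by (rule integral_distr[OF Y])
  qed
  finally show ?thesis .
qed

text \<open>Conditioning by freezing: the identity map is regarded as two random variables, one with
  values in \<open>A\<close> and one in \<open>B\<close>. Independence decouples them, and
  \<open>Z\<close> only has to be jointly measurable in the pair.\<close>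

lemma (in prob_space) integral_indep_subalgebras:
  fixes Z :: "'a \<times> 'a \<Rightarrow> real"
  assumes A: "subalgebra M A" and B: "subalgebra M B" and indep: "indep_set (sets A) (sets B)"
    and Z: "Z \<in> borel_measurable (A \<Otimes>\<^sub>M B)"
    and bd: "\<And>\<omega> \<omega>'. \<omega> \<in> space M \<Longrightarrow> \<omega>' \<in> space M \<Longrightarrow> \<bar>Z (\<omega>, \<omega>')\<bar> \<le> K"
  shows "(\<integral>\<omega>. Z (\<omega>, \<omega>) \<partial>M) = (\<integral>\<omega>. (\<integral>\<omega>'. Z (\<omega>, \<omega>') \<partial>M) \<partial>M)"
proof (rule integral_indep_var)
  have id: "(\<lambda>\<omega>. \<omega>) \<in> measurable M S" if "subalgebra M S" for S
    using that by (auto simp: subalgebra_def measurable_def)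
  have gen: "sigma_sets (space M) {(\<lambda>\<omega>. \<omega>) -` C \<inter> space M | C. C \<in> sets S} = sets S"
    if S: "subalgebra M S" for S
  proof -
    have "{(\<lambda>\<omega>. \<omega>) -` C \<inter> space M | C. C \<in> sets S} = sets S"
      using S sets.sets_into_space[of _ S] by (auto simp: subalgebra_def)
    moreover have "sigma_sets (space M) (sets S) = sets S"
      using S by (metis sets.sigma_sets_eq subalgebra_def)
    ultimately show ?thesis by simp
  qed
  show "indep_var A (\<lambda>\<omega>. \<omega>) B (\<lambda>\<omega>. \<omega>)"
    unfolding indep_var_eq gen[OF A] gen[OF B] using id[OF A] id[OF B] indep by simp
  show "\<bar>Z p\<bar> \<le> K" if "p \<in> space (A \<Otimes>\<^sub>M B)" for p
    using that bd A B by (auto simp: space_pair_measure subalgebra_def)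
qed (rule Z)

lemma (in prob_space) subalgebra_of_indep:
  assumes "indep_set (sets A) (sets B)" "space A = space M"
  shows "subalgebra M A"
  using indep_setD_ev1[OF assms(1)] assms(2) by (simp add: subalgebra_def)

lemma (in prob_space) indep_set_sym: "indep_set A B \<Longrightarrow> indep_set B A"
  unfolding indep_sets2_eq by (metis Int_commute mult.commute)

lemma (in prob_space) expectation_of_bool: "expectation (\<lambda>\<omega>. of_bool (P \<omega>)) = prob {\<omega> \<in> space M. P \<omega>}"
proof -
  have "expectation (\<lambda>\<omega>. of_bool (P \<omega>)) = expectation (indicator {\<omega> \<in> space M. P \<omega>})"
    by (rule Bochner_Integration.integral_cong) auto
  also have "\<dots> = prob ({\<omega> \<in> space M. P \<omega>} \<inter> space M)" by simp
  also have "{\<omega> \<in> space M. P \<omega>} \<inter> space M = {\<omega> \<in> space M. P \<omega>}" by auto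
  finally show ?thesis .
qed

subsection \<open>Moments of Gaussian vectors\<close>

text \<open>Lebesgue measure on \<open>real ^ 'n\<close> is the image of a product measure indexed
  by \<open>Basis\<close>; the product formula holds there and is carried over to the index type
  \<open>'n\<close> by \<open>i \<mapsto> axis i 1\<close>.\<close>

lemma lborel_vec_prod:
  fixes h :: "'n::finite \<Rightarrow> real \<Rightarrow> real"
  assumes h: "\<And>i. integrable lborel (h i)"
  shows "integrable lborel (\<lambda>x::real ^ 'n. \<Prod>i\<in>UNIV. h i (x $ i))"
    and "(\<integral>x. (\<Prod>i\<in>UNIV. h i ((x :: real ^ 'n) $ i)) \<partial>lborel) = (\<Prod>i\<in>UNIV. integral\<^sup>L lborel (h i))"
proof -
  interpret product_sigma_finite "\<lambda>_ :: real ^ 'n. lborel :: real measure" ..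
  \<comment> \<open>\<open>H\<close> is the family \<open>h\<close> indexed by basis vectors; the
    choice is unambiguous since \<open>axis i 1\<close> determines \<open>i\<close>.\<close>
  define H where "H b = h (SOME i. b = axis i (1::real))" for b :: "real ^ 'n"
  have H: "H (axis i 1) = h i" for i
    by (simp add: H_def axis_eq_axis)
  have B: "(Basis :: (real ^ 'n) set) = (\<lambda>i. axis i 1) ` UNIV"
    by (auto simp: Basis_vec_def)
  have inj: "inj (\<lambda>i. axis i 1 :: real ^ 'n)"
    by (auto simp: inj_on_def axis_eq_axis)
  have hm[measurable]: "h i \<in> borel_measurable borel" for i
    using borel_measurable_integrable[OF h[of i]] by simp
  have Hi: "integrable lborel (H b)" for b using h by (simp add: H_def)
  have eq: "(\<Prod>i\<in>UNIV. h i ((\<Sum>b\<in>Basis. f b *\<^sub>R b) $ i)) = (\<Prod>b\<in>Basis. H b (f b))"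
    for f :: "real ^ 'n \<Rightarrow> real"
  proof -
    have "(\<Sum>b\<in>Basis. f b *\<^sub>R b) $ i = f (axis i 1)" for i
    proof -
      have "(\<Sum>b\<in>Basis. f b *\<^sub>R b) $ i = (\<Sum>b\<in>Basis. f b *\<^sub>R b) \<bullet> axis i 1"
        by (simp add: inner_axis)
      also have "\<dots> = f (axis i 1)"
        by (subst inner_sum_left_Basis) (auto simp: B)
      finally show ?thesis .
    qed
    then show ?thesis by (simp add: B prod.reindex[OF inj] H)
  qed
  have m: "(\<lambda>x::real ^ 'n. \<Prod>i\<in>UNIV. h i (x $ i)) \<in> borel_measurable borel"
    by measurable
  have T: "(\<lambda>f. \<Sum>b\<in>(Basis :: (real ^ 'n) set). f b *\<^sub>R b) \<in> borel_measurable (\<Pi>\<^sub>M b\<in>Basis. lborel)"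
    by measurable
  have "integrable (\<Pi>\<^sub>M b\<in>Basis. lborel) (\<lambda>f. \<Prod>b\<in>(Basis :: (real ^ 'n) set). H b (f b))"
    by (intro product_integrable_prod Hi) auto
  then show "integrable lborel (\<lambda>x::real ^ 'n. \<Prod>i\<in>UNIV. h i (x $ i))"
    unfolding lborel_eq[where 'a = "real ^ 'n"] integrable_distr_eq[OF T m] by (simp only: eq)
  have "(\<integral>x. (\<Prod>i\<in>UNIV. h i ((x :: real ^ 'n) $ i)) \<partial>lborel) =
      (\<integral>f. (\<Prod>b\<in>(Basis :: (real ^ 'n) set). H b (f b)) \<partial>(\<Pi>\<^sub>M b\<in>Basis. lborel))"
    unfolding lborel_eq[where 'a = "real ^ 'n"] integral_distr[OF T m] by (simp only: eq)
  also have "\<dots> = (\<Prod>b\<in>Basis. integral\<^sup>L lborel (H b))"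
    by (intro product_integral_prod Hi) auto
  also have "\<dots> = (\<Prod>i\<in>UNIV. integral\<^sup>L lborel (h i))"
    by (simp add: B prod.reindex[OF inj] H)
  finally show "(\<integral>x. (\<Prod>i\<in>UNIV. h i ((x :: real ^ 'n) $ i)) \<partial>lborel) = (\<Prod>i\<in>UNIV. integral\<^sup>L lborel (h i))" .
qed

lemma norm_power2_eq_sum: "(norm (x :: real ^ 'n::finite))\<^sup>2 = (\<Sum>i\<in>UNIV. (x $ i)\<^sup>2)"
  unfolding power2_norm_eq_inner inner_vec_def by (simp add: power2_eq_square)

locale gaussian_vector = prob_space M for M :: "'a measure" +
  fixes X :: "'a \<Rightarrow> real ^ 'n::finite" and \<sigma> :: real
  assumes \<sigma>_pos: "0 < \<sigma>"
    and density: "distributed M lborel X (\<lambda>x. ennreal (\<Prod>i\<in>UNIV. normal_density 0 \<sigma> (x $ i)))"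
begin

lemma monomial:
  shows "integrable M (\<lambda>\<omega>. \<Prod>i\<in>UNIV. (X \<omega> $ i) ^ m i)"
    and "expectation (\<lambda>\<omega>. \<Prod>i\<in>UNIV. (X \<omega> $ i) ^ m i) =
      (\<Prod>i\<in>UNIV. \<integral>x. normal_density 0 \<sigma> x * x ^ m i \<partial>lborel)"
proof -
  have "integrable lborel (\<lambda>x. normal_density 0 \<sigma> x * x ^ k)" for k
    using integrable_normal_moment[OF \<sigma>_pos, of 0 k] by simp
  note p = lborel_vec_prod[where 'n = 'n and h = "\<lambda>i x. normal_density 0 \<sigma> x * x ^ m i", OF this]
  have nn: "0 \<le> (\<Prod>i\<in>UNIV. normal_density 0 \<sigma> (x $ i))" for x :: "real ^ 'n"
    by (intro prod_nonneg) simp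
  have meas: "(\<lambda>x::real ^ 'n. \<Prod>i\<in>UNIV. (x $ i) ^ m i) \<in> borel_measurable lborel" by measurable
  show "integrable M (\<lambda>\<omega>. \<Prod>i\<in>UNIV. (X \<omega> $ i) ^ m i)"
    using p(1) by (subst distributed_integrable[OF density meas nn, symmetric]) (simp add: prod.distrib)
  show "expectation (\<lambda>\<omega>. \<Prod>i\<in>UNIV. (X \<omega> $ i) ^ m i) =
      (\<Prod>i\<in>UNIV. \<integral>x. normal_density 0 \<sigma> x * x ^ m i \<partial>lborel)"
    using p(2) by (subst distributed_integral[OF density meas nn, symmetric]) (simp add: prod.distrib)
qed

lemma normal_moments:
  "(\<integral>x. normal_density 0 \<sigma> x * x ^ 0 \<partial>lborel) = 1"
  "(\<integral>x. normal_density 0 \<sigma> x * x ^ 1 \<partial>lborel) = 0"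
  "(\<integral>x. normal_density 0 \<sigma> x * x ^ 2 \<partial>lborel) = \<sigma>\<^sup>2"
  "(\<integral>x. normal_density 0 \<sigma> x * x ^ 4 \<partial>lborel) = 3 * \<sigma> ^ 4"
proof -
  show "(\<integral>x. normal_density 0 \<sigma> x * x ^ 0 \<partial>lborel) = 1"
    using \<sigma>_pos by simp
  show "(\<integral>x. normal_density 0 \<sigma> x * x ^ 1 \<partial>lborel) = 0"
    using integral_normal_moment_odd[OF \<sigma>_pos, of 0 0] by simp
  show "(\<integral>x. normal_density 0 \<sigma> x * x ^ 2 \<partial>lborel) = \<sigma>\<^sup>2"
    using integral_normal_moment_even[OF \<sigma>_pos, of 0 1] by (simp add: power2_eq_square field_simps)
  show "(\<integral>x. normal_density 0 \<sigma> x * x ^ 4 \<partial>lborel) = 3 * \<sigma> ^ 4"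
    using integral_normal_moment_even[OF \<sigma>_pos, of 0 2]
    by (simp add: fact_numeral power2_eq_square power4_eq_xxxx)
qed

lemma single_moment:
  shows "integrable M (\<lambda>\<omega>. (X \<omega> $ i) ^ k)"
    and "expectation (\<lambda>\<omega>. (X \<omega> $ i) ^ k) = (\<integral>x. normal_density 0 \<sigma> x * x ^ k \<partial>lborel)"
proof -
  have e: "(\<Prod>l\<in>UNIV. a l ^ (if l = i then k else 0)) = a i ^ k" for a :: "'n \<Rightarrow> real"
    by (simp add: prod.remove[of UNIV i])
  show "integrable M (\<lambda>\<omega>. (X \<omega> $ i) ^ k)"
    using monomial(1)[of "\<lambda>l. if l = i then k else 0"] by (simp add: e)
  have "(\<Prod>l\<in>UNIV. \<integral>x. normal_density 0 \<sigma> x * x ^ (if l = i then k else 0) \<partial>lborel) =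
      (\<Prod>l\<in>UNIV. if l = i then \<integral>x. normal_density 0 \<sigma> x * x ^ k \<partial>lborel else 1)"
    by (intro prod.cong refl) (use normal_moments(1) in auto)
  then show "expectation (\<lambda>\<omega>. (X \<omega> $ i) ^ k) = (\<integral>x. normal_density 0 \<sigma> x * x ^ k \<partial>lborel)"
    using monomial(2)[of "\<lambda>l. if l = i then k else 0"] by (simp add: e)
qed

lemma mixed_moment:
  assumes "i \<noteq> j"
  shows "integrable M (\<lambda>\<omega>. X \<omega> $ i * X \<omega> $ j)" and "expectation (\<lambda>\<omega>. X \<omega> $ i * X \<omega> $ j) = 0"
proof -
  let ?m = "\<lambda>l. if l = i \<or> l = j then 1 else 0 :: nat"
  have e: "(\<Prod>l\<in>UNIV. a l ^ ?m l) = a i * a j" for a :: "'n \<Rightarrow> real"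
    using assms by (simp add: prod.remove[of UNIV i] prod.remove[of "UNIV - {i}" j])
  show "integrable M (\<lambda>\<omega>. X \<omega> $ i * X \<omega> $ j)"
    using monomial(1)[of ?m] by (simp only: e)
  have "(\<integral>x. normal_density 0 \<sigma> x * x ^ ?m i \<partial>lborel) = 0"
    using normal_moments(2) by simp
  then have "(\<Prod>l\<in>UNIV. \<integral>x. normal_density 0 \<sigma> x * x ^ ?m l \<partial>lborel) = 0"
    by (intro prod_zero) auto
  then show "expectation (\<lambda>\<omega>. X \<omega> $ i * X \<omega> $ j) = 0"
    using monomial(2)[of ?m] by (simp only: e)
qed

lemma linear_moment:
  "integrable M (\<lambda>\<omega>. y \<bullet> X \<omega>)" "expectation (\<lambda>\<omega>. y \<bullet> X \<omega>) = 0"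
proof -
  have i: "integrable M (\<lambda>\<omega>. X \<omega> $ i)" and e: "expectation (\<lambda>\<omega>. X \<omega> $ i) = 0" for i
    using single_moment[of i 1] normal_moments(2) by simp_all
  show "integrable M (\<lambda>\<omega>. y \<bullet> X \<omega>)" "expectation (\<lambda>\<omega>. y \<bullet> X \<omega>) = 0"
    using i by (simp_all add: inner_vec_def e)
qed

lemma quadratic_moment:
  "integrable M (\<lambda>\<omega>. (y \<bullet> X \<omega>)\<^sup>2)" "expectation (\<lambda>\<omega>. (y \<bullet> X \<omega>)\<^sup>2) = \<sigma>\<^sup>2 * (norm y)\<^sup>2"
proof -
  have i: "integrable M (\<lambda>\<omega>. X \<omega> $ i * X \<omega> $ j)"
    and e: "expectation (\<lambda>\<omega>. X \<omega> $ i * X \<omega> $ j) = (if i = j then \<sigma>\<^sup>2 else 0)" for i j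
    using mixed_moment[of i j] single_moment[of i 2] normal_moments(3)
    by (cases "i = j"; simp add: power2_eq_square)+
  have sq: "(y \<bullet> X \<omega>)\<^sup>2 = (\<Sum>i\<in>UNIV. \<Sum>j\<in>UNIV. (y $ i * y $ j) * (X \<omega> $ i * X \<omega> $ j))" for \<omega>
    by (simp add: inner_vec_def power2_eq_square sum_product mult.assoc mult.left_commute)
  show "integrable M (\<lambda>\<omega>. (y \<bullet> X \<omega>)\<^sup>2)"
    unfolding sq by (intro Bochner_Integration.integrable_sum integrable_mult_right i)
  have "expectation (\<lambda>\<omega>. (y \<bullet> X \<omega>)\<^sup>2) = (\<Sum>i\<in>UNIV. \<Sum>j\<in>UNIV. (y $ i * y $ j) * (if i = j then \<sigma>\<^sup>2 else 0))"
    unfolding sq by (simp add: Bochner_Integration.integral_sum i e)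
  also have "\<dots> = (\<Sum>i\<in>UNIV. \<Sum>j\<in>UNIV. if i = j then y $ i * y $ j * \<sigma>\<^sup>2 else 0)"
    by (intro sum.cong refl) auto
  also have "\<dots> = \<sigma>\<^sup>2 * (norm y)\<^sup>2"
    unfolding power2_norm_eq_inner inner_vec_def by (simp add: sum_distrib_left mult_ac)
  finally show "expectation (\<lambda>\<omega>. (y \<bullet> X \<omega>)\<^sup>2) = \<sigma>\<^sup>2 * (norm y)\<^sup>2" .
qed

lemma norm_moment_2:
  "integrable M (\<lambda>\<omega>. (norm (X \<omega>))\<^sup>2)" "expectation (\<lambda>\<omega>. (norm (X \<omega>))\<^sup>2) = real CARD('n) * \<sigma>\<^sup>2"
  using single_moment[of _ 2] normal_moments(3) by (simp_all add: norm_power2_eq_sum)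

lemma measurable_X [measurable]: "X \<in> borel_measurable M"
  using distributed_measurable[OF density] by simp

lemma norm_moment_4:
  "integrable M (\<lambda>\<omega>. norm (X \<omega>) ^ 4)"
  "expectation (\<lambda>\<omega>. norm (X \<omega>) ^ 4) \<le> 3 * (real CARD('n))\<^sup>2 * \<sigma> ^ 4"
proof -
  let ?S = "\<lambda>\<omega>. real CARD('n) * (\<Sum>i\<in>UNIV. (X \<omega> $ i) ^ 4)"
  have le: "norm (X \<omega>) ^ 4 \<le> ?S \<omega>" for \<omega>
  proof -
    have "norm (X \<omega>) ^ 4 = (\<Sum>i\<in>UNIV. (X \<omega> $ i)\<^sup>2)\<^sup>2"
      by (simp add: norm_power2_eq_sum[symmetric] flip: power_mult)
    also have "\<dots> \<le> (\<Sum>i\<in>UNIV. ((X \<omega> $ i)\<^sup>2)\<^sup>2) * real CARD('n)"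
      by (rule sum_squared_le_sum_of_squares)
    finally show ?thesis by (simp add: mult.commute flip: power_mult)
  qed
  have S: "integrable M ?S"
    using single_moment(1)[of _ 4] by simp
  show int: "integrable M (\<lambda>\<omega>. norm (X \<omega>) ^ 4)"
    by (rule Bochner_Integration.integrable_bound[OF S]) (auto intro!: AE_I2 order_trans[OF le abs_ge_self])
  have "expectation (\<lambda>\<omega>. norm (X \<omega>) ^ 4) \<le> expectation ?S"
    by (intro integral_mono int S le)
  also have "\<dots> = 3 * (real CARD('n))\<^sup>2 * \<sigma> ^ 4"
    using single_moment[of _ 4] normal_moments(4) by (simp add: power2_eq_square)
  finally show "expectation (\<lambda>\<omega>. norm (X \<omega>) ^ 4) \<le> 3 * (real CARD('n))\<^sup>2 * \<sigma> ^ 4" .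
qed

text \<open>The third moment is interpolated between the second and the fourth.\<close>

lemma norm_moment_3:
  "integrable M (\<lambda>\<omega>. norm (X \<omega>) ^ 3)"
  "expectation (\<lambda>\<omega>. norm (X \<omega>) ^ 3) \<le> (real CARD('n) + 3 * (real CARD('n))\<^sup>2) / 2 * \<sigma> ^ 3"
proof -
  let ?S = "\<lambda>\<omega>. \<sigma> / 2 * (norm (X \<omega>))\<^sup>2 + 1 / (2 * \<sigma>) * norm (X \<omega>) ^ 4"
  have le: "norm (X \<omega>) ^ 3 \<le> ?S \<omega>" for \<omega>
  proof -
    define a where "a = norm (X \<omega>)"
    have "0 \<le> a\<^sup>2 * (\<sigma> - a)\<^sup>2" by simp
    then have "2 * \<sigma> * a ^ 3 \<le> \<sigma>\<^sup>2 * a\<^sup>2 + a ^ 4"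
      by (simp add: power2_eq_square power3_eq_cube power4_eq_xxxx algebra_simps)
    then show ?thesis using \<sigma>_pos unfolding a_def[symmetric]
      by (simp add: field_simps power2_eq_square)
  qed
  have S: "integrable M ?S"
    using norm_moment_2(1) norm_moment_4(1) by simp
  show int: "integrable M (\<lambda>\<omega>. norm (X \<omega>) ^ 3)"
  proof (rule Bochner_Integration.integrable_bound[OF S])
    show "AE \<omega> in M. norm (norm (X \<omega>) ^ 3) \<le> norm (?S \<omega>)"
      using order_trans[OF le abs_ge_self] by (simp only: real_norm_def power_abs abs_norm_cancel AE_I2)
  qed measurable
  have "expectation (\<lambda>\<omega>. norm (X \<omega>) ^ 3) \<le> expectation ?S"
    by (intro integral_mono int S le)
  also have "\<dots> = \<sigma> / 2 * (real CARD('n) * \<sigma>\<^sup>2) + 1 / (2 * \<sigma>) * expectation (\<lambda>\<omega>. norm (X \<omega>) ^ 4)"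
    using norm_moment_2 norm_moment_4(1) by simp
  also have "\<dots> \<le> \<sigma> / 2 * (real CARD('n) * \<sigma>\<^sup>2) + 1 / (2 * \<sigma>) * (3 * (real CARD('n))\<^sup>2 * \<sigma> ^ 4)"
    using norm_moment_4(2) \<sigma>_pos by (intro add_left_mono mult_left_mono) auto
  also have "\<dots> = (real CARD('n) + 3 * (real CARD('n))\<^sup>2) / 2 * \<sigma> ^ 3"
    using \<sigma>_pos by (simp add: field_simps power2_eq_square power3_eq_cube power4_eq_xxxx)
  finally show "expectation (\<lambda>\<omega>. norm (X \<omega>) ^ 3) \<le> (real CARD('n) + 3 * (real CARD('n))\<^sup>2) / 2 * \<sigma> ^ 3" .
qed

end

subsection \<open>Continuous processes\<close>

lemma tendsto_dyadic_floor: "(\<lambda>m. real_of_int \<lfloor>s * 2 ^ m\<rfloor> / 2 ^ m) \<longlonglongrightarrow> s"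
proof (rule tendsto_sandwich)
  show "\<forall>\<^sub>F m in sequentially. s - 1 / 2 ^ m \<le> real_of_int \<lfloor>s * 2 ^ m\<rfloor> / 2 ^ m"
  proof (intro always_eventually allI)
    fix m :: nat
    have "s * 2 ^ m - 1 \<le> real_of_int \<lfloor>s * 2 ^ m\<rfloor>" by linarith
    then have "(s * 2 ^ m - 1) / 2 ^ m \<le> real_of_int \<lfloor>s * 2 ^ m\<rfloor> / 2 ^ m"
      by (intro divide_right_mono) auto
    then show "s - 1 / 2 ^ m \<le> real_of_int \<lfloor>s * 2 ^ m\<rfloor> / 2 ^ m" by (simp add: diff_divide_distrib)
  qed
  show "\<forall>\<^sub>F m in sequentially. real_of_int \<lfloor>s * 2 ^ m\<rfloor> / 2 ^ m \<le> s"
    by (intro always_eventually allI) (simp add: pos_divide_le_eq)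
  have "(\<lambda>m. s - (1 / 2) ^ m) \<longlonglongrightarrow> s - 0"
    by (intro tendsto_intros LIMSEQ_power_zero) simp
  then show "(\<lambda>m. s - 1 / 2 ^ m) \<longlonglongrightarrow> s" by (simp add: power_divide)
qed auto

lemma dyadic_floor_le: "real_of_int \<lfloor>s * 2 ^ m\<rfloor> / 2 ^ m \<le> s"
  by (simp add: pos_divide_le_eq)

lemma dyadic_floor_nonneg: "0 \<le> s \<Longrightarrow> 0 \<le> real_of_int \<lfloor>s * 2 ^ m\<rfloor> / 2 ^ m"
  by simp

locale continuous_process =
  fixes N :: "'a measure" and X :: "real \<Rightarrow> 'a \<Rightarrow> 'b::euclidean_space"
  assumes measurable_at: "0 \<le> t \<Longrightarrow> X t \<in> borel_measurable N"
    and continuous: "\<omega> \<in> space N \<Longrightarrow> continuous_on {0..} (\<lambda>t. X t \<omega>)"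
begin

lemma tendsto_dyadic:
  assumes "\<omega> \<in> space N" "0 \<le> s"
  shows "(\<lambda>m. X (real_of_int \<lfloor>s * 2 ^ m\<rfloor> / 2 ^ m) \<omega>) \<longlonglongrightarrow> X s \<omega>"
  by (rule continuous_on_tendsto_compose[OF continuous[OF assms(1)] tendsto_dyadic_floor])
    (use assms(2) in auto)

text \<open>The process is the limit of its values at times rounded down to dyadics, and each
  approximation involves countably many times. \<open>max 0 t\<close> makes the map total, since
  nothing is assumed at negative times.\<close>

lemma measurable_joint:
  "(\<lambda>(t, \<omega>). X (max 0 t) \<omega>) \<in> borel_measurable (borel \<Otimes>\<^sub>M N)"
proof (rule borel_measurable_LIMSEQ_metric)
  fix m :: nat
  have [measurable]: "X (real_of_int (max 0 k) / 2 ^ m) \<in> borel_measurable N" for k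
    by (rule measurable_at) simp
  have "(\<lambda>p :: real \<times> 'a. X (real_of_int (max 0 (\<lfloor>fst p * 2 ^ m\<rfloor>)) / 2 ^ m) (snd p)) \<in> borel_measurable (borel \<Otimes>\<^sub>M N)"
  proof (rule measurable_compose_countable[where f = "\<lambda>k p. X (real_of_int (max 0 k) / 2 ^ m) (snd p)"
        and g = "\<lambda>p :: real \<times> 'a. \<lfloor>fst p * 2 ^ m\<rfloor>"])
    show "(\<lambda>p :: real \<times> 'a. \<lfloor>fst p * 2 ^ m\<rfloor>) \<in> measurable (borel \<Otimes>\<^sub>M N) (count_space UNIV)"
    proof -
      have "(\<lambda>p :: real \<times> 'a. fst p * 2 ^ m) \<in> borel_measurable (borel \<Otimes>\<^sub>M N)" by measurable
      from measurable_compose[OF this measurable_real_floor] show ?thesis .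
    qed
  qed measurable
  then show "(\<lambda>p :: real \<times> 'a. X (real_of_int (max 0 (\<lfloor>fst p * 2 ^ m\<rfloor>)) / 2 ^ m) (snd p)) \<in> borel_measurable (borel \<Otimes>\<^sub>M N)" .
next
  fix p :: "real \<times> 'a" assume "p \<in> space (borel \<Otimes>\<^sub>M N)"
  then have w: "snd p \<in> space N" by (auto simp: space_pair_measure)
  have "max 0 \<lfloor>fst p * 2 ^ m\<rfloor> = \<lfloor>max 0 (fst p) * 2 ^ m\<rfloor>" for m :: nat
  proof (cases "0 \<le> fst p")
    case False
    then have "fst p * 2 ^ m \<le> 0" by (simp add: mult_nonpos_nonneg)
    then have "\<lfloor>fst p * 2 ^ m\<rfloor> \<le> 0" by linarith
    moreover have "\<lfloor>max 0 (fst p) * 2 ^ m\<rfloor> = 0" using False by (simp add: max_def)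
    ultimately show ?thesis by (simp only: max.absorb1)
  qed (simp add: max_def)
  then show "(\<lambda>m. X (real_of_int (max 0 \<lfloor>fst p * 2 ^ m\<rfloor>) / 2 ^ m) (snd p))
      \<longlonglongrightarrow> (case p of (t, \<omega>) \<Rightarrow> X (max 0 t) \<omega>)"
    using tendsto_dyadic[OF w, of "max 0 (fst p)"] by (simp add: case_prod_beta)
qed

end

text \<open>The radius is a parameter because the unit ball is compared with slightly larger ones.
  For negative \<open>t\<close> only time \<open>0\<close> is tested, which keeps the notion total
  under integrals over the whole line.\<close>

definition avoids :: "real \<Rightarrow> real \<Rightarrow> 'b::euclidean_space \<Rightarrow> (real \<Rightarrow> 'b) \<Rightarrow> bool" where
  "avoids \<rho> t x w \<longleftrightarrow> (\<forall>s\<in>{0..max 0 t}. \<rho> < norm (x + w s))"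

lemma avoids_end: "avoids \<rho> t x w \<Longrightarrow> \<rho> < norm (x + w (max 0 t))"
  by (auto simp: avoids_def)

text \<open>A continuous path attains its least distance on a compact interval, so strict avoidance
  leaves room for a larger radius.\<close>

lemma avoids_margin:
  assumes "continuous_on {0..} w" "avoids \<rho> t x w"
  shows "\<exists>\<eta>>0. avoids (\<rho> + \<eta>) t x w"
proof -
  have "continuous_on {0..max 0 t} (\<lambda>s. norm (x + w s))"
    by (intro continuous_intros continuous_on_subset[OF assms(1)]) auto
  then obtain s where s: "s \<in> {0..max 0 t}" "\<forall>r\<in>{0..max 0 t}. norm (x + w s) \<le> norm (x + w r)"
    using continuous_attains_inf[of "{0..max 0 t}" "\<lambda>s. norm (x + w s)"] by auto
  have "\<rho> < norm (x + w s)" using assms(2) s(1) by (auto simp: avoids_def)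
  with s(2) show ?thesis
    by (intro exI[of _ "(norm (x + w s) - \<rho>) / 2"]) (force simp: avoids_def field_simps)
qed

text \<open>The margin \<open>1 / (k + 1)\<close> makes the condition closed, so that it passes from
  rational to all times and still implies the strict inequality. Times are fractions
  \<open>q * t\<close>, so the countable index set does not depend on \<open>t\<close>, which may
  then be random.\<close>

lemma avoids_iff_countable:
  assumes "continuous_on {0..} w"
  shows "avoids \<rho> t x w \<longleftrightarrow>
    (\<exists>k::nat. \<forall>q\<in>{0..1::rat}. \<rho> + 1 / real (Suc k) \<le> norm (x + w (max 0 (of_rat q * t))))"
    (is "_ \<longleftrightarrow> ?R")
proof
  assume "avoids \<rho> t x w"
  then obtain \<eta> where \<eta>: "0 < \<eta>" "avoids (\<rho> + \<eta>) t x w" using avoids_margin[OF assms] by blast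
  then obtain k where k: "1 / real (Suc k) < \<eta>" using nat_approx_posE by blast
  have "\<rho> + 1 / real (Suc k) \<le> norm (x + w (max 0 (of_rat q * t)))" if "q \<in> {0..1}" for q
  proof -
    have q: "0 \<le> (of_rat q :: real)" "(of_rat q :: real) \<le> 1" using that by auto
    have "of_rat q * t \<le> max 0 t"
    proof (cases "0 \<le> t")
      case True
      then show ?thesis using q mult_right_mono[of "of_rat q" 1 t] by auto
    next
      case False
      then have "of_rat q * t \<le> 0" using q by (auto intro: mult_nonneg_nonpos)
      then show ?thesis by simp
    qed
    then have "max 0 (of_rat q * t) \<in> {0..max 0 t}" by simp
    then have "\<rho> + \<eta> < norm (x + w (max 0 (of_rat q * t)))"
      using \<eta>(2) unfolding avoids_def by blast
    with k show ?thesis by linarith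
  qed
  then show ?R by blast
next
  assume ?R
  then obtain k where k: "\<And>q. q \<in> {0..1} \<Longrightarrow> \<rho> + 1 / real (Suc k) \<le> norm (x + w (max 0 (of_rat q * t)))"
    by blast
  define F where "F \<theta> = norm (x + w (max 0 (\<theta> * t)))" for \<theta>
  have cF: "continuous_on UNIV F"
    unfolding F_def by (intro continuous_intros continuous_on_compose2[OF assms]) auto
  have dense: "\<rho> < F \<theta>" if "\<theta> \<in> {0..1}" for \<theta>
  proof -
    have cl: "closed {\<theta>. \<rho> + 1 / real (Suc k) \<le> F \<theta>}"
      by (intro closed_Collect_le continuous_intros cF)
    have "{0..1::real} \<subseteq> closure (of_rat ` {0..1})"
    proof
      fix z :: real assume z: "z \<in> {0..1}"
      define d :: "nat \<Rightarrow> rat" where "d m = of_int \<lfloor>z * 2 ^ m\<rfloor> / 2 ^ m" for m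
      have d: "of_rat (d m) = real_of_int \<lfloor>z * 2 ^ m\<rfloor> / 2 ^ m" for m
        by (simp add: d_def of_rat_divide of_rat_power)
      have "0 \<le> (of_rat (d m) :: real)" for m
        unfolding d using z by (intro dyadic_floor_nonneg) simp
      moreover have "(of_rat (d m) :: real) \<le> 1" for m
        unfolding d by (rule order_trans[OF dyadic_floor_le]) (use z in simp)
      ultimately have "of_rat (d m) \<in> (of_rat ` {0..1} :: real set)" for m
        by auto
      moreover have "(\<lambda>m. of_rat (d m)) \<longlonglongrightarrow> z"
        unfolding d by (rule tendsto_dyadic_floor)
      ultimately show "z \<in> closure (of_rat ` {0..1})"
        unfolding closure_sequential by (intro exI[of _ "\<lambda>m. of_rat (d m)"]) simp
    qed
    also have "\<dots> \<subseteq> {\<theta>. \<rho> + 1 / real (Suc k) \<le> F \<theta>}"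
      by (rule closure_minimal[OF _ cl]) (use k in \<open>auto simp: F_def\<close>)
    finally have "\<rho> + 1 / real (Suc k) \<le> F \<theta>" using that by auto
    moreover have "0 < 1 / real (Suc k)" by simp
    ultimately show ?thesis by linarith
  qed
  show "avoids \<rho> t x w"
    unfolding avoids_def
  proof
    fix s assume s: "s \<in> {0..max 0 t}"
    show "\<rho> < norm (x + w s)"
    proof (cases "0 < t")
      case True
      then have "s / t \<in> {0..1}" "max 0 (s / t * t) = s" using s by auto
      then show ?thesis using dense[of "s / t"] by (simp only: F_def)
    next
      case False
      then have "s = max 0 (0 * t)" using s by auto
      then have "norm (x + w s) = F 0" by (simp add: F_def)
      then show ?thesis using dense[of 0] by simp
    qed
  qed
qed

lemma (in continuous_process) pred_avoids:
  assumes [measurable]: "S \<in> borel_measurable K" "Y \<in> borel_measurable K" "\<pi> \<in> measurable K N"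
  shows "Measurable.pred K (\<lambda>p. avoids \<rho> (S p) (Y p) (\<lambda>t. X t (\<pi> p)))"
proof -
  have j[measurable]: "(\<lambda>p. X (max 0 (r p)) (\<pi> p)) \<in> borel_measurable K"
    if [measurable]: "r \<in> borel_measurable K" for r
    using measurable_compose[OF _ measurable_joint, of "\<lambda>p. (r p, \<pi> p)" K] by simp
  have "Measurable.pred K (\<lambda>p. \<exists>k::nat. \<forall>q\<in>{0..1::rat}.
      \<rho> + 1 / real (Suc k) \<le> norm (Y p + X (max 0 (of_rat q * S p)) (\<pi> p)))"
    by measurable
  moreover have "(\<exists>k::nat. \<forall>q\<in>{0..1::rat}.
      \<rho> + 1 / real (Suc k) \<le> norm (Y p + X (max 0 (of_rat q * S p)) (\<pi> p))) \<longleftrightarrow>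
      avoids \<rho> (S p) (Y p) (\<lambda>t. X t (\<pi> p))" if "p \<in> space K" for p
    using avoids_iff_countable[OF continuous[OF measurable_space[OF assms(3) that]]] by auto
  ultimately show ?thesis by (rule measurable_cong[THEN iffD1, rotated])
qed

subsection \<open>The radial solution of \<open>\<Delta>v = v\<^sup>2\<close>\<close>

context hitting_profile
begin

text \<open>\<open>radial (r\<^sup>2) = f (ln r) / r\<^sup>2\<close> is the candidate for the hitting probability from distance \<open>r\<close>.\<close>

definition radial :: "real \<Rightarrow> real" where
  "radial s = f (ln s / 2) / s"

text \<open>The first three derivatives of \<open>radial\<close> in the variable
  \<open>s = r^2\<close>. Second derivatives of \<open>f\<close> are eliminated through the profile
  equation, so only \<open>f\<close> and \<open>f1\<close> occur.\<close>

definition radial1 :: "real \<Rightarrow> real" where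
  "radial1 s = (f1 (ln s / 2) / 2 - f (ln s / 2)) / s\<^sup>2"

definition radial2 :: "real \<Rightarrow> real" where
  "radial2 s = ((f (ln s / 2))\<^sup>2 / 4 - f1 (ln s / 2) + 2 * f (ln s / 2)) / s ^ 3"

definition radial3 :: "real \<Rightarrow> real" where
  "radial3 s = (f (ln s / 2) * f1 (ln s / 2) / 4 - 5 / 4 * (f (ln s / 2))\<^sup>2 + 3 * f1 (ln s / 2)
     - 6 * f (ln s / 2)) / s ^ 4"

text \<open>A common bound for the numerators of the three derivatives, from
  \<open>0 \<le> f \<le> 1\<close> and the bound \<open>C\<close> for \<open>f1\<close>.\<close>

definition bound :: real where
  "bound = 10 + 4 * C"

lemma bound_ge: "10 \<le> bound"
  using C_nonneg by (simp add: bound_def)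

lemma radial_derivs:
  assumes "1 \<le> s"
  shows "(radial has_real_derivative radial1 s) (at s)"
    "(radial1 has_real_derivative radial2 s) (at s)"
    "(radial2 has_real_derivative radial3 s) (at s)"
proof -
  have s: "0 < s" "0 \<le> ln s / 2" using assms by auto
  have l: "((\<lambda>s. ln s / 2) has_real_derivative 1 / (2 * s)) (at s)"
    using s by (auto intro!: derivative_eq_intros)
  have F: "((\<lambda>s. f (ln s / 2)) has_real_derivative f1 (ln s / 2) * (1 / (2 * s))) (at s)"
    by (rule DERIV_chain2[OF f_deriv[OF s(2)] l])
  have F1: "((\<lambda>s. f1 (ln s / 2)) has_real_derivative
      (2 * f1 (ln s / 2) + (f (ln s / 2))\<^sup>2) * (1 / (2 * s))) (at s)"
    by (rule DERIV_chain2[OF f1_deriv[OF s(2)] l])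
  show "(radial has_real_derivative radial1 s) (at s)"
    unfolding radial_def[abs_def] radial1_def using s
    by (auto intro!: derivative_eq_intros F F1 simp: field_simps power2_eq_square)
  show "(radial1 has_real_derivative radial2 s) (at s)"
    unfolding radial1_def[abs_def] radial2_def using s
    by (auto intro!: derivative_eq_intros F F1 simp: divide_simps)
      (simp add: power_numeral_reduce algebra_simps)
  show "(radial2 has_real_derivative radial3 s) (at s)"
    unfolding radial2_def[abs_def] radial3_def using s
    by (auto intro!: derivative_eq_intros F F1 simp: divide_simps)
      (simp add: power_numeral_reduce algebra_simps)
qed

text \<open>Half of the equation \<open>\<Delta>v = v^2\<close> in dimension 4: the Laplacian of
  \<open>radial ((norm x)^2)\<close> is \<open>8 radial1 + 4 s radial2\<close> at
  \<open>s = (norm x)^2\<close>.\<close>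

lemma radial_equation:
  assumes "1 \<le> s"
  shows "4 * radial1 s + 2 * s * radial2 s = (radial s)\<^sup>2 / 2"
  using assms unfolding radial_def radial1_def radial2_def
  by (simp add: divide_simps) (simp add: power2_eq_square power3_eq_cube algebra_simps)

lemma radial_range:
  assumes "1 \<le> s"
  shows "0 < radial s" "radial s \<le> 1 / s" "radial s \<le> 1"
proof -
  have s: "0 \<le> ln s / 2" using assms by simp
  show "0 < radial s" using f_pos[OF s] assms by (simp add: radial_def)
  show "radial s \<le> 1 / s" using f_le_1[OF s] assms by (simp add: radial_def divide_right_mono)
  also have "\<dots> \<le> 1" using assms by simp
  finally show "radial s \<le> 1" .
qed

lemma radial_derivs_bound:
  assumes "1 \<le> s"
  shows "\<bar>radial1 s\<bar> \<le> bound / s\<^sup>2" "\<bar>radial2 s\<bar> \<le> bound / s ^ 3" "\<bar>radial3 s\<bar> \<le> bound / s ^ 4"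
proof -
  have s: "0 \<le> ln s / 2" using assms by simp
  define a b where "a = f (ln s / 2)" and "b = f1 (ln s / 2)"
  have a: "0 \<le> a" "a \<le> 1" "0 \<le> a\<^sup>2" "a\<^sup>2 \<le> 1" and b: "\<bar>b\<bar> \<le> C"
    using f_range[OF s] f1_bounded[OF s] f_power_le_1[OF s, of 2] by (auto simp: a_def b_def)
  have ab: "\<bar>a * b\<bar> \<le> C"
    using mult_mono[of "\<bar>a\<bar>" 1 "\<bar>b\<bar>" C] a b C_nonneg by (simp add: abs_mult)
  have "\<bar>b / 2 - a\<bar> \<le> bound" using a b C_nonneg unfolding bound_def by linarith
  then show "\<bar>radial1 s\<bar> \<le> bound / s\<^sup>2"
    using assms by (simp add: radial1_def a_def b_def abs_divide divide_right_mono)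
  have "\<bar>a\<^sup>2 / 4 - b + 2 * a\<bar> \<le> bound" using a b C_nonneg unfolding bound_def by linarith
  then show "\<bar>radial2 s\<bar> \<le> bound / s ^ 3"
    using assms by (simp add: radial2_def a_def b_def abs_divide divide_right_mono)
  have "\<bar>a * b / 4 - 5 / 4 * a\<^sup>2 + 3 * b - 6 * a\<bar> \<le> bound"
    using a b ab C_nonneg unfolding bound_def by linarith
  then show "\<bar>radial3 s\<bar> \<le> bound / s ^ 4"
    using assms by (simp add: radial3_def a_def b_def abs_divide divide_right_mono)
qed

text \<open>\<open>s / 2 \<le> s'\<close> keeps the intermediate point of the Lagrange remainder
  above \<open>s / 2\<close>, at the cost of a factor \<open>2^4 = 16\<close> in the bound for
  \<open>radial3\<close>.\<close>

lemma radial_taylor: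
  assumes "1 \<le> s" "1 \<le> s'" "s / 2 \<le> s'"
  shows "\<bar>radial s' - (radial s + radial1 s * (s' - s) + radial2 s * (s' - s)\<^sup>2 / 2)\<bar>
    \<le> 16 * bound / s ^ 4 * \<bar>s' - s\<bar> ^ 3 / 6"
proof (cases "s' = s")
  case False
  define d where "d m = (if m = 0 then radial else if m = 1 then radial1 else if m = 2 then radial2 else radial3)"
    for m :: nat
  have "\<exists>t. (if s' < s then s' < t \<and> t < s else s < t \<and> t < s') \<and>
      radial s' = (\<Sum>m<3. d m s / fact m * (s' - s) ^ m) + d 3 t / fact 3 * (s' - s) ^ 3"
  proof (rule Taylor[where a = "min s s'" and b = "max s s'"])
    show "\<forall>m t. m < 3 \<and> min s s' \<le> t \<and> t \<le> max s s' \<longrightarrow> (d m has_real_derivative d (Suc m) t) (at t)"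
    proof (intro allI impI)
      fix m :: nat and t assume h: "m < 3 \<and> min s s' \<le> t \<and> t \<le> max s s'"
      then have "1 \<le> t" using assms by auto
      moreover have "m = 0 \<or> m = 1 \<or> m = 2" using h by auto
      ultimately show "(d m has_real_derivative d (Suc m) t) (at t)"
        using radial_derivs by (auto simp: d_def)
    qed
  qed (use False in \<open>auto simp: d_def\<close>)
  then obtain t where t: "min s s' < t" and
    e: "radial s' = (\<Sum>m<3. d m s / fact m * (s' - s) ^ m) + d 3 t / fact 3 * (s' - s) ^ 3"
    by (auto split: if_splits)
  have "radial s' - (radial s + radial1 s * (s' - s) + radial2 s * (s' - s)\<^sup>2 / 2)
      = radial3 t * ((s' - s) ^ 3 / 6)"
    unfolding e by (simp add: d_def numeral_3_eq_3 fact_numeral power2_eq_square)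
  moreover have "\<bar>radial3 t\<bar> \<le> 16 * bound / s ^ 4"
  proof -
    have t1: "1 \<le> t" "s / 2 \<le> t" using t assms by auto
    then have "(s / 2) ^ 4 \<le> t ^ 4" using assms by (intro power_mono) auto
    then have "bound / t ^ 4 \<le> bound / (s / 2) ^ 4"
      using assms bound_ge t1 by (intro divide_left_mono) auto
    also have "\<dots> = 16 * bound / s ^ 4" by (simp add: power_divide)
    finally show ?thesis using radial_derivs_bound(3)[OF t1(1)] by linarith
  qed
  ultimately show ?thesis
    using mult_right_mono[of "\<bar>radial3 t\<bar>" "16 * bound / s ^ 4" "\<bar>s' - s\<bar> ^ 3 / 6"]
    by (simp only: abs_mult power_abs abs_divide abs_numeral times_divide_eq_right) simp
qed (use bound_ge assms in auto)

section \<open>The candidate \<open>h\<close> on the whole space and its expansion along one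
  step\<close>

definition avoidance :: "'b::euclidean_space \<Rightarrow> real" where
  "avoidance y = (if norm y \<le> 1 then 0 else 1 - radial ((norm y)\<^sup>2))"

definition source :: "'b::euclidean_space \<Rightarrow> real" where
  "source y = (1 + (avoidance y)\<^sup>2) / 2"

lemma one_le_norm_power2: "1 \<le> norm y \<Longrightarrow> 1 \<le> (norm y)\<^sup>2"
  by (simp add: one_le_power)

lemma avoidance_range: "0 \<le> avoidance y" "avoidance y \<le> 1"
  using radial_range[OF one_le_norm_power2, of y] by (auto simp: avoidance_def)

lemma source_range: "0 \<le> source y" "source y \<le> 1"
  using power_le_one[OF avoidance_range, of y 2] by (auto simp: source_def)

lemma continuous_on_avoidance: "continuous_on UNIV (avoidance :: 'b::euclidean_space \<Rightarrow> real)"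
proof -
  have rad: "continuous_on {1..} radial"
    by (rule DERIV_continuous_on[where D = radial1]) (use radial_derivs in \<open>auto intro: DERIV_subset\<close>)
  have "radial 1 = 1" by (simp add: radial_def f_0)
  then have "continuous_on UNIV (\<lambda>y :: 'b. if norm y \<le> 1 then 0 else 1 - radial ((norm y)\<^sup>2))"
    by (intro continuous_on_cases_le continuous_intros continuous_on_compose2[OF rad])
      (auto intro: one_le_norm_power2)
  then show ?thesis by (simp add: avoidance_def[abs_def])
qed

lemma continuous_on_source: "continuous_on UNIV source"
  unfolding source_def[abs_def] by (intro continuous_intros continuous_on_avoidance) auto

lemma measurable_avoidance [measurable]: "avoidance \<in> borel_measurable borel"
  by (rule borel_measurable_continuous_onI[OF continuous_on_avoidance])

lemma measurable_source [measurable]: "source \<in> borel_measurable borel"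
  by (rule borel_measurable_continuous_onI[OF continuous_on_source])

text \<open>\<open>radial 1 = 1\<close>, the slope of \<open>radial\<close> is at most
  \<open>bound\<close> in modulus, and \<open>(norm y)^2 - 1 \<le> 3 * \<delta>\<close>. This
  controls the contribution of paths stopped in the thin shell around the ball.\<close>

lemma avoidance_near_ball:
  assumes "norm y \<le> 1 + \<delta>" "0 \<le> \<delta>" "\<delta> \<le> 1"
  shows "avoidance y \<le> 3 * bound * \<delta>"
proof (cases "norm y \<le> 1")
  case True
  then show ?thesis using bound_ge assms by (simp add: avoidance_def)
next
  case False
  define s where "s = (norm y)\<^sup>2"
  have s: "1 < s" using False by (simp add: s_def)
  have "s \<le> (1 + \<delta>)\<^sup>2" unfolding s_def using assms by (intro power_mono) auto
  also have "\<dots> \<le> 1 + 3 * \<delta>"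
    using assms mult_left_mono[of \<delta> 1 \<delta>] by (simp add: power2_eq_square algebra_simps)
  finally have s3: "s - 1 \<le> 3 * \<delta>" by simp
  obtain z where z: "1 < z" "z < s" "radial s - radial 1 = (s - 1) * radial1 z"
    using MVT2[OF s, of radial radial1] radial_derivs by auto
  have "\<bar>radial1 z\<bar> \<le> bound / z\<^sup>2" using radial_derivs_bound[of z] z by simp
  also have "\<dots> \<le> bound" using z bound_ge by (simp add: divide_le_eq)
  finally have "- radial1 z \<le> bound" by simp
  then have "(s - 1) * (- radial1 z) \<le> (s - 1) * bound"
    using s by (intro mult_left_mono) auto
  also have "\<dots> \<le> 3 * \<delta> * bound"
    using s3 bound_ge by (intro mult_right_mono) auto
  finally have "- ((s - 1) * radial1 z) \<le> 3 * bound * \<delta>" by (simp add: mult_ac)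
  moreover have "avoidance y = radial 1 - radial s"
    using False by (simp add: avoidance_def s_def radial_def f_0)
  ultimately show ?thesis using z(3) by linarith
qed

text \<open>The sum of the constants for long and for short steps. It blows up as
  \<open>\<delta>\<close> tends to \<open>0\<close>, which is harmless because the time step tends
  to \<open>0\<close> first, with \<open>\<delta>\<close> fixed.\<close>

definition step_const :: "real \<Rightarrow> real" where
  "step_const \<delta> = (1 + 5 * bound) * (4 / \<delta>) ^ 3 + 75 * bound"

lemma step_const_nonneg: "0 < \<delta> \<Longrightarrow> 0 \<le> step_const \<delta>"
  using bound_ge by (simp add: step_const_def)

text \<open>A short step stays outside the unit ball, as
  \<open>(1 - \<delta> / 4) * (1 + \<delta>) > 1\<close>, so \<open>radial\<close> may be expanded
  in \<open>s' - s = 2 (y \<bullet> z) + (norm z)^2\<close>. The decay of its derivatives in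
  \<open>s\<close> absorbs all powers of \<open>norm y\<close>. The remainder contributes
  \<open>16 * 27 / 6 = 72\<close>, the higher part of the quadratic term \<open>2\<close>; the sum
  is rounded up to \<open>75\<close>.\<close>

lemma avoidance_taylor_near:
  fixes y z :: "'b::euclidean_space"
  assumes \<delta>: "0 < \<delta>" "\<delta> \<le> 1" and y: "1 + \<delta> \<le> norm y" and z: "norm z \<le> \<delta> / 4 * norm y"
  shows "\<bar>avoidance (y + z) - (avoidance y - (radial1 ((norm y)\<^sup>2) * (2 * (y \<bullet> z) + (norm z)\<^sup>2)
      + 2 * radial2 ((norm y)\<^sup>2) * (y \<bullet> z)\<^sup>2))\<bar> \<le> 75 * bound * (norm z ^ 3 + norm z ^ 4)"
proof -
  define s s' p n where "s = (norm y)\<^sup>2" and "s' = (norm (y + z))\<^sup>2" and "p = y \<bullet> z" and "n = norm z"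
  have n: "0 \<le> n" by (simp add: n_def)
  have y1: "1 < norm y" using \<delta> y by simp
  have yz: "(1 - \<delta> / 4) * norm y \<le> norm (y + z)"
    using z norm_diff_ineq[of y z] by (simp add: algebra_simps)
  have "1 < (1 - \<delta> / 4) * (1 + \<delta>)"
  proof -
    have "\<delta> * \<delta> \<le> \<delta> * 1" using \<delta> by (intro mult_left_mono) auto
    then show ?thesis using \<delta> by (simp add: algebra_simps)
  qed
  also have "\<dots> \<le> (1 - \<delta> / 4) * norm y" using y \<delta> by (intro mult_left_mono) auto
  also note yz
  finally have yz1: "1 < norm (y + z)" .
  have "3 / 4 * norm y \<le> norm (y + z)"
    using yz \<delta> mult_right_mono[of "3 / 4" "1 - \<delta> / 4" "norm y"] by simp
  then have "(3 / 4 * norm y)\<^sup>2 \<le> s'" unfolding s'_def by (intro power_mono) auto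
  then have "9 / 16 * s \<le> s'" by (simp add: s_def power_mult_distrib power_divide)
  moreover have "0 \<le> s" by (simp add: s_def)
  ultimately have s': "s / 2 \<le> s'" by linarith
  have s1: "1 \<le> s" "1 \<le> s'" using y1 yz1 by (simp_all add: s_def s'_def one_le_norm_power2)
  have eta: "s' - s = 2 * p + n\<^sup>2"
    by (simp add: s_def s'_def p_def n_def power2_norm_eq_inner inner_simps inner_commute)
  have p: "\<bar>p\<bar> \<le> norm y * n" unfolding p_def n_def by (rule Cauchy_Schwarz_ineq2)
  have nn: "n \<le> norm y" using z \<delta> mult_right_mono[of "\<delta> / 4" 1 "norm y"] by (simp add: n_def)
  have "\<bar>s' - s\<bar> \<le> 2 * \<bar>p\<bar> + n\<^sup>2"
    unfolding eta by (intro order_trans[OF abs_triangle_ineq]) (simp add: abs_mult)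
  moreover have "n\<^sup>2 \<le> norm y * n" using mult_right_mono[OF nn n] by (simp add: power2_eq_square)
  ultimately have "\<bar>s' - s\<bar> \<le> 3 * (norm y * n)" using p by linarith
  then have "\<bar>s' - s\<bar> ^ 3 \<le> (3 * (norm y * n)) ^ 3" by (intro power_mono) auto
  also have "\<dots> = 27 * (norm y ^ 3 * n ^ 3)" by (simp add: power_mult_distrib)
  also have "\<dots> \<le> 27 * (s ^ 4 * n ^ 3)"
  proof -
    have "norm y ^ 3 \<le> norm y ^ 8" using y1 by (intro power_increasing) auto
    then have "norm y ^ 3 \<le> s ^ 4" by (simp add: s_def flip: power_mult)
    then show ?thesis using n by (intro mult_left_mono mult_right_mono) auto
  qed
  finally have e3: "\<bar>s' - s\<bar> ^ 3 \<le> 27 * (s ^ 4 * n ^ 3)" .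
  have "16 * bound / s ^ 4 * \<bar>s' - s\<bar> ^ 3 / 6 \<le> 16 * bound / s ^ 4 * (27 * (s ^ 4 * n ^ 3)) / 6"
    using e3 bound_ge by (intro divide_right_mono mult_left_mono) auto
  also have "\<dots> = 72 * bound * n ^ 3" using s1 by (simp add: field_simps)
  finally have T: "\<bar>radial s' - (radial s + radial1 s * (s' - s) + radial2 s * (s' - s)\<^sup>2 / 2)\<bar> \<le> 72 * bound * n ^ 3"
    using radial_taylor[OF s1 s'] by linarith
  have "\<bar>radial2 s * (2 * p * n\<^sup>2 + n ^ 4 / 2)\<bar> \<le> bound / s ^ 3 * (2 * norm y * n ^ 3 + n ^ 4 / 2)"
    unfolding abs_mult
  proof (intro mult_mono radial_derivs_bound s1)
    have "\<bar>2 * p * n\<^sup>2 + n ^ 4 / 2\<bar> \<le> 2 * \<bar>p\<bar> * n\<^sup>2 + n ^ 4 / 2"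
      using n by (intro order_trans[OF abs_triangle_ineq]) (simp add: abs_mult)
    also have "\<dots> \<le> 2 * (norm y * n) * n\<^sup>2 + n ^ 4 / 2"
      using p n by (intro add_right_mono mult_right_mono mult_left_mono) auto
    finally show "\<bar>2 * p * n\<^sup>2 + n ^ 4 / 2\<bar> \<le> 2 * norm y * n ^ 3 + n ^ 4 / 2"
      by (simp add: power2_eq_square power3_eq_cube mult.assoc)
  qed (use bound_ge s1 in auto)
  also have "\<dots> \<le> bound / s ^ 3 * (s ^ 3 * (2 * (n ^ 3 + n ^ 4)))"
  proof -
    have "norm y \<le> norm y ^ 6" using y1 by (intro self_le_power) auto
    then have ys: "norm y \<le> s ^ 3" by (simp add: s_def flip: power_mult)
    have "1 \<le> s ^ 3" using s1 by (simp add: one_le_power)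
    then have "1 * (2 * n ^ 4) \<le> s ^ 3 * (2 * n ^ 4)" using n by (intro mult_right_mono) auto
    moreover have "2 * norm y * n ^ 3 \<le> 2 * s ^ 3 * n ^ 3" using ys n by (intro mult_right_mono) auto
    moreover have "0 \<le> n ^ 4" using n by simp
    ultimately have "2 * norm y * n ^ 3 + n ^ 4 / 2 \<le> 2 * s ^ 3 * n ^ 3 + s ^ 3 * (2 * n ^ 4)" by linarith
    then show ?thesis using bound_ge s1 by (intro mult_left_mono) (auto simp: algebra_simps)
  qed
  also have "\<dots> = 2 * bound * (n ^ 3 + n ^ 4)" using s1 by (simp add: field_simps)
  finally have Q: "\<bar>radial2 s * (2 * p * n\<^sup>2 + n ^ 4 / 2)\<bar> \<le> 2 * bound * (n ^ 3 + n ^ 4)" .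
  have "radial2 s * (s' - s)\<^sup>2 / 2 = 2 * radial2 s * p\<^sup>2 + radial2 s * (2 * p * n\<^sup>2 + n ^ 4 / 2)"
    unfolding eta by (simp add: power2_eq_square power4_eq_xxxx algebra_simps)
  moreover have "radial1 s * (s' - s) = radial1 s * (2 * p + n\<^sup>2)" by (simp only: eta)
  moreover have "avoidance (y + z) = 1 - radial s'" "avoidance y = 1 - radial s"
    using y1 yz1 by (simp_all add: avoidance_def s_def s'_def)
  ultimately have "avoidance (y + z) - (avoidance y - (radial1 s * (2 * p + n\<^sup>2) + 2 * radial2 s * p\<^sup>2))
      = - (radial s' - (radial s + radial1 s * (s' - s) + radial2 s * (s' - s)\<^sup>2 / 2))
        - radial2 s * (2 * p * n\<^sup>2 + n ^ 4 / 2)"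
    by linarith
  moreover have "72 * bound * n ^ 3 + 2 * bound * (n ^ 3 + n ^ 4) \<le> 75 * bound * (n ^ 3 + n ^ 4)"
    using bound_ge n by (simp add: distrib_left)
  ultimately show ?thesis
    using T Q unfolding s_def[symmetric] p_def[symmetric] n_def[symmetric] by linarith
qed

text \<open>No smoothness is involved: for a long step \<open>q = 4 / \<delta> * norm z\<close> is
  at least \<open>1\<close>, so the increment of \<open>avoidance\<close>, which is at most
  \<open>1\<close>, and each term of the polynomial are dominated by multiples of
  \<open>q^3\<close>.\<close>

lemma avoidance_taylor_far:
  fixes y z :: "'b::euclidean_space"
  assumes \<delta>: "0 < \<delta>" "\<delta> \<le> 1" and y: "1 + \<delta> \<le> norm y" and z: "\<delta> / 4 * norm y \<le> norm z"
  shows "\<bar>avoidance (y + z) - (avoidance y - (radial1 ((norm y)\<^sup>2) * (2 * (y \<bullet> z) + (norm z)\<^sup>2)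
      + 2 * radial2 ((norm y)\<^sup>2) * (y \<bullet> z)\<^sup>2))\<bar> \<le> (1 + 5 * bound) * (4 / \<delta>) ^ 3 * norm z ^ 3"
proof -
  define s p n q where "s = (norm y)\<^sup>2" and "p = y \<bullet> z" and "n = norm z" and "q = 4 / \<delta> * n"
  have y1: "1 \<le> norm y" using \<delta> y by simp
  have s1: "1 \<le> s" using one_le_norm_power2[OF y1] by (simp add: s_def)
  have "\<delta> / 4 * 1 \<le> \<delta> / 4 * norm y" using y1 \<delta> by (intro mult_left_mono) auto
  then have "\<delta> / 4 \<le> n" using z by (simp add: n_def)
  then have q1: "1 \<le> q" using \<delta> by (simp add: q_def field_simps)
  have n: "0 \<le> n" "n \<le> q" using \<delta> mult_right_mono[of 1 "4 / \<delta>" n] by (auto simp: n_def q_def)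
  have qq: "q \<le> q ^ 3" "q\<^sup>2 \<le> q ^ 3" "1 \<le> q ^ 3" using q1 by (auto intro: self_le_power power_increasing one_le_power)
  have p: "\<bar>p\<bar> \<le> norm y * n" unfolding p_def n_def by (rule Cauchy_Schwarz_ineq2)
  have nsq: "n\<^sup>2 \<le> q\<^sup>2" using n by (intro power_mono) auto
  have "\<bar>2 * p + n\<^sup>2\<bar> \<le> 2 * \<bar>p\<bar> + n\<^sup>2"
    by (intro order_trans[OF abs_triangle_ineq]) (simp add: abs_mult)
  also have "\<dots> \<le> s\<^sup>2 * (3 * q ^ 3)"
  proof -
    have "norm y \<le> norm y ^ 4" using y1 by (intro self_le_power) auto
    then have "norm y \<le> s\<^sup>2" by (simp add: s_def flip: power_mult)
    then have "norm y * n \<le> s\<^sup>2 * q ^ 3" using n qq by (intro mult_mono) auto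
    moreover have "1 * n\<^sup>2 \<le> s\<^sup>2 * q ^ 3" using nsq qq s1 by (intro mult_mono one_le_power) auto
    ultimately show ?thesis using p by simp
  qed
  finally have a: "\<bar>radial1 s * (2 * p + n\<^sup>2)\<bar> \<le> bound / s\<^sup>2 * (s\<^sup>2 * (3 * q ^ 3))"
    unfolding abs_mult using bound_ge by (intro mult_mono radial_derivs_bound s1) auto
  have "p\<^sup>2 \<le> (norm y * n)\<^sup>2" using p by (metis abs_ge_zero power2_abs power_mono)
  also have "\<dots> = s * n\<^sup>2" by (simp add: s_def power_mult_distrib)
  also have "\<dots> \<le> s ^ 3 * q ^ 3"
    using s1 nsq qq by (intro mult_mono self_le_power) auto
  finally have b: "\<bar>radial2 s * p\<^sup>2\<bar> \<le> bound / s ^ 3 * (s ^ 3 * q ^ 3)"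
    unfolding abs_mult using bound_ge s1 by (intro mult_mono radial_derivs_bound s1) auto
  have "\<bar>avoidance (y + z) - avoidance y\<bar> \<le> 1"
    using avoidance_range[of y] avoidance_range[of "y + z"] by simp
  then have "\<bar>avoidance (y + z) - (avoidance y - (radial1 s * (2 * p + n\<^sup>2) + 2 * radial2 s * p\<^sup>2))\<bar>
      \<le> 1 + bound * (3 * q ^ 3) + 2 * (bound * q ^ 3)"
    using a b s1 by (simp add: abs_le_iff)
  also have "\<dots> \<le> (1 + 5 * bound) * q ^ 3" using qq by (simp add: algebra_simps)
  also have "\<dots> = (1 + 5 * bound) * (4 / \<delta>) ^ 3 * norm z ^ 3"
    by (simp add: q_def n_def power_mult_distrib power_divide)
  finally show ?thesis by (simp add: s_def p_def n_def)
qed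

lemma avoidance_taylor:
  fixes y z :: "'b::euclidean_space"
  assumes \<delta>: "0 < \<delta>" "\<delta> \<le> 1" and y: "1 + \<delta> \<le> norm y"
  shows "\<bar>avoidance (y + z) - (avoidance y - (radial1 ((norm y)\<^sup>2) * (2 * (y \<bullet> z) + (norm z)\<^sup>2)
      + 2 * radial2 ((norm y)\<^sup>2) * (y \<bullet> z)\<^sup>2))\<bar> \<le> step_const \<delta> * (norm z ^ 3 + norm z ^ 4)"
proof -
  have n: "0 \<le> norm z ^ 3" "0 \<le> norm z ^ 4" by auto
  have c: "0 \<le> (1 + 5 * bound) * (4 / \<delta>) ^ 3" "0 \<le> 75 * bound" using bound_ge \<delta> by auto
  have "75 * bound * (norm z ^ 3 + norm z ^ 4) \<le> step_const \<delta> * (norm z ^ 3 + norm z ^ 4)"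
    unfolding step_const_def using n c by (intro mult_right_mono) auto
  moreover have "(1 + 5 * bound) * (4 / \<delta>) ^ 3 * norm z ^ 3 \<le> step_const \<delta> * (norm z ^ 3 + norm z ^ 4)"
    unfolding step_const_def using n c by (intro mult_mono) auto
  ultimately show ?thesis
    using avoidance_taylor_near[OF assms, of z] avoidance_taylor_far[OF assms, of z]
    by (cases "norm z \<le> \<delta> / 4 * norm y") (auto intro: order_trans)
qed

text \<open>By \<open>radial_equation\<close> the expected quadratic expansion is
  \<open>avoidance + \<sigma>^2 (avoidance - source)\<close>, since
  \<open>avoidance - source = - radial^2 / 2\<close>. Multiplying by
  \<open>q = exp (- \<sigma>^2)\<close>, the probability of surviving a step of length
  \<open>\<sigma>^2\<close>, replaces \<open>q (1 + \<sigma>^2)\<close> by \<open>1\<close> up to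
  order \<open>\<sigma>^4\<close>.\<close>

lemma gaussian_step:
  fixes X :: "'w \<Rightarrow> real ^ 4"
  assumes X: "gaussian_vector M X \<sigma>" and \<sigma>: "\<sigma> \<le> 1"
    and \<delta>: "0 < \<delta>" "\<delta> \<le> 1" and y: "1 + \<delta> \<le> norm y"
  shows "\<bar>exp (- \<sigma>\<^sup>2) * (\<integral>\<omega>. avoidance (y + X \<omega>) \<partial>M) - (avoidance y - (1 - exp (- \<sigma>\<^sup>2)) * source y)\<bar>
    \<le> (1 + 74 * step_const \<delta>) * \<sigma> ^ 3"
proof -
  interpret gaussian_vector M X \<sigma> by fact
  define s where "s = (norm y)\<^sup>2"
  have y1: "1 < norm y" using y \<delta> by simp
  have s1: "1 \<le> s" using one_le_norm_power2[of y] y1 by (simp add: s_def)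
  define T where "T \<omega> = avoidance y - (radial1 s * (2 * (y \<bullet> X \<omega>) + (norm (X \<omega>))\<^sup>2)
      + 2 * radial2 s * (y \<bullet> X \<omega>)\<^sup>2)" for \<omega>
  have intT: "integrable M T"
    unfolding T_def using linear_moment(1) quadratic_moment(1) norm_moment_2(1) by auto
  have "expectation T = avoidance y - (radial1 s * (4 * \<sigma>\<^sup>2) + 2 * radial2 s * (\<sigma>\<^sup>2 * s))"
    unfolding T_def using linear_moment quadratic_moment norm_moment_2 by (simp add: prob_space s_def)
  also have "\<dots> = avoidance y - \<sigma>\<^sup>2 * ((radial s)\<^sup>2 / 2)"
    unfolding radial_equation[OF s1, symmetric] by (simp add: algebra_simps)
  also have "\<dots> = avoidance y + \<sigma>\<^sup>2 * (avoidance y - source y)"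
    using y1 by (simp add: source_def avoidance_def s_def power2_eq_square field_simps)
  finally have ET: "expectation T = avoidance y + \<sigma>\<^sup>2 * (avoidance y - source y)" .
  have intA: "integrable M (\<lambda>\<omega>. avoidance (y + X \<omega>))"
    by (rule integrable_const_bound[where B = 1]) (auto intro!: AE_I2 simp: avoidance_range)
  have pointwise: "\<bar>avoidance (y + X \<omega>) - T \<omega>\<bar> \<le> step_const \<delta> * (norm (X \<omega>) ^ 3 + norm (X \<omega>) ^ 4)" for \<omega>
    using avoidance_taylor[OF \<delta> y, of "X \<omega>"] by (simp add: T_def s_def)
  have "\<bar>expectation (\<lambda>\<omega>. avoidance (y + X \<omega>)) - expectation T\<bar>
      = \<bar>expectation (\<lambda>\<omega>. avoidance (y + X \<omega>) - T \<omega>)\<bar>"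
    using intT intA by simp
  also have "\<dots> \<le> expectation (\<lambda>\<omega>. step_const \<delta> * (norm (X \<omega>) ^ 3 + norm (X \<omega>) ^ 4))"
    using norm_moment_3(1) norm_moment_4(1) intT intA pointwise
    by (intro order_trans[OF integral_abs_bound] integral_mono) auto
  also have "\<dots> = step_const \<delta> * (expectation (\<lambda>\<omega>. norm (X \<omega>) ^ 3) + expectation (\<lambda>\<omega>. norm (X \<omega>) ^ 4))"
    using norm_moment_3(1) norm_moment_4(1) by simp
  \<comment> \<open>In dimension 4 the moment bounds have the constants
    \<open>(4 + 3 * 16) / 2 = 26\<close> and \<open>3 * 16 = 48\<close>, with sum
    \<open>74\<close>.\<close>
  also have "\<dots> \<le> step_const \<delta> * (26 * \<sigma> ^ 3 + 48 * \<sigma> ^ 3)"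
  proof (intro mult_left_mono add_mono step_const_nonneg \<delta>)
    show "expectation (\<lambda>\<omega>. norm (X \<omega>) ^ 3) \<le> 26 * \<sigma> ^ 3" using norm_moment_3(2) by simp
    have "\<sigma> ^ 4 \<le> \<sigma> ^ 3" using \<sigma> \<sigma>_pos by (intro power_decreasing) auto
    then show "expectation (\<lambda>\<omega>. norm (X \<omega>) ^ 4) \<le> 48 * \<sigma> ^ 3" using norm_moment_4(2) by simp
  qed
  finally have E: "\<bar>expectation (\<lambda>\<omega>. avoidance (y + X \<omega>)) - expectation T\<bar> \<le> 74 * step_const \<delta> * \<sigma> ^ 3"
    by simp
  define q where "q = exp (- \<sigma>\<^sup>2)"
  have q: "0 \<le> q" "q \<le> 1" by (simp_all add: q_def)
  have "1 - \<sigma>\<^sup>2 \<le> q" using exp_ge_add_one_self[of "- \<sigma>\<^sup>2"] by (simp add: q_def)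
  then have "(1 - \<sigma>\<^sup>2) * (1 + \<sigma>\<^sup>2) \<le> q * (1 + \<sigma>\<^sup>2)" by (intro mult_right_mono) auto
  then have q1: "1 - q * (1 + \<sigma>\<^sup>2) \<le> \<sigma> ^ 4"
    by (simp add: algebra_simps power2_eq_square power4_eq_xxxx)
  have "q * (1 + \<sigma>\<^sup>2) \<le> q * exp (\<sigma>\<^sup>2)"
    using q exp_ge_add_one_self[of "\<sigma>\<^sup>2"] by (intro mult_left_mono) auto
  then have q2: "q * (1 + \<sigma>\<^sup>2) \<le> 1" by (simp add: q_def flip: exp_add)
  have "\<bar>(1 - q * (1 + \<sigma>\<^sup>2)) * (avoidance y - source y)\<bar> \<le> \<sigma> ^ 4 * 1"
    unfolding abs_mult using q1 q2 avoidance_range[of y] source_range[of y]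
    by (intro mult_mono) auto
  also have "\<dots> \<le> \<sigma> ^ 3" using \<sigma> \<sigma>_pos power_decreasing[of 3 4 \<sigma>] by simp
  finally have e1: "\<bar>(1 - q * (1 + \<sigma>\<^sup>2)) * (avoidance y - source y)\<bar> \<le> \<sigma> ^ 3" .
  have e2: "\<bar>q * (expectation (\<lambda>\<omega>. avoidance (y + X \<omega>)) - expectation T)\<bar> \<le> 1 * (74 * step_const \<delta> * \<sigma> ^ 3)"
    unfolding abs_mult using q E by (intro mult_mono) auto
  have "q * expectation (\<lambda>\<omega>. avoidance (y + X \<omega>)) - (avoidance y - (1 - q) * source y)
      = q * (expectation (\<lambda>\<omega>. avoidance (y + X \<omega>)) - expectation T)
        - (1 - q * (1 + \<sigma>\<^sup>2)) * (avoidance y - source y)"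
    unfolding ET by (simp add: algebra_simps)
  with e1 e2 have "\<bar>q * expectation (\<lambda>\<omega>. avoidance (y + X \<omega>)) - (avoidance y - (1 - q) * source y)\<bar>
      \<le> 74 * step_const \<delta> * \<sigma> ^ 3 + \<sigma> ^ 3"
    by linarith
  then show ?thesis by (simp add: q_def algebra_simps)
qed

end

subsection \<open>Brownian motion observed at discrete times\<close>

locale brownian_motion = prob_space M for M :: "'w measure" +
  fixes W :: "real \<Rightarrow> 'w \<Rightarrow> real ^ 'n::finite"
  assumes brownian: "standard_brownian_motion M W"

sublocale brownian_motion \<subseteq> continuous_process M W
  using brownian by unfold_locales (auto simp: standard_brownian_motion_def)

context brownian_motion
begin

lemma W_0: "\<omega> \<in> space M \<Longrightarrow> W 0 \<omega> = 0"
  using brownian by (auto simp: standard_brownian_motion_def)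

lemma gaussian_increment:
  assumes "0 \<le> s" "s < t"
  shows "gaussian_vector M (\<lambda>\<omega>. W t \<omega> - W s \<omega>) (sqrt (t - s))"
  using brownian assms by unfold_locales (auto simp: standard_brownian_motion_def)

definition increment :: "real \<Rightarrow> nat \<Rightarrow> 'w \<Rightarrow> real ^ 'n" where
  "increment \<epsilon> i \<omega> = W (real (Suc i) * \<epsilon>) \<omega> - W (real i * \<epsilon>) \<omega>"

text \<open>Only the indices \<open>0\<close> to \<open>k - 1\<close> are tested, so
  \<open>alive \<rho> x \<epsilon> (Suc k)\<close> is determined by the first \<open>k\<close>
  increments and is independent of increment \<open>k\<close>.\<close>

definition alive :: "real \<Rightarrow> real ^ 'n \<Rightarrow> real \<Rightarrow> nat \<Rightarrow> 'w \<Rightarrow> bool" where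
  "alive \<rho> x \<epsilon> k \<omega> \<longleftrightarrow> (\<forall>j<k. \<rho> < norm (x + W (real j * \<epsilon>) \<omega>))"

lemma W_eq_sum_increments:
  assumes "\<omega> \<in> space M"
  shows "W (real j * \<epsilon>) \<omega> = (\<Sum>i<j. increment \<epsilon> i \<omega>)"
  unfolding increment_def using sum_lessThan_telescope[of "\<lambda>i. W (real i * \<epsilon>) \<omega>" j] W_0[OF assms] by simp

lemma measurable_W_mult [measurable]: "0 < \<epsilon> \<Longrightarrow> W (real j * \<epsilon>) \<in> borel_measurable M"
  by (rule measurable_at) simp

lemma pred_alive:
  assumes [arith]: "0 < \<epsilon>"
  shows "Measurable.pred M (alive \<rho> x \<epsilon> k)"
  unfolding alive_def[abs_def] by measurable

text \<open>The Markov property at one grid time: the first \<open>k\<close> increments, which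
  determine \<open>alive\<close> and the current position, are independent of increment
  \<open>k\<close>, which can therefore be integrated out separately.\<close>

lemma markov_step:
  fixes \<psi> :: "real ^ 'n \<Rightarrow> real"
  assumes \<epsilon>: "0 < \<epsilon>" and \<psi>: "\<psi> \<in> borel_measurable borel" "\<And>y. \<bar>\<psi> y\<bar> \<le> B"
  shows "expectation (\<lambda>\<omega>. of_bool (alive \<rho> x \<epsilon> (Suc k) \<omega>) * \<psi> (x + W (real (Suc k) * \<epsilon>) \<omega>)) =
    expectation (\<lambda>\<omega>. of_bool (alive \<rho> x \<epsilon> (Suc k) \<omega>) *
      expectation (\<lambda>\<omega>'. \<psi> (x + W (real k * \<epsilon>) \<omega> + increment \<epsilon> k \<omega>')))"
proof -
  define P where "P = PiM {..<k} (\<lambda>_. borel :: (real ^ 'n) measure)"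
  define Q where "Q = PiM {k} (\<lambda>_. borel :: (real ^ 'n) measure)"
  define Z where "Z p = of_bool (\<forall>j<Suc k. \<rho> < norm (x + (\<Sum>i<j. fst p i))) * \<psi> (x + (\<Sum>i<k. fst p i) + snd p k)"
    for p :: "(nat \<Rightarrow> real ^ 'n) \<times> (nat \<Rightarrow> real ^ 'n)"
  note \<psi>(1)[measurable]
  have [measurable]: "(\<lambda>p. \<Sum>i<j. fst p i) \<in> borel_measurable (P \<Otimes>\<^sub>M Q)" if "j \<le> k" for j
    unfolding P_def Q_def using that
    by (intro borel_measurable_sum measurable_compose[OF measurable_fst measurable_component_singleton]) auto
  have [measurable]: "(\<lambda>p. snd p k) \<in> borel_measurable (P \<Otimes>\<^sub>M Q)"
    unfolding P_def Q_def
    by (intro measurable_compose[OF measurable_snd measurable_component_singleton]) auto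
  have Z: "Z \<in> borel_measurable (P \<Otimes>\<^sub>M Q)"
    unfolding Z_def[abs_def]
  proof (intro borel_measurable_times)
    have "Measurable.pred (P \<Otimes>\<^sub>M Q) (\<lambda>p. \<forall>j\<in>{..<Suc k}. \<rho> < norm (x + (\<Sum>i<j. fst p i)))"
    proof (rule pred_intros_finite(3))
      fix j assume "j \<in> {..<Suc k}"
      then have [measurable]: "(\<lambda>p. \<Sum>i<j. fst p i) \<in> borel_measurable (P \<Otimes>\<^sub>M Q)" by simp
      show "Measurable.pred (P \<Otimes>\<^sub>M Q) (\<lambda>p. \<rho> < norm (x + (\<Sum>i<j. fst p i)))" by measurable
    qed simp
    then have [measurable]: "Measurable.pred (P \<Otimes>\<^sub>M Q) (\<lambda>p. \<forall>j<Suc k. \<rho> < norm (x + (\<Sum>i<j. fst p i)))"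
      by (simp add: Ball_def)
    show "(\<lambda>p. of_bool (\<forall>j<Suc k. \<rho> < norm (x + (\<Sum>i<j. fst p i))) :: real) \<in> borel_measurable (P \<Otimes>\<^sub>M Q)"
      by measurable
  qed measurable
  have "mono (\<lambda>i. real i * \<epsilon>)" using \<epsilon> by (auto simp: mono_def)
  then have "indep_vars (\<lambda>_. borel) (increment \<epsilon>) {..<Suc k}"
    using brownian unfolding standard_brownian_motion_def increment_def[abs_def]
    by (elim conjE allE[of _ "\<lambda>i. real i * \<epsilon>"] allE[of _ "Suc k"]) auto
  then have "indep_var P (\<lambda>\<omega>. \<lambda>i\<in>{..<k}. increment \<epsilon> i \<omega>) Q (\<lambda>\<omega>. \<lambda>i\<in>{k}. increment \<epsilon> i \<omega>)"
    unfolding P_def Q_def by (rule indep_var_restrict) auto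
  from integral_indep_var[OF this Z, of B]
  have main: "expectation (\<lambda>\<omega>. Z (\<lambda>i\<in>{..<k}. increment \<epsilon> i \<omega>, \<lambda>i\<in>{k}. increment \<epsilon> i \<omega>)) =
      expectation (\<lambda>\<omega>. expectation (\<lambda>\<omega>'. Z (\<lambda>i\<in>{..<k}. increment \<epsilon> i \<omega>, \<lambda>i\<in>{k}. increment \<epsilon> i \<omega>')))"
    using \<psi>(2) order_trans[OF abs_ge_zero \<psi>(2)] by (auto simp: Z_def)
  have sums: "(\<Sum>i<j. (\<lambda>i\<in>{..<k}. increment \<epsilon> i \<omega>) i) = W (real j * \<epsilon>) \<omega>" if "j \<le> k" "\<omega> \<in> space M" for j \<omega>
    unfolding W_eq_sum_increments[OF that(2)] using that(1) by (intro sum.cong) auto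
  have Zeq: "Z (\<lambda>i\<in>{..<k}. increment \<epsilon> i \<omega>, \<lambda>i\<in>{k}. increment \<epsilon> i \<omega>') =
      of_bool (alive \<rho> x \<epsilon> (Suc k) \<omega>) * \<psi> (x + W (real k * \<epsilon>) \<omega> + increment \<epsilon> k \<omega>')"
    if "\<omega> \<in> space M" for \<omega> \<omega>'
    using sums[OF _ that] by (simp add: Z_def alive_def less_Suc_eq_le)
  have "expectation (\<lambda>\<omega>. of_bool (alive \<rho> x \<epsilon> (Suc k) \<omega>) * \<psi> (x + W (real (Suc k) * \<epsilon>) \<omega>)) =
      expectation (\<lambda>\<omega>. Z (\<lambda>i\<in>{..<k}. increment \<epsilon> i \<omega>, \<lambda>i\<in>{k}. increment \<epsilon> i \<omega>))"
    by (rule Bochner_Integration.integral_cong) (simp_all only: Zeq, simp add: increment_def)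
  also note main
  also have "expectation (\<lambda>\<omega>. expectation (\<lambda>\<omega>'. Z (\<lambda>i\<in>{..<k}. increment \<epsilon> i \<omega>, \<lambda>i\<in>{k}. increment \<epsilon> i \<omega>'))) =
      expectation (\<lambda>\<omega>. of_bool (alive \<rho> x \<epsilon> (Suc k) \<omega>) *
        expectation (\<lambda>\<omega>'. \<psi> (x + W (real k * \<epsilon>) \<omega> + increment \<epsilon> k \<omega>')))"
    by (rule Bochner_Integration.integral_cong) (simp_all only: Zeq, simp)
  finally show ?thesis .
qed

end

locale killed_brownian_motion = hitting_profile f f1 C + brownian_motion M W
  for f f1 :: "real \<Rightarrow> real" and C and M :: "'w measure" and W :: "real \<Rightarrow> 'w \<Rightarrow> real ^ 4"
begin

text \<open>Discrete version of Dynkin's formula for \<open>avoidance\<close>, killed at rate \<open>1\<close> and stopped when the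
  skeleton enters the ball of radius \<open>1 + \<delta>\<close>.\<close>

lemma skeleton_bounds:
  fixes x :: "real ^ 4" and K :: nat
  assumes \<delta>: "0 < \<delta>" "\<delta> \<le> 1" and \<epsilon>: "0 < \<epsilon>" "\<epsilon> \<le> 1"
  defines "S \<equiv> \<Sum>k<K. exp (- \<epsilon>) ^ k * (1 - exp (- \<epsilon>)) *
    expectation (\<lambda>\<omega>. of_bool (alive (1 + \<delta>) x \<epsilon> (Suc k) \<omega>) * source (x + W (real k * \<epsilon>) \<omega>))"
    and "err \<equiv> real K * ((1 + 74 * step_const \<delta>) * sqrt \<epsilon> ^ 3)"
  shows "S - err \<le> avoidance x" "avoidance x \<le> S + 3 * bound * \<delta> + exp (- \<epsilon>) ^ K + err"
proof -
  define q where "q = exp (- \<epsilon>)"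
  have q: "0 < q" "q \<le> 1" "\<And>k. 0 \<le> q ^ k" "\<And>k. q ^ k \<le> 1"
    using \<epsilon> by (auto simp: q_def intro: power_le_one)
  define X where "X k \<omega> = x + W (real k * \<epsilon>) \<omega>" for k \<omega>
  define A where "A k \<omega> = (of_bool (alive (1 + \<delta>) x \<epsilon> k \<omega>) :: real)" for k \<omega>
  define \<kappa> where "\<kappa> = (1 + 74 * step_const \<delta>) * sqrt \<epsilon> ^ 3"
  define h where "h = 3 * bound * \<delta>"
  have [measurable]: "X k \<in> borel_measurable M" for k
    unfolding X_def[abs_def] using \<epsilon> by measurable
  have [measurable]: "A k \<in> borel_measurable M" for k
    unfolding A_def[abs_def] using pred_alive[OF \<epsilon>(1)] by measurable
  have A: "0 \<le> A k \<omega>" "A k \<omega> \<le> 1" "A (Suc k) \<omega> \<le> A k \<omega>" for k \<omega>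
    by (auto simp: A_def alive_def of_bool_def)
  have int: "integrable M (\<lambda>\<omega>. F \<omega>)" if [measurable]: "F \<in> borel_measurable M" and "\<And>\<omega>. \<bar>F \<omega>\<bar> \<le> 1" for F :: "'w \<Rightarrow> real"
    by (rule integrable_const_bound[where B = 1]) (use that in auto)
  have avoidance_abs: "\<bar>avoidance y\<bar> \<le> 1" for y :: "real ^ 4"
    using avoidance_range[of y] by simp
  have b1: "\<bar>a * b\<bar> \<le> 1" if "0 \<le> a" "a \<le> 1" "0 \<le> b" "b \<le> 1" for a b :: real
    using mult_mono[of a 1 b 1] that by simp
  have intA: "integrable M (A k)" for k using A by (intro int) auto
  have intAv: "integrable M (\<lambda>\<omega>. A j \<omega> * avoidance (X k \<omega>))" for j k
    by (intro int b1 A avoidance_range) measurable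
  have intAs: "integrable M (\<lambda>\<omega>. A j \<omega> * source (X k \<omega>))" for j k
    by (intro int b1 A source_range) measurable
  \<comment> \<open>One step splits the discounted value \<open>D k\<close> into \<open>R k\<close>,
    from paths stopped at step \<open>k\<close>, \<open>I k\<close>, from killing during the step,
    and \<open>D (Suc k)\<close>, up to the error \<open>\<kappa>\<close>.\<close>
  define D where "D k = q ^ k * expectation (\<lambda>\<omega>. A k \<omega> * avoidance (X k \<omega>))" for k
  define I where "I k = q ^ k * (1 - q) * expectation (\<lambda>\<omega>. A (Suc k) \<omega> * source (X k \<omega>))" for k
  define R where "R k = q ^ k * expectation (\<lambda>\<omega>. (A k \<omega> - A (Suc k) \<omega>) * avoidance (X k \<omega>))" for k
  define p where "p k = expectation (A k)" for k
  have R: "0 \<le> R k" "R k \<le> h * (p k - p (Suc k))" for k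
  proof -
    show "0 \<le> R k"
      unfolding R_def using A avoidance_range q by (intro mult_nonneg_nonneg Bochner_Integration.integral_nonneg) auto
    have "expectation (\<lambda>\<omega>. (A k \<omega> - A (Suc k) \<omega>) * avoidance (X k \<omega>)) \<le> expectation (\<lambda>\<omega>. (A k \<omega> - A (Suc k) \<omega>) * h)"
    proof (intro integral_mono)
      fix \<omega>
      show "(A k \<omega> - A (Suc k) \<omega>) * avoidance (X k \<omega>) \<le> (A k \<omega> - A (Suc k) \<omega>) * h"
      proof (cases "A k \<omega> = A (Suc k) \<omega>")
        case False
        then have "norm (X k \<omega>) \<le> 1 + \<delta>"
          by (auto simp: A_def alive_def X_def of_bool_def less_Suc_eq split: if_splits)
        then have "avoidance (X k \<omega>) \<le> h" unfolding h_def using \<delta> by (intro avoidance_near_ball) auto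
        then show ?thesis using A(3)[of k \<omega>] by (intro mult_left_mono) auto
      qed simp
    qed (use intA intAv in \<open>auto simp: left_diff_distrib\<close>)
    also have "\<dots> = h * (p k - p (Suc k))"
      unfolding p_def using intA by (simp add: mult.commute)
    finally have "expectation (\<lambda>\<omega>. (A k \<omega> - A (Suc k) \<omega>) * avoidance (X k \<omega>)) \<le> h * (p k - p (Suc k))" .
    moreover have "R k \<le> 1 * expectation (\<lambda>\<omega>. (A k \<omega> - A (Suc k) \<omega>) * avoidance (X k \<omega>))"
      unfolding R_def using A avoidance_range q
      by (intro mult_right_mono Bochner_Integration.integral_nonneg mult_nonneg_nonneg) auto
    ultimately show "R k \<le> h * (p k - p (Suc k))" by linarith
  qed
  have step: "\<bar>D k - (R k + I k + D (Suc k))\<bar> \<le> \<kappa>" for k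
  proof -
    define G where "G y = expectation (\<lambda>\<omega>'. avoidance (y + increment \<epsilon> k \<omega>'))" for y
    have gv: "gaussian_vector M (increment \<epsilon> k) (sqrt \<epsilon>)"
    proof -
      have "real (Suc k) * \<epsilon> - real k * \<epsilon> = \<epsilon>" by (simp add: algebra_simps)
      then show ?thesis
        using gaussian_increment[of "real k * \<epsilon>" "real (Suc k) * \<epsilon>"] \<epsilon> by (simp add: increment_def[abs_def])
    qed
    then interpret inc: gaussian_vector M "increment \<epsilon> k" "sqrt \<epsilon>" .
    have [measurable]: "G \<in> borel_measurable borel"
      unfolding G_def by measurable
    have G01: "0 \<le> G y" "G y \<le> 1" for y
    proof -
      show "0 \<le> G y" unfolding G_def by (intro Bochner_Integration.integral_nonneg avoidance_range)
      have "G y \<le> expectation (\<lambda>_. 1)" unfolding G_def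
        by (intro integral_mono int) (auto simp: avoidance_abs avoidance_range)
      then show "G y \<le> 1" by (simp add: prob_space)
    qed
    have intG: "integrable M (\<lambda>\<omega>. A (Suc k) \<omega> * G (X k \<omega>))"
      by (intro int b1 A G01) measurable
    have "expectation (\<lambda>\<omega>. A (Suc k) \<omega> * avoidance (X (Suc k) \<omega>)) = expectation (\<lambda>\<omega>. A (Suc k) \<omega> * G (X k \<omega>))"
      unfolding A_def X_def G_def by (rule markov_step[OF \<epsilon>(1), where B = 1]) (auto simp: avoidance_abs)
    then have D': "D (Suc k) = q ^ k * expectation (\<lambda>\<omega>. q * (A (Suc k) \<omega> * G (X k \<omega>)))"
      by (simp add: D_def)
    have pw: "\<bar>A (Suc k) \<omega> * avoidance (X k \<omega>) - (1 - q) * (A (Suc k) \<omega> * source (X k \<omega>))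
        - q * (A (Suc k) \<omega> * G (X k \<omega>))\<bar> \<le> \<kappa>" for \<omega>
    proof (cases "alive (1 + \<delta>) x \<epsilon> (Suc k) \<omega>")
      case True
      then have "1 + \<delta> \<le> norm (X k \<omega>)" by (auto simp: alive_def X_def intro: less_imp_le)
      moreover have "sqrt \<epsilon> \<le> 1" using \<epsilon> by simp
      ultimately show ?thesis
        using gaussian_step[OF gv _ \<delta>, of "X k \<omega>"] True \<epsilon>
        by (simp add: A_def G_def q_def \<kappa>_def abs_le_iff)
    next
      case False
      then show ?thesis using step_const_nonneg[OF \<delta>(1)] \<epsilon> by (simp add: A_def \<kappa>_def)
    qed
    have "D k - (R k + I k + D (Suc k)) = q ^ k * (expectation (\<lambda>\<omega>. A (Suc k) \<omega> * avoidance (X k \<omega>))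
        - (1 - q) * expectation (\<lambda>\<omega>. A (Suc k) \<omega> * source (X k \<omega>))
        - expectation (\<lambda>\<omega>. q * (A (Suc k) \<omega> * G (X k \<omega>))))"
      unfolding D' unfolding D_def R_def I_def left_diff_distrib using intAv by (simp add: algebra_simps)
    also have "\<dots> = q ^ k * expectation (\<lambda>\<omega>. A (Suc k) \<omega> * avoidance (X k \<omega>)
        - (1 - q) * (A (Suc k) \<omega> * source (X k \<omega>)) - q * (A (Suc k) \<omega> * G (X k \<omega>)))"
      using intAv intAs intG by simp
    finally have "\<bar>D k - (R k + I k + D (Suc k))\<bar> = q ^ k * \<bar>expectation (\<lambda>\<omega>. A (Suc k) \<omega> * avoidance (X k \<omega>)
        - (1 - q) * (A (Suc k) \<omega> * source (X k \<omega>)) - q * (A (Suc k) \<omega> * G (X k \<omega>)))\<bar>"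
      using q by (simp add: abs_mult)
    also have "\<dots> \<le> 1 * expectation (\<lambda>\<omega>. \<kappa>)"
      using q intAv intAs intG pw
      by (intro mult_mono order_trans[OF integral_abs_bound] integral_mono) auto
    finally show ?thesis by (simp add: prob_space)
  qed
  \<comment> \<open>Subtracting \<open>h * p\<close> makes the stopping terms telescope, since
    \<open>R k \<le> h * (p k - p (Suc k))\<close>; their total is at most \<open>h\<close>, however
    many steps there are.\<close>
  have upper: "D 0 - h * p 0 \<le> (\<Sum>k<K. I k) + (D K - h * p K) + real K * \<kappa>"
  proof (induction K)
    case (Suc K)
    have "D K - h * p K \<le> I K + (D (Suc K) - h * p (Suc K)) + \<kappa>"
      using step[of K] R(2)[of K] unfolding right_diff_distrib by linarith
    then show ?case using Suc by (simp add: algebra_simps)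
  qed simp
  have lower: "(\<Sum>k<K. I k) + D K - real K * \<kappa> \<le> D 0"
  proof (induction K)
    case (Suc K)
    have "I K + D (Suc K) - \<kappa> \<le> D K" using step[of K] R(1)[of K] by linarith
    then show ?case using Suc by (simp add: algebra_simps)
  qed simp
  have "expectation (\<lambda>\<omega>. avoidance (x + W 0 \<omega>)) = expectation (\<lambda>\<omega>. avoidance x)"
    by (rule Bochner_Integration.integral_cong) (auto simp: W_0)
  then have D0: "D 0 = avoidance x" by (simp add: D_def A_def X_def alive_def prob_space)
  have "0 \<le> expectation (\<lambda>\<omega>. A K \<omega> * avoidance (X K \<omega>))"
    using A avoidance_range by (intro Bochner_Integration.integral_nonneg mult_nonneg_nonneg) auto
  moreover have "expectation (\<lambda>\<omega>. A K \<omega> * avoidance (X K \<omega>)) \<le> expectation (\<lambda>_. 1)"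
    using b1[OF A(1,2) avoidance_range] by (intro integral_mono intAv) (auto simp: abs_le_iff)
  ultimately have DK: "0 \<le> D K" "D K \<le> q ^ K"
    unfolding D_def using q mult_left_mono[of _ 1 "q ^ K"] by (auto simp: prob_space)
  have h0: "0 \<le> h" using bound_ge \<delta> by (simp add: h_def)
  have p: "0 \<le> p k" "p k \<le> 1" for k
  proof -
    show "0 \<le> p k" unfolding p_def using A by (intro Bochner_Integration.integral_nonneg) auto
    have "p k \<le> expectation (\<lambda>_. 1)" unfolding p_def using A intA by (intro integral_mono) auto
    then show "p k \<le> 1" by (simp add: prob_space)
  qed
  have S: "S = (\<Sum>k<K. I k)" by (simp add: S_def I_def q_def A_def X_def)
  have err: "err = real K * \<kappa>" by (simp add: err_def \<kappa>_def)
  show "S - err \<le> avoidance x" using lower DK by (simp add: S err D0)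
  have "h * p 0 \<le> h * 1" "0 \<le> h * p K" using mult_left_mono[OF p(2) h0] mult_nonneg_nonneg[OF h0 p(1)] by auto
  then show "avoidance x \<le> S + 3 * bound * \<delta> + exp (- \<epsilon>) ^ K + err"
    using upper DK unfolding S err D0 h_def[symmetric] q_def[symmetric] by linarith
qed

end

subsection \<open>The avoidance probability as the value of a killed Brownian motion\<close>

lemma exponential_cell:
  assumes "a < b"
  shows "has_bochner_integral lborel (\<lambda>s. indicator {a..<b} s * exp (- s)) (exp (- a) - exp (- b :: real))"
proof -
  have "has_bochner_integral lborel (\<lambda>s. exp (- s) * indicator {a..b} s) (- exp (- b) - (- exp (- a)))"
    by (rule has_bochner_integral_FTC_Icc_real) (use assms in \<open>auto intro!: derivative_eq_intros continuous_intros\<close>)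
  then have "has_bochner_integral lborel (\<lambda>s. exp (- s) * indicator {a..b} s) (exp (- a) - exp (- b))"
    by simp
  moreover have "AE s in lborel. exp (- s) * indicator {a..b} s = indicator {a..<b} s * exp (- s)"
    using AE_lborel_singleton[of b] by eventually_elim (auto simp: indicator_def)
  ultimately show ?thesis
    by (subst has_bochner_integral_cong_AE[symmetric, of "\<lambda>s. exp (- s) * indicator {a..b} s"]) auto
qed

text \<open>The weight of index \<open>k\<close> is the probability that an exponential time of mean
  \<open>1\<close> falls into the grid cell from \<open>k * \<epsilon>\<close> to
  \<open>(k + 1) * \<epsilon>\<close>.\<close>

lemma geometric_sum_eq_integral:
  fixes a :: "nat \<Rightarrow> real" and m :: nat
  defines "\<epsilon> \<equiv> 1 / 2 ^ m :: real"
  shows "(\<Sum>k<K. exp (- \<epsilon>) ^ k * (1 - exp (- \<epsilon>)) * a k) =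
    (\<integral>s. exponential_density 1 s * (of_bool (s < real K * \<epsilon>) * a (nat \<lfloor>s * 2 ^ m\<rfloor>)) \<partial>lborel)"
proof -
  have \<epsilon>: "0 < \<epsilon>" by (simp add: \<epsilon>_def)
  have "has_bochner_integral lborel
      (\<lambda>s. exponential_density 1 s * (of_bool (s < real K * \<epsilon>) * a (nat \<lfloor>s * 2 ^ m\<rfloor>)))
      (\<Sum>k<K. exp (- \<epsilon>) ^ k * (1 - exp (- \<epsilon>)) * a k)"
  proof (induction K)
    case 0
    have eq: "(\<lambda>s. exponential_density 1 s * (of_bool (s < real 0 * \<epsilon>) * a (nat \<lfloor>s * 2 ^ m\<rfloor>))) = (\<lambda>_. 0)"
      by (auto simp: fun_eq_iff exponential_density_def)
    show ?case by (simp only: eq lessThan_0 sum.empty has_bochner_integral_zero)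
  next
    case (Suc K)
    have "has_bochner_integral lborel (\<lambda>s. a K * (indicator {real K * \<epsilon>..<real (Suc K) * \<epsilon>} s * exp (- s)))
        (a K * (exp (- (real K * \<epsilon>)) - exp (- (real (Suc K) * \<epsilon>))))"
      by (intro has_bochner_integral_mult_right exponential_cell) (use \<epsilon> in \<open>auto simp: algebra_simps\<close>)
    moreover have "exp (- (real k * \<epsilon>)) = exp (- \<epsilon>) ^ k" for k
      using exp_of_nat_mult[of k "- \<epsilon>"] by simp
    then have "a K * (exp (- (real K * \<epsilon>)) - exp (- (real (Suc K) * \<epsilon>))) =
        exp (- \<epsilon>) ^ K * (1 - exp (- \<epsilon>)) * a K"
      by (simp only: power_Suc) (simp add: algebra_simps)
    moreover have "a K * (indicator {real K * \<epsilon>..<real (Suc K) * \<epsilon>} s * exp (- s))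
        = exponential_density 1 s * (of_bool (s < real (Suc K) * \<epsilon>) * a (nat \<lfloor>s * 2 ^ m\<rfloor>))
          - exponential_density 1 s * (of_bool (s < real K * \<epsilon>) * a (nat \<lfloor>s * 2 ^ m\<rfloor>))" for s
    proof (cases "s \<in> {real K * \<epsilon>..<real (Suc K) * \<epsilon>}")
      case True
      then have "real K \<le> s * 2 ^ m" "s * 2 ^ m < real K + 1"
        by (auto simp: \<epsilon>_def field_simps)
      then have "\<lfloor>s * 2 ^ m\<rfloor> = int K" by (intro floor_unique) auto
      moreover have "0 \<le> s" using True \<epsilon> by (auto intro: order_trans[rotated])
      ultimately show ?thesis using True by (auto simp: exponential_density_def)
    next
      case False
      moreover have "real K * \<epsilon> \<le> real (Suc K) * \<epsilon>" using \<epsilon> by (intro mult_right_mono) auto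
      ultimately have "(s < real (Suc K) * \<epsilon>) = (s < real K * \<epsilon>)" by auto
      with False show ?thesis by (simp only: indicator_def) simp
    qed
    ultimately have "has_bochner_integral lborel
        (\<lambda>s. exponential_density 1 s * (of_bool (s < real (Suc K) * \<epsilon>) * a (nat \<lfloor>s * 2 ^ m\<rfloor>))
          - exponential_density 1 s * (of_bool (s < real K * \<epsilon>) * a (nat \<lfloor>s * 2 ^ m\<rfloor>)))
        (exp (- \<epsilon>) ^ K * (1 - exp (- \<epsilon>)) * a K)"
      by (simp only:)
    from has_bochner_integral_add[OF Suc this] show ?case by (simp add: algebra_simps)
  qed
  then show ?thesis by (rule has_bochner_integral_integral_eq[symmetric])
qed

lemma exponential_density_nonneg: "0 \<le> exponential_density 1 s"
  by (simp add: exponential_density_def)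

lemma integrable_exponential_density: "integrable lborel (exponential_density 1)"
proof -
  interpret prob_space "density lborel (exponential_density 1)"
    by (rule prob_space_exponential_density) simp
  have "integrable (density lborel (exponential_density 1)) (\<lambda>_. 1 :: real)" by simp
  then show ?thesis
    by (subst (asm) integrable_density) (auto simp: exponential_density_nonneg)
qed

lemma integral_exponential_density: "(\<integral>s. exponential_density 1 s \<partial>lborel) = 1"
proof -
  interpret E: prob_space "density lborel (exponential_density 1)"
    by (rule prob_space_exponential_density) simp
  have "(\<integral>s. 1 \<partial>density lborel (exponential_density 1)) = (\<integral>s. exponential_density 1 s *\<^sub>R (1 :: real) \<partial>lborel)"
    by (rule integral_density) (auto simp: exponential_density_nonneg)
  then show ?thesis using E.prob_space by simp
qed

lemma of_bool_times_abs_le: "\<bar>g y\<bar> \<le> (1 :: real) \<Longrightarrow> \<bar>of_bool P * g y\<bar> \<le> 1"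
  by (simp add: of_bool_def)

lemma integral_exponential_mono:
  assumes "\<And>s. 0 \<le> s \<Longrightarrow> g s \<le> h s"
    and [measurable]: "g \<in> borel_measurable borel" "h \<in> borel_measurable borel"
    and "\<And>s. \<bar>g s\<bar> \<le> 1" "\<And>s. \<bar>h s\<bar> \<le> 1"
  shows "(\<integral>s. exponential_density 1 s * g s \<partial>lborel) \<le> (\<integral>s. exponential_density 1 s * h s \<partial>lborel)"
proof (rule integral_mono)
  have "integrable lborel (\<lambda>s. exponential_density 1 s * k s)" if [measurable]: "k \<in> borel_measurable borel"
    and "\<And>s. \<bar>k s\<bar> \<le> 1" for k :: "real \<Rightarrow> real"
    by (rule Bochner_Integration.integrable_bound[OF integrable_exponential_density])
      (use that in \<open>auto intro!: AE_I2 mult_left_le simp: abs_mult\<close>)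
  then show "integrable lborel (\<lambda>s. exponential_density 1 s * g s)" "integrable lborel (\<lambda>s. exponential_density 1 s * h s)"
    using assms by auto
  show "exponential_density 1 s * g s \<le> exponential_density 1 s * h s" for s
    using assms(1)[of s] by (simp add: exponential_density_def)
qed

lemma (in prob_space) exponential_dominated_convergence:
  fixes F :: "nat \<Rightarrow> real \<Rightarrow> 'a \<Rightarrow> real"
  assumes F: "\<And>m. (\<lambda>(s, \<omega>). F m s \<omega>) \<in> borel_measurable (borel \<Otimes>\<^sub>M M)"
    and G: "(\<lambda>(s, \<omega>). G s \<omega>) \<in> borel_measurable (borel \<Otimes>\<^sub>M M)"
    and bd: "\<And>m s \<omega>. \<bar>F m s \<omega>\<bar> \<le> 1"
    and lim: "\<And>s \<omega>. 0 \<le> s \<Longrightarrow> \<omega> \<in> space M \<Longrightarrow> (\<lambda>m. F m s \<omega>) \<longlonglongrightarrow> G s \<omega>"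
  shows "(\<lambda>m. \<integral>s. exponential_density 1 s * expectation (F m s) \<partial>lborel)
    \<longlonglongrightarrow> (\<integral>s. exponential_density 1 s * expectation (G s) \<partial>lborel)"
proof (rule integral_dominated_convergence[where w = "exponential_density 1"])
  have Fs: "F m s \<in> borel_measurable M" for m s
    using measurable_compose[OF measurable_Pair1' F, of s] by simp
  have Gs: "G s \<in> borel_measurable M" for s
    using measurable_compose[OF measurable_Pair1' G, of s] by simp
  have [measurable]: "(\<lambda>s. expectation (F m s)) \<in> borel_measurable borel" for m
    by (rule borel_measurable_lebesgue_integral) (rule F)
  have [measurable]: "(\<lambda>s. expectation (G s)) \<in> borel_measurable borel"
    by (rule borel_measurable_lebesgue_integral) (rule G)
  show "(\<lambda>s. exponential_density 1 s * expectation (F m s)) \<in> borel_measurable lborel" for m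
    by measurable
  show "(\<lambda>s. exponential_density 1 s * expectation (G s)) \<in> borel_measurable lborel"
    by measurable
  show "AE s in lborel. (\<lambda>m. exponential_density 1 s * expectation (F m s)) \<longlonglongrightarrow>
      exponential_density 1 s * expectation (G s)"
  proof (intro AE_I2)
    fix s :: real
    show "(\<lambda>m. exponential_density 1 s * expectation (F m s)) \<longlonglongrightarrow> exponential_density 1 s * expectation (G s)"
    proof (cases "s < 0")
      case False
      have "(\<lambda>m. expectation (F m s)) \<longlonglongrightarrow> expectation (G s)"
        by (rule integral_dominated_convergence[where w = "\<lambda>_. 1"]) (use Fs Gs bd lim False in auto)
      then show ?thesis by (intro tendsto_intros)
    qed (simp add: exponential_density_def)
  qed
  show "AE s in lborel. norm (exponential_density 1 s * expectation (F m s)) \<le> exponential_density 1 s" for m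
  proof (intro AE_I2)
    fix s :: real
    have "\<bar>expectation (F m s)\<bar> \<le> expectation (\<lambda>_. 1)"
      by (intro order_trans[OF integral_abs_bound] integral_mono integrable_abs integrable_const_bound[where B = 1])
        (use Fs bd in auto)
    then show "norm (exponential_density 1 s * expectation (F m s)) \<le> exponential_density 1 s"
      using mult_left_mono[of "\<bar>expectation (F m s)\<bar>" 1 "exponential_density 1 s"] exponential_density_nonneg[of s]
      by (simp add: abs_mult prob_space)
  qed
qed (rule integrable_exponential_density)

text \<open>The time horizon \<open>m\<close> takes \<open>m * 2^m\<close> steps of length
  \<open>2^(- m)\<close>, each with an error of order \<open>2^(- 3 m / 2)\<close>; the total is of
  order \<open>m * 2^(- m / 2)\<close>.\<close>

lemma error_tendsto_0: "(\<lambda>m. real (m * 2 ^ m) * (c * sqrt (1 / 2 ^ m) ^ 3)) \<longlonglongrightarrow> 0"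
proof -
  have "real (m * 2 ^ m) * (c * sqrt (1 / 2 ^ m) ^ 3) = c * (real m * sqrt (1 / 2) ^ m)" for m
  proof -
    define r where "r = sqrt (1 / 2) ^ m"
    have "sqrt (1 / 2 ^ m) = r"
      unfolding r_def by (simp only: real_sqrt_power[symmetric] power_one_over)
    moreover have "r\<^sup>2 = 1 / 2 ^ m"
      unfolding r_def by (simp add: power_one_over flip: power_mult_distrib power2_eq_square power_mult)
        (simp add: power_mult mult.commute[of m] power_one_over)
    then have "r ^ 3 = 1 / 2 ^ m * r" by (simp add: power3_eq_cube power2_eq_square)
    ultimately show ?thesis by (simp add: r_def)
  qed
  moreover have "(\<lambda>m. c * (real m * sqrt (1 / 2) ^ m)) \<longlonglongrightarrow> c * 0"
    by (intro tendsto_intros lim_n_over_pown powser_times_n_limit_0) (simp add: real_sqrt_divide)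
  ultimately show ?thesis by (simp only: mult_zero_right)
qed

context killed_brownian_motion
begin

section \<open>Passage from the skeleton to continuous time\<close>

definition killed_value :: "real \<Rightarrow> real ^ 4 \<Rightarrow> real" where
  "killed_value \<rho> x = (\<integral>s. exponential_density 1 s *
     expectation (\<lambda>\<omega>. of_bool (avoids \<rho> s x (\<lambda>t. W t \<omega>)) * source (x + W (max 0 s) \<omega>)) \<partial>lborel)"

text \<open>The sum of \<open>skeleton_bounds\<close> with mesh \<open>2^(- m)\<close> and horizon
  \<open>m\<close>; with both tied to one parameter, a single limit refines the mesh and removes the
  horizon.\<close>

definition skeleton_value :: "real \<Rightarrow> real ^ 4 \<Rightarrow> nat \<Rightarrow> real" where
  "skeleton_value \<rho> x m = (\<Sum>k<m * 2 ^ m. exp (- (1 / 2 ^ m)) ^ k * (1 - exp (- (1 / 2 ^ m))) *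
    expectation (\<lambda>\<omega>. of_bool (alive \<rho> x (1 / 2 ^ m) (Suc k) \<omega>) * source (x + W (real k * (1 / 2 ^ m)) \<omega>)))"

definition dyadic_index :: "nat \<Rightarrow> real \<Rightarrow> nat" where
  "dyadic_index m s = nat \<lfloor>s * 2 ^ m\<rfloor>"

lemma dyadic_index_eq:
  "0 \<le> s \<Longrightarrow> real (dyadic_index m s) * (1 / 2 ^ m) = real_of_int \<lfloor>s * 2 ^ m\<rfloor> / 2 ^ m"
  by (simp add: dyadic_index_def)

lemma dyadic_index_mono: "r \<le> s \<Longrightarrow> dyadic_index m r \<le> dyadic_index m s"
  unfolding dyadic_index_def by (intro nat_mono floor_mono mult_right_mono) auto

lemma measurable_dyadic_index [measurable]: "dyadic_index m \<in> measurable borel (count_space UNIV)"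
proof -
  have "(\<lambda>s::real. s * 2 ^ m) \<in> borel_measurable borel" by measurable
  from measurable_compose[OF this measurable_real_floor]
  have "(\<lambda>s::real. \<lfloor>s * 2 ^ m\<rfloor>) \<in> measurable borel (count_space UNIV)" .
  from measurable_compose[OF this, of nat "count_space UNIV"]
  show ?thesis unfolding dyadic_index_def[abs_def] by simp
qed

lemma skeleton_value_eq_integral:
  "skeleton_value \<rho> x m = (\<integral>s. exponential_density 1 s *
    expectation (\<lambda>\<omega>. of_bool (s < real m) * (of_bool (alive \<rho> x (1 / 2 ^ m) (Suc (dyadic_index m s)) \<omega>) *
      source (x + W (real (dyadic_index m s) * (1 / 2 ^ m)) \<omega>))) \<partial>lborel)"
  unfolding skeleton_value_def geometric_sum_eq_integral dyadic_index_def by simp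

lemma measurable_dyadic_W:
  "(\<lambda>(s, \<omega>). W (real (dyadic_index m s) * (1 / 2 ^ m)) \<omega>) \<in> borel_measurable (borel \<Otimes>\<^sub>M M)"
proof -
  have "(\<lambda>p. W (real (dyadic_index m (fst p)) * (1 / 2 ^ m)) (snd p)) \<in> borel_measurable (borel \<Otimes>\<^sub>M M)"
  proof (rule measurable_compose_countable[where f = "\<lambda>k p. W (real k * (1 / 2 ^ m)) (snd p)"])
    show "(\<lambda>p. W (real k * (1 / 2 ^ m)) (snd p)) \<in> borel_measurable (borel \<Otimes>\<^sub>M M)" for k
      by (rule measurable_compose[OF measurable_snd measurable_W_mult]) simp
  qed measurable
  then show ?thesis by (simp add: case_prod_beta)
qed

lemma pred_dyadic_alive:
  "Measurable.pred (borel \<Otimes>\<^sub>M M) (\<lambda>(s, \<omega>). alive \<rho> x (1 / 2 ^ m) (Suc (dyadic_index m s)) \<omega>)"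
proof -
  have "Measurable.pred (borel \<Otimes>\<^sub>M M) (\<lambda>p. alive \<rho> x (1 / 2 ^ m) (Suc (dyadic_index m (fst p))) (snd p))"
  proof (rule measurable_compose_countable[where f = "\<lambda>k p. alive \<rho> x (1 / 2 ^ m) (Suc k) (snd p)"])
    show "Measurable.pred (borel \<Otimes>\<^sub>M M) (\<lambda>p. alive \<rho> x (1 / 2 ^ m) (Suc k) (snd p))" for k
      by (rule measurable_compose[OF measurable_snd pred_alive]) simp
  qed measurable
  then show ?thesis by (simp add: case_prod_beta)
qed

lemma pred_avoids_joint:
  "Measurable.pred (borel \<Otimes>\<^sub>M M) (\<lambda>(s, \<omega>). avoids \<rho> s x (\<lambda>t. W t \<omega>))"
  using pred_avoids[of fst "borel \<Otimes>\<^sub>M M" "\<lambda>_. x" snd \<rho>] by (simp add: case_prod_beta)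

lemma tendsto_source_dyadic:
  assumes "0 \<le> s" "\<omega> \<in> space M"
  shows "(\<lambda>m. source (x + W (real (dyadic_index m s) * (1 / 2 ^ m)) \<omega>)) \<longlonglongrightarrow> source (x + W (max 0 s) \<omega>)"
proof -
  have "(\<lambda>m. W (real (dyadic_index m s) * (1 / 2 ^ m)) \<omega>) \<longlonglongrightarrow> W (max 0 s) \<omega>"
    unfolding dyadic_index_eq[OF assms(1)] using tendsto_dyadic[OF assms(2,1)] assms(1) by simp
  then have "(\<lambda>m. x + W (real (dyadic_index m s) * (1 / 2 ^ m)) \<omega>) \<longlonglongrightarrow> x + W (max 0 s) \<omega>"
    by (intro tendsto_intros)
  then show ?thesis
    by (rule continuous_on_tendsto_compose[OF continuous_on_source]) auto
qed

lemma of_bool_source_abs: "\<bar>of_bool P * source (y :: real ^ 4)\<bar> \<le> 1"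
  using source_range[of y] by (simp add: of_bool_def)

lemma measurable_event_source:
  assumes [measurable]: "Measurable.pred (borel \<Otimes>\<^sub>M M) (\<lambda>(s, \<omega>). E s \<omega>)"
  shows "(\<lambda>(s, \<omega>). of_bool (E s \<omega>) * source (x + W (real (dyadic_index m s) * (1 / 2 ^ m)) \<omega>))
    \<in> borel_measurable (borel \<Otimes>\<^sub>M M)"
proof -
  note [measurable] = measurable_dyadic_W
  have "(\<lambda>p. of_bool (case p of (s, \<omega>) \<Rightarrow> E s \<omega>) *
      source (x + (case p of (s, \<omega>) \<Rightarrow> W (real (dyadic_index m s) * (1 / 2 ^ m)) \<omega>))) \<in> borel_measurable (borel \<Otimes>\<^sub>M M)"
    by measurable
  then show ?thesis by (simp add: case_prod_beta)
qed

lemma measurable_event_expectation: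
  assumes "Measurable.pred (borel \<Otimes>\<^sub>M M) (\<lambda>(s, \<omega>). E s \<omega>)"
  shows "(\<lambda>s. expectation (\<lambda>\<omega>. of_bool (E s \<omega>) * source (x + W (real (dyadic_index m s) * (1 / 2 ^ m)) \<omega>)))
    \<in> borel_measurable borel"
  by (rule borel_measurable_lebesgue_integral[OF measurable_event_source[OF assms]])

lemma measurable_killed_integrand:
  "(\<lambda>(s, \<omega>). of_bool (avoids \<rho> s x (\<lambda>t. W t \<omega>)) * source (x + W (max 0 s) \<omega>))
    \<in> borel_measurable (borel \<Otimes>\<^sub>M M)"
proof -
  note [measurable] = pred_avoids_joint measurable_joint
  have "(\<lambda>p. of_bool (case p of (s, \<omega>) \<Rightarrow> avoids \<rho> s x (\<lambda>t. W t \<omega>)) *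
      source (x + (case p of (s, \<omega>) \<Rightarrow> W (max 0 s) \<omega>))) \<in> borel_measurable (borel \<Otimes>\<^sub>M M)"
    by measurable
  then show ?thesis by (simp add: case_prod_beta)
qed

text \<open>The events \<open>E m\<close> only have to agree with avoidance from some
  \<open>m\<close> on, which may depend on \<open>s\<close> and \<open>\<omega>\<close>. This
  freedom permits modified events that contain, or are contained in, survival of the skeleton for
  every \<open>m\<close>.\<close>

lemma limit_of_events:
  assumes E: "\<And>m. Measurable.pred (borel \<Otimes>\<^sub>M M) (\<lambda>(s, \<omega>). E m s \<omega>)"
    and ev: "\<And>s \<omega>. 0 \<le> s \<Longrightarrow> \<omega> \<in> space M \<Longrightarrow> \<forall>\<^sub>F m in sequentially. E m s \<omega> = avoids \<rho> s x (\<lambda>t. W t \<omega>)"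
  shows "(\<lambda>m. \<integral>s. exponential_density 1 s * expectation (\<lambda>\<omega>. of_bool (E m s \<omega>) *
      source (x + W (real (dyadic_index m s) * (1 / 2 ^ m)) \<omega>)) \<partial>lborel) \<longlonglongrightarrow> killed_value \<rho> x"
  unfolding killed_value_def
proof (rule exponential_dominated_convergence)
  show "(\<lambda>m. of_bool (E m s \<omega>) * source (x + W (real (dyadic_index m s) * (1 / 2 ^ m)) \<omega>))
      \<longlonglongrightarrow> of_bool (avoids \<rho> s x (\<lambda>t. W t \<omega>)) * source (x + W (max 0 s) \<omega>)"
    if "0 \<le> s" "\<omega> \<in> space M" for s \<omega>
  proof (intro tendsto_mult tendsto_source_dyadic that tendsto_eventually)
    show "\<forall>\<^sub>F m in sequentially. of_bool (E m s \<omega>) = (of_bool (avoids \<rho> s x (\<lambda>t. W t \<omega>)) :: real)"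
      using ev[OF that] by eventually_elim simp
  qed
qed (rule measurable_event_source[OF E] measurable_killed_integrand of_bool_source_abs)+

lemma expectation_event_mono:
  fixes Y :: "'w \<Rightarrow> real ^ 4"
  assumes "\<And>\<omega>. P \<omega> \<Longrightarrow> Q \<omega>" and [measurable]: "Measurable.pred M P" "Measurable.pred M Q" "Y \<in> borel_measurable M"
  shows "expectation (\<lambda>\<omega>. of_bool (P \<omega>) * source (Y \<omega>)) \<le> expectation (\<lambda>\<omega>. of_bool (Q \<omega>) * source (Y \<omega>))"
proof (rule integral_mono)
  show "integrable M (\<lambda>\<omega>. of_bool (P \<omega>) * source (Y \<omega>))" "integrable M (\<lambda>\<omega>. of_bool (Q \<omega>) * source (Y \<omega>))"
    by (rule integrable_const_bound[where B = 1]; simp add: of_bool_source_abs)+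
qed (use assms(1) source_range in \<open>auto simp: of_bool_def\<close>)

lemma expectation_event_abs: 
  fixes Y :: "'w \<Rightarrow> real ^ 4"
  shows "\<bar>expectation (\<lambda>\<omega>. of_bool (P \<omega>) * source (Y \<omega>))\<bar> \<le> 1"
proof (cases "integrable M (\<lambda>\<omega>. of_bool (P \<omega>) * source (Y \<omega>))")
  case True
  have "\<bar>expectation (\<lambda>\<omega>. of_bool (P \<omega>) * source (Y \<omega>))\<bar> \<le> expectation (\<lambda>_. 1)"
    by (intro order_trans[OF integral_abs_bound] integral_mono integrable_abs True) (auto simp: of_bool_source_abs)
  then show ?thesis by (simp add: prob_space)
qed (simp add: not_integrable_integral_eq)

definition alive_until :: "real \<Rightarrow> real ^ 4 \<Rightarrow> nat \<Rightarrow> real \<Rightarrow> 'w \<Rightarrow> bool" where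
  "alive_until \<rho> x m s \<omega> \<longleftrightarrow> s < real m \<and> alive \<rho> x (1 / 2 ^ m) (Suc (dyadic_index m s)) \<omega>"

lemma pred_alive_until: "Measurable.pred (borel \<Otimes>\<^sub>M M) (\<lambda>(s, \<omega>). alive_until \<rho> x m s \<omega>)"
proof -
  note [measurable] = pred_dyadic_alive
  have "Measurable.pred (borel \<Otimes>\<^sub>M M) (\<lambda>p. fst p < real m \<and>
      (case p of (s, \<omega>) \<Rightarrow> alive \<rho> x (1 / 2 ^ m) (Suc (dyadic_index m s)) \<omega>))"
    by measurable
  then show ?thesis by (simp add: alive_until_def case_prod_beta)
qed

lemma pred_slice:
  fixes s :: real
  assumes "Measurable.pred (borel \<Otimes>\<^sub>M M) (\<lambda>(s, \<omega>). E s \<omega>)"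
  shows "Measurable.pred M (E s)"
proof -
  have "s \<in> space borel" by simp
  from measurable_compose[OF measurable_Pair1'[OF this] assms] show ?thesis by simp
qed

text \<open>A path that avoids the radius \<open>1 + \<delta>\<close> does so at all grid times, so
  the value over such paths is at most the skeleton value, to which the lower half of
  \<open>skeleton_bounds\<close> applies.\<close>

lemma avoidance_ge_killed_value:
  assumes \<delta>: "0 < \<delta>" "\<delta> \<le> 1"
  shows "killed_value (1 + \<delta>) x \<le> avoidance x"
proof (rule LIMSEQ_le_const2)
  define E where "E m s \<omega> \<longleftrightarrow> s < real m \<and> avoids (1 + \<delta>) s x (\<lambda>t. W t \<omega>)" for m s \<omega>
  define J where "J m = (\<integral>s. exponential_density 1 s * expectation (\<lambda>\<omega>. of_bool (E m s \<omega>) *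
      source (x + W (real (dyadic_index m s) * (1 / 2 ^ m)) \<omega>)) \<partial>lborel)" for m
  define err where "err m = real (m * 2 ^ m) * ((1 + 74 * step_const \<delta>) * sqrt (1 / 2 ^ m) ^ 3)" for m
  have Ej[measurable]: "Measurable.pred (borel \<Otimes>\<^sub>M M) (\<lambda>(s, \<omega>). E m s \<omega>)" for m
  proof -
    note [measurable] = pred_avoids_joint
    have "Measurable.pred (borel \<Otimes>\<^sub>M M) (\<lambda>p. fst p < real m \<and> (case p of (s, \<omega>) \<Rightarrow> avoids (1 + \<delta>) s x (\<lambda>t. W t \<omega>)))"
      by measurable
    then show ?thesis by (simp add: E_def case_prod_beta)
  qed
  have "J \<longlonglongrightarrow> killed_value (1 + \<delta>) x"
    unfolding J_def
  proof (rule limit_of_events[OF Ej])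
    fix s \<omega>
    show "\<forall>\<^sub>F m in sequentially. E m s \<omega> = avoids (1 + \<delta>) s x (\<lambda>t. W t \<omega>)"
      using eventually_gt_at_top[of "nat \<lceil>s\<rceil>"] by eventually_elim (auto simp: E_def intro: order.strict_trans1[OF real_nat_ceiling_ge])
  qed
  moreover have "err \<longlonglongrightarrow> 0" unfolding err_def by (rule error_tendsto_0)
  ultimately show "(\<lambda>m. J m - err m) \<longlonglongrightarrow> killed_value (1 + \<delta>) x"
    using tendsto_diff by fastforce
  have "J m - err m \<le> avoidance x" for m
  proof -
    have sub: "alive (1 + \<delta>) x (1 / 2 ^ m) (Suc (dyadic_index m s)) \<omega>"
      if av: "avoids (1 + \<delta>) s x (\<lambda>t. W t \<omega>)" and s: "0 \<le> s" for s \<omega>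
      unfolding alive_def
    proof (intro allI impI)
      fix j assume "j < Suc (dyadic_index m s)"
      then have "real j * (1 / 2 ^ m) \<le> real (dyadic_index m s) * (1 / 2 ^ m)"
        by (intro mult_right_mono) auto
      also have "\<dots> \<le> s" unfolding dyadic_index_eq[OF s] by (rule dyadic_floor_le)
      finally show "1 + \<delta> < norm (x + W (real j * (1 / 2 ^ m)) \<omega>)"
        using av s by (auto simp: avoids_def)
    qed
    have "J m \<le> (\<integral>s. exponential_density 1 s * expectation (\<lambda>\<omega>. of_bool (alive_until (1 + \<delta>) x m s \<omega>) *
        source (x + W (real (dyadic_index m s) * (1 / 2 ^ m)) \<omega>)) \<partial>lborel)"
      unfolding J_def
    proof (intro integral_exponential_mono expectation_event_mono measurable_event_expectation Ej pred_alive_until expectation_event_abs pred_slice)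
      show "alive_until (1 + \<delta>) x m s \<omega>" if "0 \<le> s" "E m s \<omega>" for s \<omega> using that sub by (auto simp: E_def alive_until_def)
      show "(\<lambda>\<omega>. x + W (real (dyadic_index m s) * (1 / 2 ^ m)) \<omega>) \<in> borel_measurable M" for s
        by measurable
    qed
    also have "\<dots> = skeleton_value (1 + \<delta>) x m"
      unfolding skeleton_value_eq_integral alive_until_def by (simp add: of_bool_conj mult.assoc)
    finally show ?thesis
      using skeleton_bounds(1)[OF \<delta>, where \<epsilon> = "1 / 2 ^ m" and K = "m * 2 ^ m" and x = x]
      by (simp add: skeleton_value_def err_def)
  qed
  then show "\<exists>N. \<forall>n\<ge>N. J n - err n \<le> avoidance x" by blast
qed

text \<open>The skeleton can stay alive although the path hits the unit ball between grid times. For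
  a fixed path this ends as the grid is refined: by continuity some grid point comes within
  \<open>1 + \<delta>\<close>. The disjunction in \<open>E\<close> makes the event contain survival
  of the skeleton and yet settle on exact avoidance of the unit ball.\<close>

lemma avoidance_le_killed_value:
  assumes \<delta>: "0 < \<delta>" "\<delta> \<le> 1"
  shows "avoidance x \<le> killed_value 1 x + 3 * bound * \<delta>"
proof (rule LIMSEQ_le_const)
  define E where "E m s \<omega> \<longleftrightarrow> (s < real m \<and> alive (1 + \<delta>) x (1 / 2 ^ m) (Suc (dyadic_index m s)) \<omega>)
    \<or> avoids 1 s x (\<lambda>t. W t \<omega>)" for m s \<omega>
  define J where "J m = (\<integral>s. exponential_density 1 s * expectation (\<lambda>\<omega>. of_bool (E m s \<omega>) *
      source (x + W (real (dyadic_index m s) * (1 / 2 ^ m)) \<omega>)) \<partial>lborel)" for m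
  define err where "err m = real (m * 2 ^ m) * ((1 + 74 * step_const \<delta>) * sqrt (1 / 2 ^ m) ^ 3)" for m
  note [measurable] = pred_dyadic_alive measurable_dyadic_W pred_avoids_joint
  have Ej[measurable]: "Measurable.pred (borel \<Otimes>\<^sub>M M) (\<lambda>(s, \<omega>). E m s \<omega>)" for m
  proof -
    have "Measurable.pred (borel \<Otimes>\<^sub>M M) (\<lambda>p. (fst p < real m \<and>
        (case p of (s, \<omega>) \<Rightarrow> alive (1 + \<delta>) x (1 / 2 ^ m) (Suc (dyadic_index m s)) \<omega>))
        \<or> (case p of (s, \<omega>) \<Rightarrow> avoids 1 s x (\<lambda>t. W t \<omega>)))"
      by measurable
    then show ?thesis by (simp add: E_def case_prod_beta)
  qed
  have J: "J \<longlonglongrightarrow> killed_value 1 x"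
    unfolding J_def
  proof (rule limit_of_events[OF Ej])
    fix s :: real and \<omega> assume s: "0 \<le> s" and w: "\<omega> \<in> space M"
    show "\<forall>\<^sub>F m in sequentially. E m s \<omega> = avoids 1 s x (\<lambda>t. W t \<omega>)"
    proof (cases "avoids 1 s x (\<lambda>t. W t \<omega>)")
      case False
      then obtain r where r: "0 \<le> r" "r \<le> s" "norm (x + W r \<omega>) < 1 + \<delta>"
        using \<delta> s by (force simp: avoids_def)
      have "(\<lambda>m. norm (x + W (real (dyadic_index m r) * (1 / 2 ^ m)) \<omega>)) \<longlonglongrightarrow> norm (x + W r \<omega>)"
        unfolding dyadic_index_eq[OF r(1)] by (intro tendsto_intros tendsto_dyadic w r(1))
      then have "\<forall>\<^sub>F m in sequentially. norm (x + W (real (dyadic_index m r) * (1 / 2 ^ m)) \<omega>) < 1 + \<delta>"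
        using r(3) by (rule order_tendstoD)
      then show ?thesis
      proof eventually_elim
        case (elim m)
        then have "\<not> alive (1 + \<delta>) x (1 / 2 ^ m) (Suc (dyadic_index m s)) \<omega>"
          using dyadic_index_mono[OF r(2), of m]
          by (auto simp: alive_def intro!: exI[of _ "dyadic_index m r"])
        with False show ?case by (simp add: E_def)
      qed
    qed (simp add: E_def)
  qed
  have err: "err \<longlonglongrightarrow> 0" unfolding err_def by (rule error_tendsto_0)
  have ex: "(\<lambda>m. exp (- (1 / 2 ^ m)) ^ (m * 2 ^ m) :: real) \<longlonglongrightarrow> 0"
  proof -
    have "exp (- (1 / 2 ^ m)) ^ (m * 2 ^ m) = (exp (- 1) ^ m :: real)" for m :: nat
    proof -
      have "exp (- (1 / 2 ^ m)) ^ (m * 2 ^ m) = (exp (real (m * 2 ^ m) * (- (1 / 2 ^ m))) :: real)"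
        by (rule exp_of_nat_mult[symmetric])
      also have "real (m * 2 ^ m) * (- (1 / 2 ^ m)) = real m * (- 1)" by simp
      also have "exp \<dots> = exp (- 1) ^ m" by (rule exp_of_nat_mult)
      finally show ?thesis .
    qed
    then show ?thesis by (simp add: LIMSEQ_power_zero)
  qed
  have "(\<lambda>m. J m + 3 * bound * \<delta> + exp (- (1 / 2 ^ m)) ^ (m * 2 ^ m) + err m)
      \<longlonglongrightarrow> killed_value 1 x + 3 * bound * \<delta> + 0 + 0"
    by (intro tendsto_intros J err ex)
  then show "(\<lambda>m. J m + 3 * bound * \<delta> + exp (- (1 / 2 ^ m)) ^ (m * 2 ^ m) + err m)
      \<longlonglongrightarrow> killed_value 1 x + 3 * bound * \<delta>" by simp
  have "avoidance x \<le> J m + 3 * bound * \<delta> + exp (- (1 / 2 ^ m)) ^ (m * 2 ^ m) + err m" for m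
  proof -
    have "skeleton_value (1 + \<delta>) x m = (\<integral>s. exponential_density 1 s * expectation (\<lambda>\<omega>. of_bool (alive_until (1 + \<delta>) x m s \<omega>) *
        source (x + W (real (dyadic_index m s) * (1 / 2 ^ m)) \<omega>)) \<partial>lborel)"
      unfolding skeleton_value_eq_integral alive_until_def by (simp add: of_bool_conj mult.assoc)
    also have "\<dots> \<le> J m"
      unfolding J_def
    proof (intro integral_exponential_mono expectation_event_mono measurable_event_expectation Ej pred_alive_until expectation_event_abs pred_slice)
      show "E m s \<omega>" if "alive_until (1 + \<delta>) x m s \<omega>" for s \<omega> using that by (auto simp: E_def alive_until_def)
      show "(\<lambda>\<omega>. x + W (real (dyadic_index m s) * (1 / 2 ^ m)) \<omega>) \<in> borel_measurable M" for s
        by measurable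
    qed
    finally show ?thesis
      using skeleton_bounds(2)[OF \<delta>, where \<epsilon> = "1 / 2 ^ m" and K = "m * 2 ^ m" and x = x]
      by (simp add: skeleton_value_def err_def)
  qed
  then show "\<exists>N. \<forall>m\<ge>N. avoidance x \<le> J m + 3 * bound * \<delta> + exp (- (1 / 2 ^ m)) ^ (m * 2 ^ m) + err m" by blast
qed

text \<open>Both comparisons are taken to the limit \<open>\<delta> \<rightarrow> 0\<close>. By
  \<open>avoids_margin\<close> a path avoiding the unit ball also avoids a slightly larger one,
  which makes \<open>killed_value\<close> continuous in the radius from above.\<close>

theorem avoidance_eq_killed_value: "avoidance x = killed_value 1 x"
proof (rule antisym)
  have d: "(\<lambda>j. 1 / real (Suc j)) \<longlonglongrightarrow> 0" by (rule lim_inverse_n'[THEN LIMSEQ_Suc])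
  have "(\<lambda>j. killed_value 1 x + 3 * bound * (1 / real (Suc j))) \<longlonglongrightarrow> killed_value 1 x + 3 * bound * 0"
    by (intro tendsto_intros d)
  then show "avoidance x \<le> killed_value 1 x"
    by (simp only: mult_zero_right add_0_right, elim LIMSEQ_le_const)
      (intro exI[of _ 0] allI impI avoidance_le_killed_value, auto)
  have "(\<lambda>j. killed_value (1 + 1 / real (Suc j)) x) \<longlonglongrightarrow> killed_value 1 x"
    unfolding killed_value_def
  proof (rule exponential_dominated_convergence)
    show "(\<lambda>j. of_bool (avoids (1 + 1 / real (Suc j)) s x (\<lambda>t. W t \<omega>)) * source (x + W (max 0 s) \<omega>))
        \<longlonglongrightarrow> of_bool (avoids 1 s x (\<lambda>t. W t \<omega>)) * source (x + W (max 0 s) \<omega>)"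
      if w: "\<omega> \<in> space M" for s \<omega>
    proof (intro tendsto_intros tendsto_eventually)
      show "\<forall>\<^sub>F j in sequentially. of_bool (avoids (1 + 1 / real (Suc j)) s x (\<lambda>t. W t \<omega>)) =
          (of_bool (avoids 1 s x (\<lambda>t. W t \<omega>)) :: real)"
      proof (cases "avoids 1 s x (\<lambda>t. W t \<omega>)")
        case True
        then obtain \<eta> where \<eta>: "0 < \<eta>" "avoids (1 + \<eta>) s x (\<lambda>t. W t \<omega>)"
          using avoids_margin[OF continuous[OF w]] by blast
        have "\<forall>\<^sub>F j in sequentially. 1 / real (Suc j) < \<eta>"
          using d \<eta>(1) by (rule order_tendstoD)
        then show ?thesis
        proof eventually_elim
          case (elim j)
          then have "avoids (1 + 1 / real (Suc j)) s x (\<lambda>t. W t \<omega>)"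
            using \<eta>(2) unfolding avoids_def by (metis add_strict_left_mono less_trans)
          with True show ?case by simp
        qed
      next
        case False
        have "\<not> avoids (1 + 1 / real (Suc j)) s x (\<lambda>t. W t \<omega>)" for j
        proof
          assume av: "avoids (1 + 1 / real (Suc j)) s x (\<lambda>t. W t \<omega>)"
          have "1 < 1 + 1 / real (Suc j)" by simp
          with av have "avoids 1 s x (\<lambda>t. W t \<omega>)" unfolding avoids_def by (meson less_trans)
          with False show False by simp
        qed
        with False show ?thesis by simp
      qed
    qed
  qed (rule measurable_killed_integrand of_bool_source_abs)+
  then show "killed_value 1 x \<le> avoidance x"
    by (rule LIMSEQ_le_const2) (use avoidance_ge_killed_value in auto)
qed

end

subsection \<open>Branching Brownian motion: the genealogy\<close>

definition survives ::
    "nat \<Rightarrow> real ^ 'n \<Rightarrow> (bool list \<Rightarrow> real \<Rightarrow> real ^ 'n) \<Rightarrow> (bool list \<Rightarrow> real) \<Rightarrow> (bool list \<Rightarrow> bool) \<Rightarrow> bool" where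
  "survives n x W L \<xi> \<longleftrightarrow>
     (\<forall>u. length u < n \<and> particle_exists \<xi> u \<longrightarrow> avoids 1 (L u) (birthplace x W L u) (W u))"

text \<open>The definitions recurse at the youngest particle, the head of the word, whereas the
  branching property splits at the root, the end of the word. The lemmas for \<open>u @ [b]\<close>
  change from one direction to the other.\<close>

lemma particle_exists_snoc:
  "particle_exists \<xi> (u @ [b]) \<longleftrightarrow> \<xi> [] \<and> particle_exists (\<lambda>u. \<xi> (u @ [b])) u"
  by (induction u) auto

lemma birthplace_snoc:
  "birthplace x W L (u @ [b]) = birthplace (x + W [] (L [])) (\<lambda>u. W (u @ [b])) (\<lambda>u. L (u @ [b])) u"
  by (induction u) auto

lemma survives_Suc:
  "survives (Suc n) x W L \<xi> \<longleftrightarrow> avoids 1 (L []) x (W []) \<and>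
    (\<xi> [] \<longrightarrow> (\<forall>b. survives n (x + W [] (L [])) (\<lambda>u. W (u @ [b])) (\<lambda>u. L (u @ [b])) (\<lambda>u. \<xi> (u @ [b]))))"
    (is "?l \<longleftrightarrow> ?r")
proof
  assume l: ?l
  show ?r
  proof (intro conjI impI allI)
    show "avoids 1 (L []) x (W [])" using l by (auto simp: survives_def dest: spec[of _ "[]"])
    show "survives n (x + W [] (L [])) (\<lambda>u. W (u @ [b])) (\<lambda>u. L (u @ [b])) (\<lambda>u. \<xi> (u @ [b]))" if "\<xi> []" for b
      unfolding survives_def
    proof (intro allI impI)
      fix u assume "length u < n \<and> particle_exists (\<lambda>u. \<xi> (u @ [b])) u"
      then show "avoids 1 (L (u @ [b])) (birthplace (x + W [] (L [])) (\<lambda>u. W (u @ [b])) (\<lambda>u. L (u @ [b])) u) (W (u @ [b]))"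
        using l that by (auto simp: survives_def particle_exists_snoc birthplace_snoc dest: spec[of _ "u @ [b]"])
    qed
  qed
next
  assume r: ?r
  show ?l
    unfolding survives_def
  proof (intro allI impI)
    fix u assume u: "length u < Suc n \<and> particle_exists \<xi> u"
    show "avoids 1 (L u) (birthplace x W L u) (W u)"
    proof (cases u rule: rev_cases)
      case Nil
      then show ?thesis using r by simp
    next
      case (snoc v b)
      then show ?thesis using r u by (auto simp: survives_def particle_exists_snoc birthplace_snoc)
    qed
  qed
qed

lemma genealogical_tree_iff:
  assumes "\<And>u. 0 < L u"
  shows "(u, t) \<in> genealogical_tree L \<xi> \<longleftrightarrow> particle_exists \<xi> u \<and> 0 \<le> t \<and> t \<le> L u \<and> (t = 0 \<longrightarrow> u = [])"
  using assms[of u] by (auto simp: genealogical_tree_def less_eq_real_def)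

text \<open>Given a hit, a pioneer is found on a particle of least generation among those that hit,
  at its first hitting age, which exists by compactness. Strict ancestors have an earlier
  generation, or the same label and a smaller age, and so do not hit.\<close>

lemma pioneers_nonempty_iff:
  assumes L: "\<And>u. 0 < L u" and W0: "\<And>u. W u 0 = 0" and cont: "\<And>u. continuous_on {0..} (W u)"
  shows "pioneers x W L \<xi> (cball 0 1) \<noteq> {} \<longleftrightarrow> \<not> (\<forall>n. survives n x W L \<xi>)"
proof -
  define hit where "hit u t \<longleftrightarrow> particle_exists \<xi> u \<and> 0 \<le> t \<and> t \<le> L u \<and> norm (birthplace x W L u + W u t) \<le> 1"
    for u t
  have avoids_iff: "avoids 1 (L u) (birthplace x W L u) (W u) \<longleftrightarrow> (\<forall>t. \<not> hit u t)" if "particle_exists \<xi> u" for u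
  proof (intro iffI allI notI)
    fix t assume av: "avoids 1 (L u) (birthplace x W L u) (W u)" and hit: "hit u t"
    from hit have "t \<in> {0..max 0 (L u)}" by (auto simp: hit_def)
    with av have "1 < norm (birthplace x W L u + W u t)" unfolding avoids_def by blast
    with hit show False by (simp add: hit_def)
  next
    assume no: "\<forall>t. \<not> hit u t"
    show "avoids 1 (L u) (birthplace x W L u) (W u)"
      unfolding avoids_def
    proof
      fix s assume "s \<in> {0..max 0 (L u)}"
      then show "1 < norm (birthplace x W L u + W u s)"
        using no[rule_format, of s] that L[of u] by (simp add: hit_def not_le)
    qed
  qed
  have surv: "(\<forall>n. survives n x W L \<xi>) \<longleftrightarrow> (\<forall>u t. \<not> hit u t)"
  proof (intro iffI allI)
    fix u :: "bool list" and t assume "\<forall>n. survives n x W L \<xi>"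
    then have "survives (Suc (length u)) x W L \<xi>" by blast
    then have "particle_exists \<xi> u \<longrightarrow> avoids 1 (L u) (birthplace x W L u) (W u)"
      unfolding survives_def by simp
    then show "\<not> hit u t" using avoids_iff by (auto simp: hit_def)
  next
    fix n assume "\<forall>u t. \<not> hit u t"
    then show "survives n x W L \<xi>" unfolding survives_def using avoids_iff by blast
  qed
  have "pioneers x W L \<xi> (cball 0 1) \<noteq> {} \<longleftrightarrow> (\<exists>u t. hit u t)"
  proof
    assume "pioneers x W L \<xi> (cball 0 1) \<noteq> {}"
    then obtain u t where "(u, t) \<in> pioneers x W L \<xi> (cball 0 1)" by auto
    then have "hit u t"
      using genealogical_tree_iff[OF L] by (auto simp: pioneers_def position_def hit_def)
    then show "\<exists>u t. hit u t" by blast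
  next
    assume "\<exists>u t. hit u t"
    then obtain k where "\<exists>t. hit k t" by blast
    from ex_has_least_nat[of "\<lambda>u. \<exists>t. hit u t", OF this, of length]
    obtain u where u: "\<exists>t. hit u t" and "\<And>v. \<exists>t. hit v t \<Longrightarrow> length u \<le> length v" by blast
    then have least: "\<not> (\<exists>t. hit v t)" if "length v < length u" for v
      using that not_le by blast
    define S where "S = {t \<in> {0..L u}. norm (birthplace x W L u + W u t) \<le> 1}"
    have cont_u: "continuous_on {0..L u} (W u)"
      by (rule continuous_on_subset[OF cont]) auto
    have "closed ({0..L u} \<inter> (\<lambda>t. norm (birthplace x W L u + W u t)) -` {..1})"
      by (intro continuous_closed_preimage continuous_intros cont_u)
    moreover have "{0..L u} \<inter> (\<lambda>t. norm (birthplace x W L u + W u t)) -` {..1} = S"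
      by (auto simp: S_def)
    ultimately have "closed S" by simp
    moreover have "bounded S" by (rule bounded_subset[of "{0..L u}"]) (auto simp: S_def)
    ultimately have "compact S" by (simp add: compact_eq_bounded_closed)
    moreover have "S \<noteq> {}" using u by (auto simp: S_def hit_def)
    ultimately obtain t where t: "t \<in> S" "\<And>s. s \<in> S \<Longrightarrow> t \<le> s"
      using compact_attains_inf[of S] by blast
    have ex: "particle_exists \<xi> u" using u by (auto simp: hit_def)
    \<comment> \<open>Age \<open>0\<close> of a particle other than the root is not a point of the
      tree. A hit there would be a hit of the parent at its death, against minimality of the
      generation.\<close>
    have "u = []" if "t = 0"
    proof (cases u)
      case (Cons b v)
      have "hit v (L v)"
        using t(1) that ex Cons W0 L[of v] by (auto simp: hit_def S_def)
      then show ?thesis using least[of v] Cons by auto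
    qed
    then have "(u, t) \<in> genealogical_tree L \<xi>"
      unfolding genealogical_tree_iff[OF L] using ex t(1) by (auto simp: S_def)
    moreover have "position x W L (u, t) \<in> cball 0 1"
      using t(1) by (simp add: position_def S_def)
    moreover have "position x W L q \<notin> cball 0 1"
      if q: "q \<in> genealogical_tree L \<xi>" "strict_ancestor q (u, t)" for q
    proof
      assume pos: "position x W L q \<in> cball 0 1"
      obtain v s where vs: "q = (v, s)" by (cases q)
      have h: "hit v s"
        using pos q(1) genealogical_tree_iff[OF L] by (auto simp: vs hit_def position_def)
      from q(2) have "strict_suffix v u \<or> v = u \<and> s < t"
        by (simp add: vs strict_ancestor_def)
      then show False
      proof
        assume "strict_suffix v u"
        then have "length v < length u" by (rule suffix_length_less)
        with h least show False by blast
      next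
        assume "v = u \<and> s < t"
        with h have "s \<in> S" "s < t" by (auto simp: S_def hit_def)
        with t(2) show False by force
      qed
    qed
    ultimately have "(u, t) \<in> pioneers x W L \<xi> (cball 0 1)" by (simp add: pioneers_def)
    then show "pioneers x W L \<xi> (cball 0 1) \<noteq> {}" by blast
  qed
  with surv show ?thesis by blast
qed

lemma num_pioneers_pos_iff:
  assumes "\<And>u. 0 < L u" "\<And>u. W u 0 = 0" "\<And>u. continuous_on {0..} (W u)"
  shows "0 < num_pioneers x W L \<xi> \<longleftrightarrow> \<not> (\<forall>n. survives n x W L \<xi>)"
proof -
  have "0 < num_pioneers x W L \<xi> \<longleftrightarrow> pioneers x W L \<xi> (cball 0 1) \<noteq> {}"
    by (simp add: num_pioneers_def zero_less_iff_neq_zero emeasure_count_space_eq_0)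
  then show ?thesis using pioneers_nonempty_iff[OF assms] by simp
qed

text \<open>Measurability is required only for labels in \<open>U\<close> and relative to an
  arbitrary sigma-algebra. The same results then serve the sigma-algebras generated by the root
  alone, by the other particles and by a subtree.\<close>

locale particle_data =
  fixes N :: "'w measure" and U :: "bool list set" and W :: "bool list \<Rightarrow> real \<Rightarrow> 'w \<Rightarrow> real ^ 'n::finite"
    and L :: "bool list \<Rightarrow> 'w \<Rightarrow> real" and \<xi> :: "bool list \<Rightarrow> 'w \<Rightarrow> bool"
  assumes process: "u \<in> U \<Longrightarrow> continuous_process N (W u)"
    and lifetime: "u \<in> U \<Longrightarrow> L u \<in> borel_measurable N"
    and branching: "u \<in> U \<Longrightarrow> Measurable.pred N (\<xi> u)"
    and lifetime_pos: "\<omega> \<in> space N \<Longrightarrow> 0 < L u \<omega>"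
begin

lemma measurable_death_displacement:
  assumes "u \<in> U"
  shows "(\<lambda>\<omega>. W u (L u \<omega>) \<omega>) \<in> borel_measurable N"
proof -
  note [measurable] = lifetime[OF assms]
  have "(\<lambda>\<omega>. W u (max 0 (L u \<omega>)) \<omega>) \<in> borel_measurable N"
    using measurable_compose[OF _ continuous_process.measurable_joint[OF process[OF assms]], of "\<lambda>\<omega>. (L u \<omega>, \<omega>)" N]
    by simp
  then show ?thesis
    by (rule measurable_cong[THEN iffD1, rotated]) (use lifetime_pos in \<open>simp add: max_def less_imp_le\<close>)
qed

lemma measurable_birthplace:
  assumes "U = UNIV"
  shows "(\<lambda>(x, \<omega>). birthplace x (\<lambda>u t. W u t \<omega>) (\<lambda>u. L u \<omega>) u) \<in> borel_measurable (borel \<Otimes>\<^sub>M N)"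
proof -
  have "(\<lambda>p. birthplace (fst p) (\<lambda>u t. W u t (snd p)) (\<lambda>u. L u (snd p)) u) \<in> borel_measurable (borel \<Otimes>\<^sub>M N)"
  proof (induction u)
    case (Cons b u)
    have "(\<lambda>p. W u (L u (snd p)) (snd p)) \<in> borel_measurable (borel \<Otimes>\<^sub>M N)"
      by (rule measurable_compose[OF measurable_snd measurable_death_displacement]) (simp add: assms)
    from borel_measurable_add[OF Cons this] show ?case by simp
  qed simp
  then show ?thesis by (simp add: case_prod_beta)
qed

lemma pred_particle_exists:
  assumes "U = UNIV"
  shows "Measurable.pred N (\<lambda>\<omega>. particle_exists (\<lambda>u. \<xi> u \<omega>) u)"
proof (induction u)
  case (Cons b u)
  note [measurable] = Cons branching[of u, unfolded assms, OF UNIV_I]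
  show ?case by simp
qed simp

lemma pred_survives:
  assumes "U = UNIV"
  shows "Measurable.pred (borel \<Otimes>\<^sub>M N) (\<lambda>(x, \<omega>). survives n x (\<lambda>u t. W u t \<omega>) (\<lambda>u. L u \<omega>) (\<lambda>u. \<xi> u \<omega>))"
proof -
  have [measurable]: "Measurable.pred (borel \<Otimes>\<^sub>M N) (\<lambda>p. particle_exists (\<lambda>u. \<xi> u (snd p)) u)" for u
    by (rule measurable_compose[OF measurable_snd pred_particle_exists[OF assms]])
  have [measurable]: "Measurable.pred (borel \<Otimes>\<^sub>M N) (\<lambda>p. avoids 1 (L u (snd p))
      (birthplace (fst p) (\<lambda>u t. W u t (snd p)) (\<lambda>u. L u (snd p)) u) (\<lambda>t. W u t (snd p)))" for u
  proof (rule continuous_process.pred_avoids[OF process])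
    show "(\<lambda>p. L u (snd p)) \<in> borel_measurable (borel \<Otimes>\<^sub>M N)"
      by (rule measurable_compose[OF measurable_snd lifetime]) (simp add: assms)
    show "(\<lambda>p. birthplace (fst p) (\<lambda>u t. W u t (snd p)) (\<lambda>u. L u (snd p)) u) \<in> borel_measurable (borel \<Otimes>\<^sub>M N)"
      using measurable_birthplace[OF assms, of u] by (simp add: case_prod_beta)
  qed (use assms in auto)
  show ?thesis
    unfolding survives_def case_prod_beta by measurable
qed

end

lemma (in prob_space) indep_sets_reindex:
  assumes F: "indep_sets F UNIV" and h: "inj h"
  shows "indep_sets (\<lambda>i. F (h i)) UNIV"
proof (rule indep_setsI)
  show "F (h i) \<subseteq> events" for i using F by (auto simp: indep_sets_def)
  fix A J assume J: "J \<noteq> {}" "J \<subseteq> UNIV" "finite J" "\<forall>j\<in>J. A j \<in> F (h j)"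
  have "prob (\<Inter>k\<in>h ` J. A (inv h k)) = (\<Prod>k\<in>h ` J. prob (A (inv h k)))"
    using J h by (intro indep_setsD[OF F]) (auto simp: inv_f_f)
  then show "prob (\<Inter>j\<in>J. A j) = (\<Prod>j\<in>J. prob (A j))"
    using h by (simp add: prod.reindex inj_on_subset inv_f_f)
qed

definition survival_prob ::
    "'w measure \<Rightarrow> (bool list \<Rightarrow> real \<Rightarrow> 'w \<Rightarrow> real ^ 'n::finite) \<Rightarrow> (bool list \<Rightarrow> 'w \<Rightarrow> real) \<Rightarrow>
     (bool list \<Rightarrow> 'w \<Rightarrow> bool) \<Rightarrow> nat \<Rightarrow> real ^ 'n \<Rightarrow> real" where
  "survival_prob M W L \<xi> n x =
     measure M {\<omega> \<in> space M. survives n x (\<lambda>u t. W u t \<omega>) (\<lambda>u. L u \<omega>) (\<lambda>u. \<xi> u \<omega>)}"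

section \<open>Independence of the root and its two subtrees\<close>

locale branching_brownian_motion = prob_space M for M :: "'w measure" +
  fixes W :: "bool list \<Rightarrow> real \<Rightarrow> 'w \<Rightarrow> real ^ 'n::finite" and L :: "bool list \<Rightarrow> 'w \<Rightarrow> real"
    and \<xi> :: "bool list \<Rightarrow> 'w \<Rightarrow> bool"
  assumes bbm: "critical_binary_bbm M W L \<xi>"
begin

lemma brownian_motion_W: "brownian_motion M (W u)"
  using bbm by unfold_locales (auto simp: critical_binary_bbm_def)

lemma L_pos: "\<omega> \<in> space M \<Longrightarrow> 0 < L u \<omega>"
  using bbm by (auto simp: critical_binary_bbm_def)

lemma L_distributed: "distributed M lborel (L u) (exponential_density 1)"
  using bbm by (auto simp: critical_binary_bbm_def)

lemma L_measurable [measurable]: "L u \<in> borel_measurable M"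
  using distributed_measurable[OF L_distributed] by simp

lemma \<xi>_measurable [measurable]: "Measurable.pred M (\<xi> u)"
  using bbm by (auto simp: critical_binary_bbm_def)

lemma \<xi>_prob: "prob {\<omega> \<in> space M. \<xi> u \<omega>} = 1 / 2"
  using bbm by (auto simp: critical_binary_bbm_def)

definition life :: "bool list \<Rightarrow> 'w \<Rightarrow> (real \<Rightarrow> real ^ 'n) \<times> real \<times> bool" where
  "life u \<omega> = (displacement_path (W u) \<omega>, (L u \<omega>, \<xi> u \<omega>))"

definition life_algebra :: "bool list \<Rightarrow> 'w measure" where
  "life_algebra u = vimage_algebra (space M) (life u) (path_space \<Otimes>\<^sub>M (borel \<Otimes>\<^sub>M count_space UNIV))"

text \<open>A measure that serves only as a carrier of the sigma-algebra generated by the lives of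
  the particles in \<open>U\<close>. Disjoint label sets give independent sigma-algebras, which
  expresses the branching property.\<close>

definition data :: "bool list set \<Rightarrow> 'w measure" where
  "data U = sigma (space M) (\<Union>u\<in>U. sets (life_algebra u))"

lemma displacement_path_space: "displacement_path (W u) \<omega> \<in> space path_space"
  by (auto simp: displacement_path_def path_space_def space_PiM)

lemma life_space: "life u \<in> space M \<rightarrow> space (path_space \<Otimes>\<^sub>M (borel \<Otimes>\<^sub>M count_space UNIV))"
  using displacement_path_space by (auto simp: life_def space_pair_measure)

lemma space_life_algebra: "space (life_algebra u) = space M"
  by (simp add: life_algebra_def)

lemma indep_life_algebras: "indep_sets (\<lambda>u. sets (life_algebra u)) UNIV"
proof -
  have "indep_vars (\<lambda>_. path_space \<Otimes>\<^sub>M (borel \<Otimes>\<^sub>M count_space UNIV)) life UNIV"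
    using bbm unfolding critical_binary_bbm_def life_def[abs_def] by blast
  then show ?thesis
    unfolding life_algebra_def sets_vimage_algebra2[OF life_space] indep_vars_def2 by blast
qed

lemma sets_data: "sets (data U) = sigma_sets (space M) (\<Union>u\<in>U. sets (life_algebra u))"
  unfolding data_def by (rule sets_measure_of) (use sets.sets_into_space space_life_algebra in fastforce)

lemma space_data: "space (data U) = space M"
  by (simp add: data_def space_measure_of_conv)

lemma indep_data:
  assumes "U \<inter> V = {}"
  shows "indep_set (sets (data U)) (sets (data V))"
proof -
  have "indep_sets (\<lambda>b. sigma_sets (space M) (\<Union>u\<in>case_bool U V b. sets (life_algebra u))) UNIV"
  proof (rule indep_sets_collect_sigma)
    show "indep_sets (\<lambda>u. sets (life_algebra u)) (\<Union>b\<in>UNIV. case_bool U V b)"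
      by (rule indep_sets_mono_index[OF _ indep_life_algebras]) simp
    show "disjoint_family_on (case_bool U V) UNIV"
      using assms by (auto simp: disjoint_family_on_def split: bool.splits)
  qed (rule sets.Int_stable)
  then show ?thesis
    unfolding indep_set_def sets_data by (rule indep_sets_cong[THEN iffD1, rotated 2]) (auto split: bool.split)
qed

lemma subalgebra_data: "subalgebra M (data U)"
  using indep_setD_ev1[OF indep_data[of U "{}"]] by (simp add: subalgebra_def space_data)

lemma data_mono_measurable:
  assumes "u \<in> U" "F \<in> measurable (life_algebra u) K"
  shows "F \<in> measurable (data U) K"
proof (rule measurable_mono[THEN subsetD, OF _ _ _ _ assms(2)])
  show "sets (life_algebra u) \<subseteq> sets (data U)"
    unfolding sets_data using assms(1) by auto
qed (auto simp: space_data space_life_algebra)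

lemma measurable_life: "life u \<in> measurable (life_algebra u) (path_space \<Otimes>\<^sub>M (borel \<Otimes>\<^sub>M count_space UNIV))"
  unfolding life_algebra_def by (rule measurable_vimage_algebra1[OF life_space])

lemma continuous_processI:
  assumes "displacement_path (W u) \<in> measurable N path_space" "space N = space M"
  shows "continuous_process N (W u)"
proof
  interpret brownian_motion M "W u" by (rule brownian_motion_W)
  show "continuous_on {0..} (\<lambda>t. W u t \<omega>)" if "\<omega> \<in> space N" for \<omega>
    using that assms(2) by (intro continuous) simp
  show "W u t \<in> borel_measurable N" if "0 \<le> t" for t
  proof -
    have "(\<lambda>w. w t) \<in> borel_measurable (path_space :: (real \<Rightarrow> real ^ 'n) measure)"
      unfolding path_space_def using that by (intro measurable_component_singleton) simp
    from measurable_compose[OF assms(1) this] show ?thesis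
      using that by (simp add: displacement_path_def)
  qed
qed

lemma particle_data: "particle_data (data U) U W L \<xi>"
proof (rule particle_data.intro)
  fix u assume u: "u \<in> U"
  note life = data_mono_measurable[OF u measurable_life]
  have "(\<lambda>\<omega>. fst (life u \<omega>)) \<in> measurable (data U) path_space"
    by (rule measurable_compose[OF life measurable_fst])
  then show "continuous_process (data U) (W u)"
    by (intro continuous_processI) (simp_all add: life_def space_data)
  have "(\<lambda>\<omega>. fst (snd (life u \<omega>))) \<in> borel_measurable (data U)"
    by (rule measurable_compose[OF life]) measurable
  then show "L u \<in> borel_measurable (data U)" by (simp add: life_def)
  have "(\<lambda>\<omega>. snd (snd (life u \<omega>))) \<in> measurable (data U) (count_space UNIV)"
    by (rule measurable_compose[OF life]) measurable
  then show "Measurable.pred (data U) (\<xi> u)" by (simp add: life_def)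
qed (simp add: L_pos space_data)

text \<open>The words ending in \<open>b\<close> form a copy of the whole genealogy on the same
  probability space. Inductions over generations can therefore range over all \<open>W\<close>,
  \<open>L\<close> and \<open>\<xi>\<close> with \<open>M\<close> fixed.\<close>

lemma critical_binary_bbm_subtree:
  "critical_binary_bbm M (\<lambda>u. W (u @ [b])) (\<lambda>u. L (u @ [b])) (\<lambda>u. \<xi> (u @ [b]))"
proof -
  have rv: "random_variable (path_space \<Otimes>\<^sub>M (borel \<Otimes>\<^sub>M count_space UNIV)) (life u)" for u
    using bbm unfolding critical_binary_bbm_def indep_vars_def2 life_def[abs_def] by auto
  have "indep_sets (\<lambda>u. {life u -` A \<inter> space M |A. A \<in> sets (path_space \<Otimes>\<^sub>M (borel \<Otimes>\<^sub>M count_space UNIV))}) UNIV"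
    using bbm unfolding critical_binary_bbm_def indep_vars_def2 life_def[abs_def] by auto
  from indep_sets_reindex[OF this, of "\<lambda>u. u @ [b]"]
  have "indep_vars (\<lambda>_. path_space \<Otimes>\<^sub>M (borel \<Otimes>\<^sub>M count_space UNIV)) (\<lambda>u. life (u @ [b])) UNIV"
    unfolding indep_vars_def2 using rv by (simp add: inj_def)
  then show ?thesis
    using bbm unfolding critical_binary_bbm_def life_def[abs_def] by simp
qed

definition subtree_survives :: "nat \<Rightarrow> bool \<Rightarrow> real ^ 'n \<Rightarrow> 'w \<Rightarrow> bool" where
  "subtree_survives n b x \<omega> \<longleftrightarrow>
    survives n x (\<lambda>u t. W (u @ [b]) t \<omega>) (\<lambda>u. L (u @ [b]) \<omega>) (\<lambda>u. \<xi> (u @ [b]) \<omega>)"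

definition subtree_prob :: "nat \<Rightarrow> bool \<Rightarrow> real ^ 'n \<Rightarrow> real" where
  "subtree_prob n b = survival_prob M (\<lambda>u. W (u @ [b])) (\<lambda>u. L (u @ [b])) (\<lambda>u. \<xi> (u @ [b])) n"

definition subtree_words :: "bool \<Rightarrow> bool list set" where
  "subtree_words b = range (\<lambda>u. u @ [b])"

lemma pred_subtree_survives:
  assumes "subtree_words b \<subseteq> U"
  shows "Measurable.pred (borel \<Otimes>\<^sub>M data U) (\<lambda>(x, \<omega>). subtree_survives n b x \<omega>)"
proof -
  interpret U: particle_data "data U" U W L \<xi> by (rule particle_data)
  have sub: "u @ [b] \<in> U" for u using assms by (auto simp: subtree_words_def)
  interpret particle_data "data U" UNIV "\<lambda>u. W (u @ [b])" "\<lambda>u. L (u @ [b])" "\<lambda>u. \<xi> (u @ [b])"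
    by (rule particle_data.intro) (use sub U.process U.lifetime U.branching U.lifetime_pos in auto)
  show ?thesis
    unfolding subtree_survives_def by (rule pred_survives) simp
qed

lemma pred_slice_data:
  assumes "Measurable.pred (borel \<Otimes>\<^sub>M data U) (\<lambda>(x :: real ^ 'n, \<omega>). E x \<omega>)"
  shows "Measurable.pred (data U) (E x)" "Measurable.pred M (E x)"
proof -
  have "x \<in> space borel" by simp
  from measurable_compose[OF measurable_Pair1'[OF this] assms] show 1: "Measurable.pred (data U) (E x)" by simp
  show "Measurable.pred M (E x)" by (rule measurable_from_subalg[OF subalgebra_data 1])
qed

lemma subtrees_independent:
  "prob {\<omega> \<in> space M. \<forall>b. subtree_survives n b x \<omega>} = subtree_prob n True x * subtree_prob n False x"
proof -
  define A where "A b = {\<omega> \<in> space M. subtree_survives n b x \<omega>}" for b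
  have "A b \<in> sets (data (subtree_words b))" for b
    using pred_slice_data(1)[OF pred_subtree_survives[OF order_refl]]
    unfolding A_def pred_def space_data by simp
  moreover have "subtree_words True \<inter> subtree_words False = {}" by (auto simp: subtree_words_def)
  ultimately have "prob (A True \<inter> A False) = prob (A True) * prob (A False)"
    using indep_setD[OF indep_data] by blast
  moreover have "A True \<inter> A False = {\<omega> \<in> space M. \<forall>b. subtree_survives n b x \<omega>}"
    by (auto simp: A_def all_bool_eq)
  ultimately show ?thesis
    by (simp add: A_def subtree_prob_def survival_prob_def subtree_survives_def)
qed

lemma measurable_survival_prob [measurable]: "survival_prob M W L \<xi> n \<in> borel_measurable borel"
proof -
  interpret particle_data "data UNIV" UNIV W L \<xi> by (rule particle_data)
  interpret B: prob_space "restr_to_subalg M (data UNIV)"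
    by (rule prob_space_restr_to_subalg[OF subalgebra_data]) (rule prob_space_axioms)
  have s: "sets (restr_to_subalg M (data UNIV)) = sets (data UNIV)"
    by (rule sets_restr_to_subalg[OF subalgebra_data])
  have p[measurable]: "Measurable.pred (borel \<Otimes>\<^sub>M data UNIV) (\<lambda>(x, \<omega>). survives n x (\<lambda>u t. W u t \<omega>) (\<lambda>u. L u \<omega>) (\<lambda>u. \<xi> u \<omega>))"
    by (rule pred_survives) simp
  have "(\<lambda>(x, \<omega>). of_bool (survives n x (\<lambda>u t. W u t \<omega>) (\<lambda>u. L u \<omega>) (\<lambda>u. \<xi> u \<omega>)) :: real)
      \<in> borel_measurable (borel \<Otimes>\<^sub>M data UNIV)"
  proof -
    have "(\<lambda>p. of_bool (case p of (x, \<omega>) \<Rightarrow> survives n x (\<lambda>u t. W u t \<omega>) (\<lambda>u. L u \<omega>) (\<lambda>u. \<xi> u \<omega>)) :: real)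
      \<in> borel_measurable (borel \<Otimes>\<^sub>M data UNIV)" by measurable
    then show ?thesis by (simp add: case_prod_beta)
  qed
  then have "(\<lambda>(x, \<omega>). of_bool (survives n x (\<lambda>u t. W u t \<omega>) (\<lambda>u. L u \<omega>) (\<lambda>u. \<xi> u \<omega>)) :: real)
      \<in> borel_measurable (borel \<Otimes>\<^sub>M restr_to_subalg M (data UNIV))"
    by (simp only: measurable_cong_sets[OF sets_pair_measure_cong[OF refl s] refl])
  note B.borel_measurable_lebesgue_integral[OF this]
  moreover have "(\<integral>\<omega>. (of_bool (survives n x (\<lambda>u t. W u t \<omega>) (\<lambda>u. L u \<omega>) (\<lambda>u. \<xi> u \<omega>)) :: real)
      \<partial>restr_to_subalg M (data UNIV)) = survival_prob M W L \<xi> n x" for x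
  proof -
    let ?A = "{\<omega> \<in> space M. survives n x (\<lambda>u t. W u t \<omega>) (\<lambda>u. L u \<omega>) (\<lambda>u. \<xi> u \<omega>)}"
    have [measurable]: "Measurable.pred (data UNIV) (\<lambda>\<omega>. survives n x (\<lambda>u t. W u t \<omega>) (\<lambda>u. L u \<omega>) (\<lambda>u. \<xi> u \<omega>))"
      by (rule pred_slice_data(1)[OF p])
    have "(\<integral>\<omega>. (of_bool (survives n x (\<lambda>u t. W u t \<omega>) (\<lambda>u. L u \<omega>) (\<lambda>u. \<xi> u \<omega>)) :: real)
        \<partial>restr_to_subalg M (data UNIV)) =
        (\<integral>\<omega>. of_bool (survives n x (\<lambda>u t. W u t \<omega>) (\<lambda>u. L u \<omega>) (\<lambda>u. \<xi> u \<omega>)) \<partial>M)"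
      by (rule integral_subalgebra2[OF subalgebra_data]) measurable
    also have "\<dots> = (\<integral>\<omega>. indicator ?A \<omega> \<partial>M)"
      by (rule Bochner_Integration.integral_cong) auto
    also have "\<dots> = prob (?A \<inter> space M)" by simp
    also have "?A \<inter> space M = ?A" by auto
    finally show ?thesis by (simp only: survival_prob_def)
  qed
  ultimately show ?thesis by simp
qed

end

subsection \<open>The branching recursion\<close>

context brownian_motion
begin

definition killed_mean :: "real ^ 'n \<Rightarrow> (real ^ 'n \<Rightarrow> real) \<Rightarrow> real \<Rightarrow> real" where
  "killed_mean x g s = expectation (\<lambda>\<omega>. of_bool (avoids 1 s x (\<lambda>t. W t \<omega>)) * g (x + W (max 0 s) \<omega>))"

definition killed_expectation :: "real ^ 'n \<Rightarrow> (real ^ 'n \<Rightarrow> real) \<Rightarrow> real" where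
  "killed_expectation x g = (\<integral>s. exponential_density 1 s * killed_mean x g s \<partial>lborel)"

lemma measurable_killed_integrand_of:
  assumes [measurable]: "g \<in> borel_measurable borel"
  shows "(\<lambda>(s, \<omega>). of_bool (avoids 1 s x (\<lambda>t. W t \<omega>)) * g (x + W (max 0 s) \<omega>) :: real)
    \<in> borel_measurable (borel \<Otimes>\<^sub>M M)"
proof -
  have [measurable]: "Measurable.pred (borel \<Otimes>\<^sub>M M) (\<lambda>p. avoids 1 (fst p) x (\<lambda>t. W t (snd p)))"
    by (rule pred_avoids) measurable
  have [measurable]: "(\<lambda>p. W (max 0 (fst p)) (snd p)) \<in> borel_measurable (borel \<Otimes>\<^sub>M M)"
    using measurable_joint by (simp add: case_prod_beta)
  have "(\<lambda>p. of_bool (avoids 1 (fst p) x (\<lambda>t. W t (snd p))) * g (x + W (max 0 (fst p)) (snd p)) :: real)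
      \<in> borel_measurable (borel \<Otimes>\<^sub>M M)" by measurable
  then show ?thesis by (simp add: case_prod_beta)
qed

lemma measurable_killed_mean:
  assumes "g \<in> borel_measurable borel"
  shows "killed_mean x g \<in> borel_measurable borel"
  unfolding killed_mean_def
  by (rule borel_measurable_lebesgue_integral[OF measurable_killed_integrand_of[OF assms]])

lemma integrable_killed_integrand:
  assumes g: "g \<in> borel_measurable borel" "\<And>y. \<bar>g y\<bar> \<le> (1 :: real)"
  shows "integrable M (\<lambda>\<omega>. of_bool (avoids 1 s x (\<lambda>t. W t \<omega>)) * g (x + W (max 0 s) \<omega>))"
proof (rule integrable_const_bound[where B = 1])
  have "s \<in> space borel" by simp
  from measurable_compose[OF measurable_Pair1'[OF this] measurable_killed_integrand_of[OF g(1)]]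
  show "(\<lambda>\<omega>. of_bool (avoids 1 s x (\<lambda>t. W t \<omega>)) * g (x + W (max 0 s) \<omega>)) \<in> borel_measurable M" by simp
  show "AE \<omega> in M. norm (of_bool (avoids 1 s x (\<lambda>t. W t \<omega>)) * g (x + W (max 0 s) \<omega>)) \<le> 1"
    unfolding real_norm_def by (intro AE_I2 of_bool_times_abs_le g)
qed

lemma killed_mean_abs_le:
  assumes g: "g \<in> borel_measurable borel" "\<And>y. \<bar>g y\<bar> \<le> 1"
  shows "\<bar>killed_mean x g s\<bar> \<le> 1"
proof -
  have "\<bar>killed_mean x g s\<bar> \<le> expectation (\<lambda>_. 1)"
    unfolding killed_mean_def
    by (intro order_trans[OF integral_abs_bound] integral_mono integrable_abs integrable_killed_integrand
        of_bool_times_abs_le g) simp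
  then show ?thesis by (simp add: prob_space)
qed

lemma integrable_killed_mean:
  assumes g: "g \<in> borel_measurable borel" "\<And>y. \<bar>g y\<bar> \<le> 1"
  shows "integrable lborel (\<lambda>s. exponential_density 1 s * killed_mean x g s)"
proof (rule Bochner_Integration.integrable_bound[OF integrable_exponential_density])
  note [measurable] = measurable_killed_mean[OF g(1)]
  show "(\<lambda>s. exponential_density 1 s * killed_mean x g s) \<in> borel_measurable lborel" by measurable
  show "AE s in lborel. norm (exponential_density 1 s * killed_mean x g s) \<le> norm (exponential_density 1 s)"
    using killed_mean_abs_le[OF g] by (auto intro!: AE_I2 mult_left_le simp: abs_mult)
qed

text \<open>The endpoint of an avoiding path lies outside the unit ball, so the integrands need to
  be compared only there. The constant \<open>c\<close> is not amplified because the total mass is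
  at most \<open>1\<close>.\<close>

lemma killed_expectation_le:
  assumes g: "g \<in> borel_measurable borel" "\<And>y. \<bar>g y\<bar> \<le> 1" and h: "h \<in> borel_measurable borel" "\<And>y. \<bar>h y\<bar> \<le> 1"
    and le: "\<And>y. 1 < norm y \<Longrightarrow> g y \<le> h y + c" and c: "0 \<le> c"
  shows "killed_expectation x g \<le> killed_expectation x h + c"
proof -
  have pw: "killed_mean x g s \<le> killed_mean x h s + c" for s
  proof -
    have "killed_mean x g s \<le> expectation (\<lambda>\<omega>. of_bool (avoids 1 s x (\<lambda>t. W t \<omega>)) * h (x + W (max 0 s) \<omega>) + c)"
      unfolding killed_mean_def
    proof (intro integral_mono integrable_killed_integrand g Bochner_Integration.integrable_add h)
      fix \<omega>
      show "of_bool (avoids 1 s x (\<lambda>t. W t \<omega>)) * g (x + W (max 0 s) \<omega>) \<le>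
          of_bool (avoids 1 s x (\<lambda>t. W t \<omega>)) * h (x + W (max 0 s) \<omega>) + c"
        using le[OF avoids_end[of 1 s x "\<lambda>t. W t \<omega>"]] c by (auto simp: of_bool_def)
    qed simp
    also have "\<dots> = killed_mean x h s + c"
      using integrable_killed_integrand[OF h] by (simp add: prob_space killed_mean_def)
    finally show ?thesis .
  qed
  have "killed_expectation x g \<le> (\<integral>s. exponential_density 1 s * killed_mean x h s + c * exponential_density 1 s \<partial>lborel)"
    unfolding killed_expectation_def
  proof (intro integral_mono integrable_killed_mean g Bochner_Integration.integrable_add h integrable_mult_right
      integrable_exponential_density)
    fix s :: real
    have "exponential_density 1 s * killed_mean x g s \<le> exponential_density 1 s * (killed_mean x h s + c)"
      by (intro mult_left_mono pw exponential_density_nonneg)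
    then show "exponential_density 1 s * killed_mean x g s \<le>
        exponential_density 1 s * killed_mean x h s + c * exponential_density 1 s"
      by (simp add: algebra_simps)
  qed
  also have "\<dots> = killed_expectation x h + c"
    using integrable_killed_mean[OF h] integrable_exponential_density integral_exponential_density
    by (simp add: killed_expectation_def)
  finally show ?thesis .
qed

end

context branching_brownian_motion
begin

definition subtrees_prob :: "nat \<Rightarrow> real ^ 'n \<Rightarrow> real" where
  "subtrees_prob n y = subtree_prob n True y * subtree_prob n False y"

lemma measurable_subtree_prob [measurable]: "subtree_prob n b \<in> borel_measurable borel"
proof -
  interpret B: branching_brownian_motion M "\<lambda>u. W (u @ [b])" "\<lambda>u. L (u @ [b])" "\<lambda>u. \<xi> (u @ [b])"
    by unfold_locales (rule critical_binary_bbm_subtree)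
  show ?thesis unfolding subtree_prob_def by (rule B.measurable_survival_prob)
qed

lemma subtree_prob_range: "0 \<le> subtree_prob n b x" "subtree_prob n b x \<le> 1"
  by (simp_all add: subtree_prob_def survival_prob_def)

lemma measurable_subtrees_prob [measurable]: "subtrees_prob n \<in> borel_measurable borel"
  unfolding subtrees_prob_def by measurable

lemma subtrees_prob_range: "0 \<le> subtrees_prob n y" "subtrees_prob n y \<le> 1"
  using subtree_prob_range by (auto simp: subtrees_prob_def intro: mult_le_one)

text \<open>The first of three disintegrations. The life of the root is frozen and everything below
  it integrated out; the two subtrees are independent of the root and of each other, which yields
  the product \<open>subtrees_prob\<close>.\<close>

lemma survival_prob_root_step:
  "survival_prob M W L \<xi> (Suc n) x = expectation (\<lambda>\<omega>. of_bool (avoids 1 (L [] \<omega>) x (\<lambda>t. W [] t \<omega>)) *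
     (if \<xi> [] \<omega> then subtrees_prob n (x + W [] (L [] \<omega>) \<omega>) else 1))"
proof -
  define R where "R = data {[]}"
  define S where "S = data (- {[]})"
  define A where "A \<omega> \<longleftrightarrow> avoids 1 (L [] \<omega>) x (\<lambda>t. W [] t \<omega>)" for \<omega>
  define X where "X \<omega> = x + W [] (L [] \<omega>) \<omega>" for \<omega>
  define Z where "Z p = (of_bool (A (fst p) \<and> (\<xi> [] (fst p) \<longrightarrow> (\<forall>b. subtree_survives n b (X (fst p)) (snd p)))) :: real)" for p
  interpret R: particle_data R "{[]}" W L \<xi> unfolding R_def by (rule particle_data)
  have [measurable]: "L [] \<in> borel_measurable R" "Measurable.pred R (\<xi> [])"
    using R.lifetime R.branching by auto
  have XR[measurable]: "X \<in> borel_measurable R"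
    unfolding X_def using R.measurable_death_displacement[of "[]"] by simp
  have [measurable]: "Measurable.pred R A"
    unfolding A_def by (rule continuous_process.pred_avoids[OF R.process]) auto
  have [measurable]: "Measurable.pred (R \<Otimes>\<^sub>M S) (\<lambda>p. subtree_survives n b (X (fst p)) (snd p))" for b
  proof -
    have sub: "subtree_words b \<subseteq> - {[]}" by (auto simp: subtree_words_def)
    have "(\<lambda>p. (X (fst p), snd p)) \<in> measurable (R \<Otimes>\<^sub>M S) (borel \<Otimes>\<^sub>M S)" by measurable
    from measurable_compose[OF this pred_subtree_survives[OF sub, of n, folded S_def]]
    show ?thesis by simp
  qed
  have Z: "Z \<in> borel_measurable (R \<Otimes>\<^sub>M S)"
    unfolding Z_def[abs_def] by measurable
  have "survival_prob M W L \<xi> (Suc n) x = expectation (\<lambda>\<omega>. Z (\<omega>, \<omega>))"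
    unfolding survival_prob_def Z_def expectation_of_bool survives_Suc A_def X_def subtree_survives_def by simp
  also have "\<dots> = expectation (\<lambda>\<omega>. expectation (\<lambda>\<omega>'. Z (\<omega>, \<omega>')))"
  proof (rule integral_indep_subalgebras[OF _ _ _ Z])
    show "subalgebra M R" "subalgebra M S" unfolding R_def S_def by (rule subalgebra_data)+
    show "indep_set (sets R) (sets S)" unfolding R_def S_def by (rule indep_data) auto
    show "\<bar>Z (\<omega>, \<omega>')\<bar> \<le> 1" for \<omega> \<omega>' by (simp add: Z_def)
  qed
  also have "\<dots> = expectation (\<lambda>\<omega>. of_bool (A \<omega>) * (if \<xi> [] \<omega> then subtrees_prob n (X \<omega>) else 1))"
  proof (rule Bochner_Integration.integral_cong[OF refl])
    fix \<omega>
    show "expectation (\<lambda>\<omega>'. Z (\<omega>, \<omega>')) = of_bool (A \<omega>) * (if \<xi> [] \<omega> then subtrees_prob n (X \<omega>) else 1)"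
    proof (cases "A \<omega> \<and> \<xi> [] \<omega>")
      case True
      then have "expectation (\<lambda>\<omega>'. Z (\<omega>, \<omega>')) = expectation (\<lambda>\<omega>'. of_bool (\<forall>b. subtree_survives n b (X \<omega>) \<omega>'))"
        by (simp add: Z_def)
      also have "\<dots> = subtrees_prob n (X \<omega>)"
        unfolding expectation_of_bool subtrees_independent subtrees_prob_def by simp
      finally show ?thesis using True by simp
    qed (auto simp: Z_def prob_space)
  qed
  finally show ?thesis unfolding A_def X_def .
qed

text \<open>The second disintegration: the path of the root is integrated out with its lifetime and
  branching mark frozen.\<close>

lemma displacement_independent:
  fixes k :: "real ^ 'n \<Rightarrow> real" and x :: "real ^ 'n"
  assumes k[measurable]: "k \<in> borel_measurable borel" and kb: "\<And>y. \<bar>k y\<bar> \<le> 1"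
  defines "a \<equiv> \<lambda>s. expectation (\<lambda>\<omega>. of_bool (avoids 1 s x (\<lambda>t. W [] t \<omega>)))"
    and "b \<equiv> \<lambda>s. expectation (\<lambda>\<omega>. of_bool (avoids 1 s x (\<lambda>t. W [] t \<omega>)) * k (x + W [] (max 0 s) \<omega>))"
  shows "expectation (\<lambda>\<omega>. of_bool (avoids 1 (L [] \<omega>) x (\<lambda>t. W [] t \<omega>)) *
     (if \<xi> [] \<omega> then k (x + W [] (L [] \<omega>) \<omega>) else 1)) =
    expectation (\<lambda>\<omega>. if \<xi> [] \<omega> then b (L [] \<omega>) else a (L [] \<omega>))"
proof -
  define P where "P = vimage_algebra (space M) (displacement_path (W [])) path_space"
  define Q where "Q = vimage_algebra (space M) (\<lambda>\<omega>. (L [] \<omega>, \<xi> [] \<omega>)) (borel \<Otimes>\<^sub>M count_space UNIV)"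
  have QP: "indep_set (sets Q) (sets P)"
    using bbm unfolding critical_binary_bbm_def P_def Q_def by (blast intro: indep_set_sym)
  have sp: "space P = space M" "space Q = space M" by (simp_all add: P_def Q_def)
  interpret P: continuous_process P "W []"
  proof (rule continuous_processI)
    show "displacement_path (W []) \<in> measurable P path_space"
      unfolding P_def by (rule measurable_vimage_algebra1) (use displacement_path_space in auto)
  qed (rule sp)
  have LQ: "(\<lambda>\<omega>. (L [] \<omega>, \<xi> [] \<omega>)) \<in> measurable Q (borel \<Otimes>\<^sub>M count_space UNIV)"
    unfolding Q_def by (rule measurable_vimage_algebra1) (auto simp: space_pair_measure)
  have [measurable]: "L [] \<in> borel_measurable Q" "Measurable.pred Q (\<xi> [])"
    using measurable_compose[OF LQ measurable_fst] measurable_compose[OF LQ measurable_snd] by simp_all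
  define Z where "Z p = of_bool (avoids 1 (L [] (fst p)) x (\<lambda>t. W [] t (snd p))) *
     (if \<xi> [] (fst p) then k (x + W [] (max 0 (L [] (fst p))) (snd p)) else 1)" for p
  have [measurable]: "Measurable.pred (Q \<Otimes>\<^sub>M P) (\<lambda>p. avoids 1 (L [] (fst p)) x (\<lambda>t. W [] t (snd p)))"
    by (rule P.pred_avoids) measurable
  have "(\<lambda>p. (L [] (fst p), snd p)) \<in> measurable (Q \<Otimes>\<^sub>M P) (borel \<Otimes>\<^sub>M P)" by measurable
  from measurable_compose[OF this P.measurable_joint]
  have [measurable]: "(\<lambda>p. W [] (max 0 (L [] (fst p))) (snd p)) \<in> borel_measurable (Q \<Otimes>\<^sub>M P)" by simp
  have Z: "Z \<in> borel_measurable (Q \<Otimes>\<^sub>M P)" unfolding Z_def[abs_def] by measurable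
  have "expectation (\<lambda>\<omega>. of_bool (avoids 1 (L [] \<omega>) x (\<lambda>t. W [] t \<omega>)) *
     (if \<xi> [] \<omega> then k (x + W [] (L [] \<omega>) \<omega>) else 1)) = expectation (\<lambda>\<omega>. Z (\<omega>, \<omega>))"
    by (rule Bochner_Integration.integral_cong) (use L_pos in \<open>auto simp: Z_def max_def less_imp_le\<close>)
  also have "\<dots> = expectation (\<lambda>\<omega>. expectation (\<lambda>\<omega>'. Z (\<omega>, \<omega>')))"
  proof (rule integral_indep_subalgebras[OF _ _ QP Z])
    show "subalgebra M Q" by (rule subalgebra_of_indep[OF QP sp(2)])
    show "subalgebra M P" by (rule subalgebra_of_indep[OF indep_set_sym[OF QP] sp(1)])
    show "\<bar>Z (\<omega>, \<omega>')\<bar> \<le> 1" for \<omega> \<omega>' using kb by (simp add: Z_def of_bool_def)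
  qed
  also have "\<dots> = expectation (\<lambda>\<omega>. if \<xi> [] \<omega> then b (L [] \<omega>) else a (L [] \<omega>))"
    by (rule Bochner_Integration.integral_cong) (auto simp: Z_def a_def b_def)
  finally show ?thesis .
qed

text \<open>The last disintegration: the mark is a fair coin independent of the lifetime, whence the
  average of \<open>a\<close> and \<open>b\<close>.\<close>

lemma lifetime_branching_independent:
  assumes [measurable]: "a \<in> borel_measurable borel" "b \<in> borel_measurable borel"
    and bd: "\<And>s. \<bar>a s\<bar> \<le> 1" "\<And>s. \<bar>b s\<bar> \<le> (1 :: real)"
  shows "expectation (\<lambda>\<omega>. if \<xi> [] \<omega> then b (L [] \<omega>) else a (L [] \<omega>)) =
    (\<integral>s. exponential_density 1 s * ((a s + b s) / 2) \<partial>lborel)"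
proof -
  define P where "P = vimage_algebra (space M) (L []) borel"
  define Q where "Q = vimage_algebra (space M) (\<xi> []) (count_space UNIV)"
  have PQ: "indep_set (sets P) (sets Q)"
    using bbm unfolding critical_binary_bbm_def P_def Q_def by blast
  have sp: "space P = space M" "space Q = space M" by (simp_all add: P_def Q_def)
  have [measurable]: "L [] \<in> borel_measurable P" "Measurable.pred Q (\<xi> [])"
    unfolding P_def Q_def by (auto intro: measurable_vimage_algebra1)
  define Z where "Z p = (if \<xi> [] (snd p) then b (L [] (fst p)) else a (L [] (fst p)))" for p
  have Z: "Z \<in> borel_measurable (P \<Otimes>\<^sub>M Q)" unfolding Z_def[abs_def] by measurable
  have "expectation (\<lambda>\<omega>. if \<xi> [] \<omega> then b (L [] \<omega>) else a (L [] \<omega>)) = expectation (\<lambda>\<omega>. Z (\<omega>, \<omega>))"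
    by (simp add: Z_def cong: if_cong)
  also have "\<dots> = expectation (\<lambda>\<omega>. expectation (\<lambda>\<omega>'. Z (\<omega>, \<omega>')))"
  proof (rule integral_indep_subalgebras[OF _ _ PQ Z])
    show "subalgebra M P" by (rule subalgebra_of_indep[OF PQ sp(1)])
    show "subalgebra M Q" by (rule subalgebra_of_indep[OF indep_set_sym[OF PQ] sp(2)])
    show "\<bar>Z (\<omega>, \<omega>')\<bar> \<le> 1" for \<omega> \<omega>' using bd by (simp add: Z_def)
  qed
  also have "\<dots> = expectation (\<lambda>\<omega>. (a (L [] \<omega>) + b (L [] \<omega>)) / 2)"
  proof (rule Bochner_Integration.integral_cong[OF refl])
    fix \<omega>
    have "expectation (\<lambda>\<omega>'. Z (\<omega>, \<omega>')) =
        expectation (\<lambda>\<omega>'. a (L [] \<omega>) + (b (L [] \<omega>) - a (L [] \<omega>)) * of_bool (\<xi> [] \<omega>'))"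
      by (rule Bochner_Integration.integral_cong) (auto simp: Z_def)
    also have "\<dots> = a (L [] \<omega>) + (b (L [] \<omega>) - a (L [] \<omega>)) * expectation (\<lambda>\<omega>'. of_bool (\<xi> [] \<omega>'))"
    proof -
      have "integrable M (\<lambda>\<omega>'. of_bool (\<xi> [] \<omega>') :: real)"
        by (rule integrable_const_bound[where B = 1]) auto
      then show ?thesis by (simp add: prob_space)
    qed
    also have "expectation (\<lambda>\<omega>'. of_bool (\<xi> [] \<omega>')) = (1 / 2 :: real)"
      unfolding expectation_of_bool by (rule \<xi>_prob)
    finally show "expectation (\<lambda>\<omega>'. Z (\<omega>, \<omega>')) = (a (L [] \<omega>) + b (L [] \<omega>)) / 2"
      by (simp add: field_simps)
  qed
  also have "\<dots> = (\<integral>s. exponential_density 1 s * ((a s + b s) / 2) \<partial>lborel)"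
    by (rule distributed_integral[OF L_distributed, symmetric]) (auto simp: exponential_density_nonneg)
  finally show ?thesis .
qed

theorem survival_prob_Suc:
  "survival_prob M W L \<xi> (Suc n) x =
    brownian_motion.killed_expectation M (W []) x (\<lambda>y. (1 + subtrees_prob n y) / 2)"
proof -
  interpret brownian_motion M "W []" by (rule brownian_motion_W)
  let ?k = "subtrees_prob n"
  have k: "?k \<in> borel_measurable borel" "\<And>y. \<bar>?k y\<bar> \<le> 1"
    and one: "(\<lambda>_. 1 :: real) \<in> borel_measurable borel" "\<bar>1 :: real\<bar> \<le> 1"
    using subtrees_prob_range by auto
  have a: "expectation (\<lambda>\<omega>. of_bool (avoids 1 s x (\<lambda>t. W [] t \<omega>))) = killed_mean x (\<lambda>_. 1) s" for s
    by (simp add: killed_mean_def)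
  have "survival_prob M W L \<xi> (Suc n) x =
      expectation (\<lambda>\<omega>. if \<xi> [] \<omega> then killed_mean x ?k (L [] \<omega>) else killed_mean x (\<lambda>_. 1) (L [] \<omega>))"
    unfolding survival_prob_root_step displacement_independent[OF k] a unfolding killed_mean_def ..
  also have "\<dots> = (\<integral>s. exponential_density 1 s * ((killed_mean x (\<lambda>_. 1) s + killed_mean x ?k s) / 2) \<partial>lborel)"
    by (rule lifetime_branching_independent) (intro measurable_killed_mean killed_mean_abs_le k one)+
  also have "(\<lambda>s. (killed_mean x (\<lambda>_. 1) s + killed_mean x ?k s) / 2) = killed_mean x (\<lambda>y. (1 + ?k y) / 2)"
  proof
    fix s
    have "(killed_mean x (\<lambda>_. 1) s + killed_mean x ?k s) / 2 =
        expectation (\<lambda>\<omega>. (of_bool (avoids 1 s x (\<lambda>t. W [] t \<omega>)) * 1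
          + of_bool (avoids 1 s x (\<lambda>t. W [] t \<omega>)) * ?k (x + W [] (max 0 s) \<omega>)) / 2)"
      unfolding killed_mean_def
      using integrable_killed_integrand[OF k, of s x] integrable_killed_integrand[OF one, of s x] by simp
    also have "\<dots> = killed_mean x (\<lambda>y. (1 + ?k y) / 2) s"
      unfolding killed_mean_def by (simp add: distrib_left)
    finally show "(killed_mean x (\<lambda>_. 1) s + killed_mean x ?k s) / 2 = killed_mean x (\<lambda>y. (1 + ?k y) / 2) s" .
  qed
  finally show ?thesis by (simp add: killed_expectation_def)
qed

lemma offspring_mean_abs_le: "\<bar>(1 + subtrees_prob n y) / 2\<bar> \<le> 1"
  using subtrees_prob_range[of n y] by simp

lemma survival_prob_0: "survival_prob M W L \<xi> 0 x = 1"
  by (simp add: survival_prob_def survives_def prob_space)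

text \<open>Continuity from above: survival up to generation \<open>n\<close> decreases in
  \<open>n\<close>, and by \<open>num_pioneers_pos_iff\<close> the intersection is the event without
  pioneers.\<close>

lemma survival_prob_tendsto:
  "(\<lambda>n. survival_prob M W L \<xi> n x) \<longlonglongrightarrow> 1 - hitting_prob M W L \<xi> x"
proof -
  interpret particle_data "data UNIV" UNIV W L \<xi> by (rule particle_data)
  define A where "A n = {\<omega> \<in> space M. survives n x (\<lambda>u t. W u t \<omega>) (\<lambda>u. L u \<omega>) (\<lambda>u. \<xi> u \<omega>)}" for n
  have A: "A n \<in> events" for n
    unfolding A_def using pred_slice_data(2)[OF pred_survives[OF refl]] by simp
  have "decseq A"
    by (auto simp: decseq_def A_def survives_def)
  then have "(\<lambda>n. prob (A n)) \<longlonglongrightarrow> prob (\<Inter>n. A n)"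
    using A by (intro finite_Lim_measure_decseq) auto
  moreover have "{\<omega> \<in> space M. 0 < num_pioneers x (\<lambda>u t. W u t \<omega>) (\<lambda>u. L u \<omega>) (\<lambda>u. \<xi> u \<omega>)}
      = space M - (\<Inter>n. A n)"
  proof -
    have "0 < num_pioneers x (\<lambda>u t. W u t \<omega>) (\<lambda>u. L u \<omega>) (\<lambda>u. \<xi> u \<omega>) \<longleftrightarrow> \<omega> \<notin> (\<Inter>n. A n)" if "\<omega> \<in> space M" for \<omega>
    proof -
      have "W u 0 \<omega> = 0" "continuous_on {0..} (\<lambda>t. W u t \<omega>)" for u
        using brownian_motion.W_0[OF brownian_motion_W that] brownian_motion.brownian[OF brownian_motion_W, of u] that
        by (auto simp: standard_brownian_motion_def)
      then show ?thesis
        using num_pioneers_pos_iff[of "\<lambda>u. L u \<omega>" "\<lambda>u t. W u t \<omega>" x "\<lambda>u. \<xi> u \<omega>"] L_pos[OF that] that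
        by (auto simp: A_def)
    qed
    then show ?thesis by auto
  qed
  then have "hitting_prob M W L \<xi> x = 1 - prob (\<Inter>n. A n)"
    unfolding hitting_prob_def using A by (simp add: prob_compl sets.countable_INT'')
  ultimately show ?thesis by (simp add: A_def survival_prob_def)
qed

end

subsection \<open>Identification of the hitting probability\<close>

context hitting_profile
begin

lemma source_abs_le: "\<bar>source y\<bar> \<le> 1"
  using source_range[of y] by simp

lemma killed_expectation_source:
  fixes W :: "real \<Rightarrow> 'w \<Rightarrow> real ^ 4"
  assumes "brownian_motion M W"
  shows "brownian_motion.killed_expectation M W x source = avoidance x"
proof -
  interpret brownian_motion M W by fact
  interpret killed_brownian_motion f f1 C M W ..
  show ?thesis
    unfolding avoidance_eq_killed_value killed_value_def killed_expectation_def killed_mean_def ..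
qed

text \<open>The iteration is monotone, starts at \<open>1\<close> and has \<open>avoidance\<close>
  as a fixed point, so it stays above it. The induction is over all realisations because its
  hypothesis is applied to the subtrees.\<close>

lemma survival_prob_ge_avoidance:
  fixes W :: "bool list \<Rightarrow> real \<Rightarrow> 'w \<Rightarrow> real ^ 4"
  assumes "branching_brownian_motion M W L \<xi>"
  shows "avoidance x \<le> survival_prob M W L \<xi> n x"
  using assms
proof (induction n arbitrary: W L \<xi> x)
  case 0
  then show ?case using branching_brownian_motion.survival_prob_0[OF 0] avoidance_range by simp
next
  case (Suc n)
  interpret branching_brownian_motion M W L \<xi> by fact
  interpret B: brownian_motion M "W []" by (rule brownian_motion_W)
  have "avoidance y \<le> subtree_prob n b y" for b y
    unfolding subtree_prob_def
    by (intro Suc.IH branching_brownian_motion.intro branching_brownian_motion_axioms.intro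
        critical_binary_bbm_subtree prob_space_axioms)
  then have "(avoidance y)\<^sup>2 \<le> subtrees_prob n y" for y
    unfolding subtrees_prob_def power2_eq_square using avoidance_range subtree_prob_range by (intro mult_mono) auto
  then have "source y \<le> (1 + subtrees_prob n y) / 2 + 0" for y by (simp add: source_def)
  then have "B.killed_expectation x source \<le> B.killed_expectation x (\<lambda>y. (1 + subtrees_prob n y) / 2) + 0"
    by (intro B.killed_expectation_le source_abs_le offspring_mean_abs_le) (auto simp del: add_0_right)
  then show ?case
    by (simp add: survival_prob_Suc killed_expectation_source[OF brownian_motion_W])
qed

text \<open>Contraction with an absorbing remainder: near the ball \<open>(1 + avoidance) / 2 \<le> \<theta> < 1\<close>, and far from it
  \<open>1 - avoidance \<le> \<eta>\<close>.\<close>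

lemma survival_prob_le_avoidance:
  assumes "0 < \<eta>" "\<eta> \<le> 1"
  obtains \<theta> where "0 \<le> \<theta>" "\<theta> < 1"
    "\<And>M W L \<xi> n x. branching_brownian_motion M (W :: bool list \<Rightarrow> real \<Rightarrow> 'w \<Rightarrow> real ^ 4) L \<xi> \<Longrightarrow> 1 < norm x \<Longrightarrow>
      survival_prob M W L \<xi> n x \<le> avoidance x + \<eta> + \<theta> ^ n"
proof -
  define R where "R = 1 / \<eta>"
  have R: "1 \<le> R" using assms by (simp add: R_def)
  \<comment> \<open>\<open>m\<close> is the lower bound for \<open>radial\<close> on
    \<open>1 \<le> s \<le> R^2\<close> given by \<open>f_lower\<close> at the outer radius;
    \<open>(1 + avoidance) / 2 = 1 - radial / 2\<close> turns it into
    \<open>\<theta>\<close>.\<close>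
  define m where "m = exp (- ln (R\<^sup>2) / 4) / R\<^sup>2"
  define \<theta> where "\<theta> = 1 - m / 2"
  have "0 < m" using R by (simp add: m_def)
  have "m \<le> exp 0 / 1"
    unfolding m_def using R by (intro frac_le) (auto simp: one_le_power)
  then have \<theta>: "0 \<le> \<theta>" "\<theta> < 1" using \<open>0 < m\<close> by (auto simp: \<theta>_def)
  have near: "(1 + avoidance y) / 2 \<le> \<theta>" if "1 < norm y" "norm y \<le> R" for y :: "real ^ 4"
  proof -
    define s where "s = (norm y)\<^sup>2"
    have s: "1 \<le> s" "s \<le> R\<^sup>2" using that by (auto simp: s_def one_le_power intro: power_mono)
    have "m \<le> exp (- (ln s / 2) / 2) / s"
      unfolding m_def using s R by (intro frac_le) auto
    also have "\<dots> \<le> radial s"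
      unfolding radial_def using s by (intro divide_right_mono f_lower) auto
    finally show ?thesis using that by (simp add: \<theta>_def avoidance_def s_def field_simps)
  qed
  have far: "1 - \<eta> \<le> avoidance y" if "R < norm y" for y :: "real ^ 4"
  proof -
    have y: "1 < norm y" "y \<noteq> 0" using that R by auto
    have "radial ((norm y)\<^sup>2) \<le> 1 / (norm y)\<^sup>2"
      using y by (intro radial_range one_le_norm_power2) simp
    also have "\<dots> \<le> 1 / norm y" using y by (intro frac_le self_le_power) auto
    also have "\<dots> \<le> 1 / R" using that R by (intro frac_le) auto
    finally show ?thesis using y by (simp add: avoidance_def R_def)
  qed
  have "survival_prob M W L \<xi> n x \<le> avoidance x + \<eta> + \<theta> ^ n"
    if "branching_brownian_motion M (W :: bool list \<Rightarrow> real \<Rightarrow> 'w \<Rightarrow> real ^ 4) L \<xi>" "1 < norm x" for M W L \<xi> n x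
    using that
  proof (induction n arbitrary: W L \<xi> x)
    case 0
    interpret branching_brownian_motion M W L \<xi> by fact
    show ?case using avoidance_range[of x] assms survival_prob_0[of x] by simp
  next
    case (Suc n)
    interpret branching_brownian_motion M W L \<xi> by fact
    interpret B: brownian_motion M "W []" by (rule brownian_motion_W)
    have le: "(1 + subtrees_prob n y) / 2 \<le> source y + (\<eta> + \<theta> ^ Suc n)" if y: "1 < norm y" for y
    proof -
      \<comment> \<open>The cap at \<open>1\<close> bounds the half sum of \<open>w\<close> and
        \<open>avoidance\<close> by \<open>(1 + avoidance) / 2\<close>; this half sum is the factor
        that accompanies \<open>w - avoidance\<close> when the difference of squares is
        factored.\<close>
      define c w where "c = \<eta> + \<theta> ^ n" and "w = min 1 (avoidance y + c)"
      have c: "0 \<le> c" using assms \<theta> by (simp add: c_def)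
      have sub: "subtree_prob n b y \<le> w" for b
        unfolding w_def c_def subtree_prob_def
        using Suc.IH[OF branching_brownian_motion.intro[OF prob_space_axioms
              branching_brownian_motion_axioms.intro[OF critical_binary_bbm_subtree]] y, of b]
          subtree_prob_range(2)[of n b y] by (simp add: subtree_prob_def add.assoc)
      have w: "0 \<le> w" "w \<le> 1" "avoidance y \<le> w" "w - avoidance y \<le> c"
        using c avoidance_range[of y] by (auto simp: w_def min_def)
      have "subtrees_prob n y \<le> w * w"
        unfolding subtrees_prob_def using sub subtree_prob_range w by (intro mult_mono) auto
      then have "(1 + subtrees_prob n y) / 2 - source y \<le> (w - avoidance y) * ((w + avoidance y) / 2)"
        by (simp add: source_def power2_eq_square field_simps)
      \<comment> \<open>Near the ball the second factor multiplies
        \<open>c = \<eta> + \<theta>^n\<close> by at most \<open>\<theta>\<close>; far from it the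
        first factor is itself at most \<open>\<eta>\<close>, since
        \<open>w \<le> 1\<close>.\<close>
      also have "\<dots> \<le> \<eta> + \<theta> ^ Suc n"
      proof (cases "norm y \<le> R")
        case True
        have "(w - avoidance y) * ((w + avoidance y) / 2) \<le> c * \<theta>"
          using near[OF y True] w c avoidance_range[of y] by (intro mult_mono) auto
        also have "\<dots> \<le> \<eta> + \<theta> ^ Suc n"
          using \<theta> assms mult_left_mono[of \<theta> 1 \<eta>] by (simp add: c_def algebra_simps)
        finally show ?thesis .
      next
        case False
        have "(w - avoidance y) * ((w + avoidance y) / 2) \<le> \<eta> * 1"
          using far[of y] False w avoidance_range[of y] by (intro mult_mono) auto
        then show ?thesis using \<theta> by (simp add: add_increasing2)
      qed
      finally show ?thesis by linarith
    qed
    have "B.killed_expectation x (\<lambda>y. (1 + subtrees_prob n y) / 2) \<le> B.killed_expectation x source + (\<eta> + \<theta> ^ Suc n)"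
      using assms \<theta> by (intro B.killed_expectation_le source_abs_le offspring_mean_abs_le le) auto
    then show ?case
      by (simp add: survival_prob_Suc killed_expectation_source[OF brownian_motion_W])
  qed
  with \<theta> show thesis by (intro that[of \<theta>]) auto
qed

theorem hitting_prob_eq:
  fixes W :: "bool list \<Rightarrow> real \<Rightarrow> 'w \<Rightarrow> real ^ 4"
  assumes "critical_binary_bbm M W L \<xi>" "1 < norm x"
  shows "hitting_prob M W L \<xi> x = f (ln (norm x)) / (norm x)\<^sup>2"
proof -
  have "prob_space M" using assms(1) by (simp add: critical_binary_bbm_def)
  then have B: "branching_brownian_motion M W L \<xi>"
    using assms(1) by (intro branching_brownian_motion.intro branching_brownian_motion_axioms.intro)
  note lim = branching_brownian_motion.survival_prob_tendsto[OF B, of x]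
  have "avoidance x \<le> 1 - hitting_prob M W L \<xi> x"
    by (rule LIMSEQ_le_const[OF lim]) (use survival_prob_ge_avoidance[OF B] in auto)
  moreover have "1 - hitting_prob M W L \<xi> x \<le> avoidance x + \<eta>" if "0 < \<eta>" for \<eta>
  proof -
    have \<eta>: "0 < min 1 \<eta>" "min 1 \<eta> \<le> 1" using that by auto
    obtain \<theta> where \<theta>: "0 \<le> \<theta>" "\<theta> < 1" "\<And>n. survival_prob M W L \<xi> n x \<le> avoidance x + min 1 \<eta> + \<theta> ^ n"
    proof (rule survival_prob_le_avoidance[OF \<eta>, where 'w = 'w])
      fix \<theta>
      assume a: "0 \<le> \<theta>" "\<theta> < 1"
        "\<And>M W L \<xi> n x. branching_brownian_motion M (W :: bool list \<Rightarrow> real \<Rightarrow> 'w \<Rightarrow> real ^ 4) L \<xi> \<Longrightarrow>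
          1 < norm x \<Longrightarrow> survival_prob M W L \<xi> n x \<le> avoidance x + min 1 \<eta> + \<theta> ^ n"
      show thesis by (rule that[OF a(1,2) a(3)[OF B assms(2)]])
    qed
    have "(\<lambda>n. avoidance x + min 1 \<eta> + \<theta> ^ n) \<longlonglongrightarrow> avoidance x + min 1 \<eta> + 0"
      using \<theta> by (intro tendsto_intros LIMSEQ_power_zero) auto
    then have "1 - hitting_prob M W L \<xi> x \<le> avoidance x + min 1 \<eta> + 0"
      by (rule LIMSEQ_le[OF lim]) (use \<theta>(3) in auto)
    then show ?thesis using min.cobounded2[of 1 \<eta>] by linarith
  qed
  then have "1 - hitting_prob M W L \<xi> x \<le> avoidance x" by (rule field_le_epsilon)
  ultimately have "hitting_prob M W L \<xi> x = radial ((norm x)\<^sup>2)"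
    using assms(2) by (simp add: avoidance_def)
  then show ?thesis
    using assms(2) by (simp add: radial_def ln_realpow)
qed

end

theorem theorem1p7:
  "\<exists>(c_hit :: real) (P :: nat \<Rightarrow> real poly).
     hitting_recursion c_hit P \<and>
     (\<forall>Q. hitting_recursion c_hit Q \<longrightarrow> (\<forall>n\<ge>1. Q n = P n)) \<and>
     (\<forall>(M :: 'w measure) (W :: bool list \<Rightarrow> real \<Rightarrow> 'w \<Rightarrow> real ^ 4) L \<xi> (x :: real \<Rightarrow> real ^ 4).
        critical_binary_bbm M W L \<xi> \<and> (\<forall>r\<ge>0. norm (x r) = r) \<longrightarrow>
          (\<lambda>r. hitting_prob M W L \<xi> (x r)
               - (2 / (r\<^sup>2 * ln r) + (2 * ln (ln r) + c_hit) / (r\<^sup>2 * (ln r)\<^sup>2)))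
            \<in> o[at_top](\<lambda>r. 1 / (r\<^sup>2 * (ln r)\<^sup>2)) \<and>
          (\<forall>N\<ge>1.
            (\<lambda>r. hitting_prob M W L \<xi> (x r)
                 - 1 / r\<^sup>2 * (\<Sum>n=1..N. poly (P n) (ln (ln r)) / (ln r) ^ n))
              \<in> o[at_top](\<lambda>r. 1 / (r\<^sup>2 * (ln r) ^ N))))"
proof -
  obtain f f1 :: "real \<Rightarrow> real" and C where "hitting_profile f f1 C"
    using profile_exists unfolding hitting_profile_def by metis
  then interpret hitting_profile f f1 C .
  \<comment> \<open>\<open>c\<close> is determined by the profile before any probability space is
    fixed, so one constant serves all realisations of the process.\<close>
  obtain c where c: "\<And>P N. hitting_recursion c P \<Longrightarrow> 1 \<le> N \<Longrightarrow>
      (\<lambda>t. f t - (\<Sum>n=1..N. poly (P n) (ln t) / t ^ n)) \<in> o(\<lambda>t. 1 / t ^ N)"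
    using f_expansion by blast
  define P where "P = hitting_poly c"
  have P: "hitting_recursion c P" unfolding P_def by (rule hitting_recursion_hitting_poly)
  have main: "(\<lambda>r. hitting_prob M W L \<xi> (x r) - 1 / r\<^sup>2 * (\<Sum>n=1..N. poly (P n) (ln (ln r)) / (ln r) ^ n))
      \<in> o[at_top](\<lambda>r. 1 / (r\<^sup>2 * (ln r) ^ N))"
    if B: "critical_binary_bbm M W L \<xi>" and x: "\<forall>r\<ge>0. norm (x r) = r" and N: "1 \<le> N"
    for M :: "'w measure" and W :: "bool list \<Rightarrow> real \<Rightarrow> 'w \<Rightarrow> real ^ 4" and L \<xi> and x :: "real \<Rightarrow> real ^ 4" and N
  proof -
    have "(\<lambda>r. f (ln r) - (\<Sum>n=1..N. poly (P n) (ln (ln r)) / (ln r) ^ n)) \<in> o(\<lambda>r. 1 / (ln r) ^ N)"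
      by (rule landau_o.small.compose[OF c[OF P N] ln_at_top])
    then have "(\<lambda>r. 1 / r\<^sup>2 * (f (ln r) - (\<Sum>n=1..N. poly (P n) (ln (ln r)) / (ln r) ^ n)))
        \<in> o(\<lambda>r. 1 / r\<^sup>2 * (1 / (ln r) ^ N))"
      by (rule landau_o.big_small_mult[OF landau_o.big_refl])
    moreover have "\<forall>\<^sub>F r in at_top. 1 / r\<^sup>2 * (f (ln r) - (\<Sum>n=1..N. poly (P n) (ln (ln r)) / (ln r) ^ n)) =
        hitting_prob M W L \<xi> (x r) - 1 / r\<^sup>2 * (\<Sum>n=1..N. poly (P n) (ln (ln r)) / (ln r) ^ n)"
      using eventually_gt_at_top[of 1]
    proof eventually_elim
      case (elim r)
      then show ?case using hitting_prob_eq[OF B, of "x r"] x by (simp add: right_diff_distrib)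
    qed
    ultimately have "(\<lambda>r. hitting_prob M W L \<xi> (x r) - 1 / r\<^sup>2 * (\<Sum>n=1..N. poly (P n) (ln (ln r)) / (ln r) ^ n))
        \<in> o(\<lambda>r. 1 / r\<^sup>2 * (1 / (ln r) ^ N))"
      by (rule landau_o.small.in_cong[THEN iffD1, rotated])
    then show ?thesis by (simp only: times_divide_times_eq mult_1)
  qed
  have second: "(\<lambda>r. hitting_prob M W L \<xi> (x r)
        - (2 / (r\<^sup>2 * ln r) + (2 * ln (ln r) + c) / (r\<^sup>2 * (ln r)\<^sup>2))) \<in> o[at_top](\<lambda>r. 1 / (r\<^sup>2 * (ln r)\<^sup>2))"
    if B: "critical_binary_bbm M W L \<xi>" and x: "\<forall>r\<ge>0. norm (x r) = r"
    for M :: "'w measure" and W :: "bool list \<Rightarrow> real \<Rightarrow> 'w \<Rightarrow> real ^ 4" and L \<xi> and x :: "real \<Rightarrow> real ^ 4"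
  proof -
    have "1 / r\<^sup>2 * (\<Sum>n=1..2. poly (P n) (ln (ln r)) / (ln r) ^ n) =
        2 / (r\<^sup>2 * ln r) + (2 * ln (ln r) + c) / (r\<^sup>2 * (ln r)\<^sup>2)" for r
    proof -
      have "{1..2::nat} = {1, 2}" by auto
      then show ?thesis
        using hitting_recursion_init[OF P] by (simp add: algebra_simps add_divide_distrib)
    qed
    then show ?thesis using main[OF B x, of 2] by simp
  qed
  show ?thesis
    using P hitting_recursion_unique[OF P] main second by (intro exI[of _ c] exI[of _ P]) blast
qed

end
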